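(* Let $\alpha\in(0,1]$, $\lambda>0$, $K\ge 1$ an integer, and $p_1,\dots,p_K>0$ with $p_1+\dots+p_K=1$; put $P_\ell=p_1+\dots+p_\ell$. Let $N^{\alpha,\lambda}$ be a fractional Poisson process of index $\alpha$ and scale $\lambda$, and let each of its events be assigned to one of the classes $1,\dots,K$, independently of each other and of $N^{\alpha,\lambda}$, with probability $p_i$ of being assigned to class $i$. Let $N^{(i)}(t)$ be the number of events in $[0,t]$ assigned to class $i$, and ${\bf N}(t)=(N^{(1)}(t),\dots,N^{(K)}(t))$. Then: (a) For all $s=(s_1,\dots,s_K)\in\mathbb{R}^K$ and $t\ge 0$, $$\mathbb{E}\,e^{s\cdot{\bf N}(t)}=E_\alpha\Big(\lambda^\alpha t^\alpha\sum_{i=1}^K p_i(e^{s_i}-1)\Big).$$ (b) For each $1\le i\le K$, the process $\{N^{(i)}(t)\}_{t\ge 0}$ has the law ${\rm FPP}(\alpha,\lambda p_i^{1/\alpha})$. (c) For each $1\le \ell\le K$, the process $\big\{\sum_{j=1}^\ell N^{(j)}(t)\big\}_{t\ge 0}$ has the law ${\rm FPP}(\alpha,\lambda P_\ell^{1/\alpha})$. (d) For all $t\ge 0$ and $i\ne j$, $${\rm Cov}(N^{(i)}(t),N^{(j)}(t))=p_ip_j\lambda^{2\alpha}t^{2\alpha}\left(\frac{1}{\Gamma(1+2\alpha)}-\frac{1}{(\Gamma(1+\alpha))^2}\right)=p_ip_j\lambda^{2\alpha}\,{\rm Var}(Y_\alpha(t)),$$ where $Y_\alpha$ is the inverse of a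 standard $\alpha$-stable subordinator.
   Context: Mittag-Leffler function: $E_\theta(z)=\sum_{\ell\ge 0} z^\ell/\Gamma(1+\theta\ell)$. Fractional Poisson process: for $\theta\in(0,1]$ and $\lambda>0$, ${\rm FPP}(\theta,\lambda)$ denotes the law of the counting process $N^{\theta,\lambda}(t)=\max\{n\ge 0: X_1+\dots+X_n\le t\}$, $t\ge 0$, where $X_1,X_2,\dots$ are i.i.d. nonnegative random variables with distribution function $F(x)=1-E_\theta(-\lambda^\theta x^\theta)$, $x\ge 0$. For $\theta=1$ this is a Poisson process of rate $\lambda$. Inverse stable subordinator: a standard $\theta$-stable subordinator $L_\theta$, $\theta\in(0,1]$, is a nondecreasing Lévy process with $\mathbb{E}(e^{-tL_\theta(s)})=e^{-st^\theta}$ for $s,t\ge 0$ (so $L_1(s)=s$). Its inverse is $Y_\theta(t)=\inf\{s>0:L_\theta(s)>t\}$, $t\ge 0$ (so $Y_1(t)=t$).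
   Formalization: In (d) the constant is corrected: the bracket should read 2/Γ(1+2α) − 1/Γ(1+α)², not 1/Γ(1+2α) − 1/Γ(1+α)²; for α = 1 the covariance and Var(Y_1(t)) are 0 while the printed bracket is −1/2. *)

theory Defs
  imports "HOL-Probability.Probability"
begin

definition mittag_leffler :: "real \<Rightarrow> real \<Rightarrow> real" where
  "mittag_leffler \<theta> z = (\<Sum>l. z ^ l / Gamma (1 + \<theta> * real l))"

text \<open>
  The law of an \<open>\<nat>\<close>-valued process indexed by \<open>t \<ge> 0\<close>, as a measure on path space with the
  product \<open>\<sigma>\<close>-algebra.  Equality of laws is therefore equality of finite-dimensional distributions.
\<close>

definition path_space :: "(real \<Rightarrow> nat) measure" where
  "path_space = (\<Pi>\<^sub>M t\<in>{0..}. count_space UNIV)"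

definition path :: "(real \<Rightarrow> 'a \<Rightarrow> nat) \<Rightarrow> 'a \<Rightarrow> real \<Rightarrow> nat" where
  "path N \<omega> = (\<lambda>t\<in>{0..}. N t \<omega>)"

definition process_law :: "'a measure \<Rightarrow> (real \<Rightarrow> 'a \<Rightarrow> nat) \<Rightarrow> (real \<Rightarrow> nat) measure" where
  "process_law M N = distr M path_space (path N)"

text \<open>
  \<open>x k\<close> is the (k+1)-st waiting time.  For almost every i.i.d. sequence of waiting times the set
  below is finite; on the exceptional null set \<^const>\<open>Max\<close> has an unspecified constant value.
\<close>

definition renewal_count :: "real \<Rightarrow> (nat \<Rightarrow> real) \<Rightarrow> nat" where
  "renewal_count t x = Max {n. (\<Sum>k<n. x k) \<le> t}"

definition ml_cdf :: "real \<Rightarrow> real \<Rightarrow> real \<Rightarrow> real" where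
  "ml_cdf \<theta> lam x =
     (if x < 0 then 0 else 1 - mittag_leffler \<theta> (- (lam powr \<theta> * x powr \<theta>)))"

text \<open>
  \<open>N\<close> has the law FPP(\<open>\<theta>\<close>, \<open>lam\<close>).  The i.i.d. waiting times are realised as the coordinates of the
  infinite product of their common distribution \<open>\<rho>\<close>, which is determined by its distribution function.
\<close>

definition has_FPP_law :: "'a measure \<Rightarrow> (real \<Rightarrow> 'a \<Rightarrow> nat) \<Rightarrow> real \<Rightarrow> real \<Rightarrow> bool" where
  "has_FPP_law M N \<theta> lam \<longleftrightarrow>
     (\<forall>t\<ge>0. N t \<in> measurable M (count_space UNIV)) \<and>
     (\<exists>\<rho>. real_distribution \<rho> \<and> (\<forall>x. cdf \<rho> x = ml_cdf \<theta> lam x) \<and>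
        process_law M N = process_law (\<Pi>\<^sub>M k\<in>(UNIV :: nat set). \<rho>) renewal_count)"

definition events_of :: "'a measure \<Rightarrow> 'b measure \<Rightarrow> ('a \<Rightarrow> 'b) \<Rightarrow> 'a set set" where
  "events_of M S f = {f -` A \<inter> space M | A. A \<in> sets S}"

text \<open>
  \<open>C n\<close> is the class of the (n+1)-st event of \<open>N\<close>.  The last clause is the mutual independence of
  the whole process \<open>N\<close> (index \<^const>\<open>None\<close>) and of all the \<open>C n\<close> (indices \<open>Some n\<close>).
\<close>

definition independent_classes ::
  "'a measure \<Rightarrow> (real \<Rightarrow> 'a \<Rightarrow> nat) \<Rightarrow> (nat \<Rightarrow> 'a \<Rightarrow> nat) \<Rightarrow> nat \<Rightarrow> (nat \<Rightarrow> real) \<Rightarrow> bool" where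
  "independent_classes M N C K p \<longleftrightarrow>
     (\<forall>n. C n \<in> measurable M (count_space {1..K})) \<and>
     (\<forall>n. \<forall>i\<in>{1..K}. measure M {\<omega> \<in> space M. C n \<omega> = i} = p i) \<and>
     prob_space.indep_sets M
       (case_option (events_of M path_space (path N))
                    (\<lambda>n. events_of M (count_space {1..K}) (C n))) UNIV"

definition class_count ::
  "(real \<Rightarrow> 'a \<Rightarrow> nat) \<Rightarrow> (nat \<Rightarrow> 'a \<Rightarrow> nat) \<Rightarrow> nat \<Rightarrow> real \<Rightarrow> 'a \<Rightarrow> nat" where
  "class_count N C i t \<omega> = card {n. n < N t \<omega> \<and> C n \<omega> = i}"

definition covariance :: "'a measure \<Rightarrow> ('a \<Rightarrow> real) \<Rightarrow> ('a \<Rightarrow> real) \<Rightarrow> real" where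
  "covariance M X Y =
     (\<integral>\<omega>. (X \<omega> - (\<integral>\<omega>. X \<omega> \<partial>M)) * (Y \<omega> - (\<integral>\<omega>. Y \<omega> \<partial>M)) \<partial>M)"

definition levy_process :: "'a measure \<Rightarrow> (real \<Rightarrow> 'a \<Rightarrow> real) \<Rightarrow> bool" where
  "levy_process M L \<longleftrightarrow>
     prob_space M \<and>
     (\<forall>s\<ge>0. L s \<in> borel_measurable M) \<and>
     (AE \<omega> in M. L 0 \<omega> = 0) \<and>
     (\<forall>(n::nat) \<tau>. 0 \<le> \<tau> 0 \<and> mono_on {..n} \<tau> \<longrightarrow>
        prob_space.indep_vars M (\<lambda>_. borel)
          (\<lambda>k \<omega>. L (\<tau> (Suc k)) \<omega> - L (\<tau> k) \<omega>) {..<n}) \<and>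
     (\<forall>s\<ge>0. \<forall>h\<ge>0. distr M borel (\<lambda>\<omega>. L (s + h) \<omega> - L s \<omega>) = distr M borel (L h)) \<and>
     (\<forall>s\<ge>0. \<forall>\<epsilon>>0.
        ((\<lambda>u. measure M {\<omega> \<in> space M. \<bar>L u \<omega> - L s \<omega>\<bar> > \<epsilon>}) \<longlongrightarrow> 0) (at s within {0..})) \<and>
     (\<forall>\<omega>\<in>space M. \<forall>s\<ge>0. continuous (at_right s) (\<lambda>u. L u \<omega>)) \<and>
     (\<forall>\<omega>\<in>space M. \<forall>s>0. \<exists>l. ((\<lambda>u. L u \<omega>) \<longlongrightarrow> l) (at_left s))"

definition stable_subordinator :: "'a measure \<Rightarrow> real \<Rightarrow> (real \<Rightarrow> 'a \<Rightarrow> real) \<Rightarrow> bool" where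
  "stable_subordinator M \<theta> L \<longleftrightarrow>
     levy_process M L \<and>
     (\<forall>\<omega>\<in>space M. mono_on {0..} (\<lambda>s. L s \<omega>)) \<and>
     (\<forall>s\<ge>0. \<forall>t\<ge>0. (\<integral>\<omega>. exp (- t * L s \<omega>) \<partial>M) = exp (- s * t powr \<theta>))"

definition inverse_process :: "(real \<Rightarrow> 'a \<Rightarrow> real) \<Rightarrow> real \<Rightarrow> 'a \<Rightarrow> real" where
  "inverse_process L t \<omega> = Inf {s. s > 0 \<and> L s \<omega> > t}"

end

(*
  If S_n is the n-th arrival time of the renewal process, the Beta integral turns convolution into
  multiplication of power series in t^alpha, so that
    P(S_{n+1} <= t) = sum_m (-1)^m binom(n+m, m) (lam^alpha t^alpha)^{n+m+1} / Gamma(1 + alpha (n+m+1)).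
  All series converge absolutely, and summing against weights w_n gives every law that is needed:
  w_n = z^n yields the generating function of N(t), w_n = 1 and w_n = 2n its factorial moments, and
  w_n = P (1-P)^n the law of a geometric sum of waiting times, which is again Mittag-Leffler, with
  lam replaced by lam P^{1/alpha}.  Keeping only the events of a set of classes of total probability P
  cuts the waiting times into such geometric blocks; by the strong Markov property at the first kept
  event the blocks are i.i.d., so the thinned process is a renewal process with the new waiting-time law.

  For the inverse subordinator, uniqueness of Laplace transforms gives L(s) = s^{1/alpha} L(1) in law,
  hence Y(t) = (t / L(1))^alpha in law, and the negative moments of L(1) are Gamma integrals of its
  Laplace transform.
*)

theory Submission
  imports Defs
begin

section \<open>Mittag-Leffler series and triangular sums\<close>

text \<open>Why the waiting-time family is closed under geometric sums: the Laplace transform of F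
  is phi(s) = lam^alpha / (lam^alpha + s^alpha). In powers of y = (lam/s)^alpha, the coefficients of
  phi^(n+1) are those of (1 + y)^-(n+1), namely (-1)^m binom(n+m, m). A geometric sum has transform
  P phi / (1 - (1-P) phi) = P lam^alpha / (P lam^alpha + s^alpha), again of this form.

  The obstacle is that N is given only through its law on path space: M carries no waiting times, so
  the geometric blocks cannot be formed there. The joint law of the path of N and the classes is
  therefore identified with a law on a product of two i.i.d. sequence spaces, whose coordinates are
  the waiting times and the classes; everything is computed on that product. Expectations are mostly
  taken as nonnegative integrals, for which Tonelli and monotone convergence ask for no prior
  integrability; integrability then comes with the value.\<close>

text \<open>Only the part u >= A of the Euler integral is kept, where u^x >= A^x. As A is arbitrary,
  Gamma (1 + x) outgrows every exponential in x, which makes the Mittag-Leffler series converge for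
  all arguments.\<close>

lemma Gamma_ge_powr_times_exp:
  fixes A x :: real
  assumes "A > 0" "x \<ge> 0"
  shows "A powr x * exp (- A) \<le> Gamma (1 + x)"
proof -
  have lim: "((\<lambda>u. - exp (- u)) \<longlongrightarrow> (0 :: real)) at_top"
    using tendsto_minus[OF filterlim_compose[OF exp_at_bot filterlim_uminus_at_bot_at_top]] by simp
  have "ennreal (A powr x * exp (- A)) = A powr x * (\<integral>\<^sup>+u. ennreal (exp (- u)) * indicator {A..} u \<partial>lborel)"
    by (subst nn_integral_FTC_atLeast[where F = "\<lambda>u. - exp (- u)" and T = 0])
       (use lim in \<open>auto intro!: derivative_eq_intros simp: ennreal_mult\<close>)
  also have "\<dots> = (\<integral>\<^sup>+u. ennreal (A powr x) * (ennreal (exp (- u)) * indicator {A..} u) \<partial>lborel)"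
    by (subst nn_integral_cmult) auto
  also have "\<dots> \<le> (\<integral>\<^sup>+u. ennreal (indicator {0..} u * u powr (1 + x - 1) / exp u) \<partial>lborel)"
    using assms
    by (intro nn_integral_mono)
       (auto simp: indicator_def exp_minus field_simps ennreal_mult[symmetric] intro!: ennreal_leI mult_left_mono powr_mono2)
  also have "\<dots> = ennreal (Gamma (1 + x))"
    using assms by (subst Gamma_conv_nn_integral_real[symmetric]) auto
  finally show ?thesis
    using assms by (subst (asm) ennreal_le_iff) auto
qed

lemma summable_mittag_leffler:
  fixes \<alpha> r :: real
  assumes "0 < \<alpha>"
  shows "summable (\<lambda>l. r ^ l / Gamma (1 + \<alpha> * real l))"
proof -
  \<comment> \<open>Chosen so that \<open>A powr (\<alpha> * l)\<close> is the l-th power of 2 (|r|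
    + 1); the l-th term of the series is then at most exp A / 2^l.\<close>
  define A where "A = (2 * (\<bar>r\<bar> + 1)) powr (1 / \<alpha>)"
  have A: "A > 0" unfolding A_def by auto
  have Aa: "A powr (\<alpha> * real l) = (2 * (\<bar>r\<bar> + 1)) ^ l" for l
    using assms by (simp add: A_def powr_powr powr_realpow)
  show ?thesis
  proof (rule summable_comparison_test')
    show "summable (\<lambda>l. exp A * (1/2 :: real) ^ l)"
      by (intro summable_mult summable_geometric) auto
    fix l :: nat
    have G: "(2 * (\<bar>r\<bar> + 1)) ^ l * exp (- A) \<le> Gamma (1 + \<alpha> * real l)"
      using Gamma_ge_powr_times_exp[OF A, of "\<alpha> * real l"] assms by (simp add: Aa)
    have pos: "Gamma (1 + \<alpha> * real l) > 0"
      using assms by (intro Gamma_real_pos) (simp add: add_pos_nonneg)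
    have "\<bar>r\<bar> ^ l \<le> (\<bar>r\<bar> + 1) ^ l" by (intro power_mono) auto
    also have "\<dots> = exp A * (1/2) ^ l * ((2 * (\<bar>r\<bar> + 1)) ^ l * exp (- A))"
      by (simp only: power_mult_distrib) (simp add: exp_minus field_simps)
    also have "\<dots> \<le> exp A * (1/2) ^ l * Gamma (1 + \<alpha> * real l)"
      using G by (intro mult_left_mono) auto
    finally show "norm (r ^ l / Gamma (1 + \<alpha> * real l)) \<le> exp A * (1/2) ^ l"
      using pos by (simp add: power_abs abs_mult pos_divide_le_eq)
  qed
qed

text \<open>Substituting u = t v gives a Beta integral. The factor a (t - u)^(a-1) is the derivative
  of a power, so the lemma says that the functions t^a / Gamma (1 + a) form a semigroup in a under
  Stieltjes convolution. This is what turns convolutions into index additions below.\<close>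

lemma nn_integral_beta_convolution:
  fixes a b t :: real
  assumes "0 < a" "0 \<le> b" "0 \<le> t"
  shows "(\<integral>\<^sup>+u. ennreal (a * (t - u) powr (a - 1) * u powr b) * indicator {0..t} u \<partial>lborel)
    = ennreal (Gamma (1 + a) * Gamma (1 + b) / Gamma (1 + a + b) * t powr (a + b))"
proof (cases "t = 0")
  case True
  then show ?thesis
    by (subst nn_integral_cong_AE[where v = "\<lambda>_. 0"]) (auto intro!: AE_I[of _ _ "{0}"])
next
  case False
  with assms have t: "t > 0" by simp
  have ap: "Gamma (1 + a) = a * Gamma a"
  proof -
    have "a \<notin> \<int>\<^sub>\<le>\<^sub>0" using assms by (auto dest: nonpos_Ints_nonpos)
    then show ?thesis using Gamma_plus1[of a] by (simp add: add.commute)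
  qed
  have "(\<integral>\<^sup>+u. ennreal (a * (t - u) powr (a - 1) * u powr b) * indicator {0..t} u \<partial>lborel)
    = ennreal t * (\<integral>\<^sup>+u. ennreal (a * (t - t * u) powr (a - 1) * (t * u) powr b) * indicator {0..t} (t * u) \<partial>lborel)"
    using t by (subst nn_integral_real_affine[where c = t and t = 0]) auto
  also have "(\<integral>\<^sup>+u. ennreal (a * (t - t * u) powr (a - 1) * (t * u) powr b) * indicator {0..t} (t * u) \<partial>lborel)
     = (\<integral>\<^sup>+u. ennreal (a * t powr (a - 1 + b)) * (ennreal (u powr (b + 1 - 1) * (1 - u) powr (a - 1)) * indicator {0..1} u) \<partial>lborel)"
  proof (intro nn_integral_cong)
    fix u :: real
    have "(t * u \<in> {0..t}) = (u \<in> {0..1})"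
      using t by (auto simp: zero_le_mult_iff)
    moreover have "a * (t - t * u) powr (a - 1) * (t * u) powr b =
        a * t powr (a - 1 + b) * (u powr (b + 1 - 1) * (1 - u) powr (a - 1))" if "u \<in> {0..1}"
    proof -
      have "(t - t * u) = t * (1 - u)" by (simp add: algebra_simps)
      then show ?thesis using t that by (simp add: powr_mult powr_add)
    qed
    ultimately show "ennreal (a * (t - t * u) powr (a - 1) * (t * u) powr b) * indicator {0..t} (t * u)
      = ennreal (a * t powr (a - 1 + b)) * (ennreal (u powr (b + 1 - 1) * (1 - u) powr (a - 1)) * indicator {0..1} u)"
      using assms by (auto simp: indicator_def ennreal_mult[symmetric])
  qed
  also have "\<dots> = ennreal (a * t powr (a - 1 + b)) * ennreal (Beta (b + 1) a)"
    using assms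
    by (subst nn_integral_cmult, force, subst nn_integral_has_integral_lebesgue'[OF _ has_integral_Beta_real]) auto
  also have "ennreal t * \<dots> = ennreal (t * (a * t powr (a - 1 + b) * Beta (b + 1) a))"
    using assms by (simp add: ennreal_mult'[symmetric] ennreal_mult''[symmetric])
  also have "t * (a * t powr (a - 1 + b) * Beta (b + 1) a) = (t * t powr (a - 1 + b)) * (Gamma (1 + a) * Gamma (1 + b) / Gamma (1 + a + b))"
    by (simp add: Beta_def ap algebra_simps)
  also have "t * t powr (a - 1 + b) = t powr (a + b)"
    using t by (simp add: powr_mult_base)
  finally show ?thesis by (simp add: mult_ac)
qed

text \<open>Fubini for double series. Absolute summability is required along antidiagonals because
  in the applications the terms with i + m = k share the same power of t.\<close>

lemma triangle_sums:
  fixes f :: "nat \<Rightarrow> nat \<Rightarrow> real"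
  assumes "summable (\<lambda>k. \<Sum>i\<le>k. \<bar>f i (k - i)\<bar>)"
  shows "(\<lambda>i. \<Sum>m. f i m) sums (\<Sum>k. \<Sum>i\<le>k. f i (k - i))"
    and "summable (\<lambda>m. \<bar>f i m\<bar>)"
proof -
  have bij: "bij_betw (\<lambda>(k, i). (i, k - i)) (SIGMA k:UNIV. {..k}) (UNIV :: (nat \<times> nat) set)"
    by (rule bij_betwI[where g = "\<lambda>(i, m). (i + m, i)"]) auto
  have "(\<lambda>(k, i). \<bar>f i (k - i)\<bar>) summable_on (SIGMA k:UNIV. {..k})"
    using assms
    by (intro summable_on_SigmaI[where g = "\<lambda>k. \<Sum>i\<le>k. \<bar>f i (k - i)\<bar>"])
       (auto intro!: has_sum_finite summable_nonneg_imp_summable_on sum_nonneg)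
  then have A: "(\<lambda>(i, m). \<bar>f i m\<bar>) summable_on UNIV"
    by (subst summable_on_reindex_bij_betw[OF bij, symmetric]) (simp add: case_prod_unfold)
  then have A1: "(\<lambda>z. norm ((\<lambda>(i, m). f i m) z)) summable_on UNIV"
    by (simp add: case_prod_unfold)
  then have B: "(\<lambda>(i, m). f i m) summable_on UNIV \<times> UNIV"
    using Infinite_Sum.abs_summable_summable[of "\<lambda>(i, m). f i m" UNIV] by simp
  have row: "(\<lambda>m. \<bar>f i m\<bar>) summable_on UNIV" for i
    using A by (intro summable_on_SigmaD1[of "\<lambda>i m. \<bar>f i m\<bar>" UNIV "\<lambda>_. UNIV"]) auto
  show row': "summable (\<lambda>m. \<bar>f i m\<bar>)" for i
    by (rule summable_on_imp_summable[OF row])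
  have "((\<lambda>(i, m). f i m) has_sum (\<Sum>k. \<Sum>i\<le>k. f i (k - i))) (UNIV \<times> UNIV)"
  proof -
    have C: "(\<lambda>(k, i). f i (k - i)) summable_on (SIGMA k:UNIV. {..k})"
      using B summable_on_reindex_bij_betw[OF bij, of "\<lambda>(i, m). f i m"] by (simp add: case_prod_unfold)
    have s: "summable (\<lambda>k. norm (\<Sum>i\<le>k. f i (k - i)))"
      by (rule summable_comparison_test'[OF assms, of 0]) (auto intro: sum_abs)
    have s': "((\<lambda>k. \<Sum>i\<le>k. f i (k - i)) has_sum (\<Sum>k. \<Sum>i\<le>k. f i (k - i))) UNIV"
      by (intro norm_summable_imp_has_sum[OF s] summable_sums[OF summable_norm_cancel[OF s]])
    have "((\<lambda>(k, i). f i (k - i)) has_sum (\<Sum>k. \<Sum>i\<le>k. f i (k - i))) (SIGMA k:UNIV. {..k})"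
      by (rule has_sum_SigmaI[OF _ _ C, where g = "\<lambda>k. \<Sum>i\<le>k. f i (k - i)"])
         (use s' in \<open>auto intro: has_sum_finite\<close>)
    then show ?thesis
      using has_sum_reindex_bij_betw[OF bij, of "\<lambda>(i, m). f i m"] by (simp add: case_prod_unfold)
  qed
  moreover have "((\<lambda>m. f i m) has_sum (\<Sum>m. f i m)) UNIV" for i
    using row'[of i] summable_sums[OF summable_rabs_cancel[OF row'[of i]]]
    by (auto intro: norm_summable_imp_has_sum)
  ultimately have "((\<lambda>i. \<Sum>m. f i m) has_sum (\<Sum>k. \<Sum>i\<le>k. f i (k - i))) UNIV"
    using has_sum_SigmaD[where f = "\<lambda>(i, m). f i m" and B = "\<lambda>_. UNIV"] by fastforce
  then show "(\<lambda>i. \<Sum>m. f i m) sums (\<Sum>k. \<Sum>i\<le>k. f i (k - i))"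
    by (rule has_sum_imp_sums)
qed

section \<open>Waiting times\<close>

locale ml_renewal = real_distribution \<rho> for \<rho> :: "real measure" +
  fixes \<alpha> lam :: real
  assumes index_pos: "0 < \<alpha>" and scale_pos: "0 < lam"
    and cdf_eq: "cdf \<rho> x = ml_cdf \<alpha> lam x"
begin

text \<open>Signs and powers of z are kept outside, so the terms are nonnegative and absolute
  convergence is always convergence of a Mittag-Leffler series at a positive argument.\<close>

definition ml_term :: "nat \<Rightarrow> real \<Rightarrow> real" where
  "ml_term l t = (lam powr \<alpha> * t powr \<alpha>) ^ l / Gamma (1 + \<alpha> * real l)"

lemma Gamma_index_pos: "Gamma (1 + \<alpha> * real l) > 0"
  using index_pos by (intro Gamma_real_pos) (simp add: add_pos_nonneg)

lemma ml_term_nonneg: "0 \<le> ml_term l t"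
  unfolding ml_term_def using Gamma_index_pos[of l] by (intro divide_nonneg_pos) auto

text \<open>Merging the exponents needs a successor index: at t = 0 the zeroth term is 1, whereas
  \<open>0 powr 0\<close> is 0.\<close>

lemma ml_term_Suc:
  "ml_term (Suc l) t = (lam powr \<alpha>) ^ Suc l / Gamma (1 + \<alpha> * real (Suc l)) * t powr (\<alpha> * real (Suc l))"
proof -
  have "(t powr \<alpha>) ^ Suc l = t powr (\<alpha> * real (Suc l))"
    by (subst powr_powr[symmetric], subst powr_realpow') auto
  then show ?thesis by (simp only: ml_term_def power_mult_distrib) simp
qed

lemma borel_measurable_ml_term[measurable]: "ml_term l \<in> borel_measurable borel"
  unfolding ml_term_def by measurable

lemma mittag_leffler_sums:
  "(\<lambda>l. z ^ l * ml_term l t) sums mittag_leffler \<alpha> (lam powr \<alpha> * t powr \<alpha> * z)"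
  using summable_sums[OF summable_mittag_leffler[OF index_pos, of "lam powr \<alpha> * t powr \<alpha> * z"]]
  by (simp add: mittag_leffler_def ml_term_def power_mult_distrib mult_ac)

lemma summable_ml_term: "summable (\<lambda>l. z ^ l * ml_term l t)"
  using mittag_leffler_sums by (auto simp: sums_iff)

lemma summable_ml_term_shift: "summable (\<lambda>l. ml_term (l + n) t)"
  using summable_ignore_initial_segment[OF summable_ml_term[of 1], of n] by simp

lemma cdf_sums:
  assumes "0 \<le> t"
  shows "(\<lambda>m. (-1) ^ m * ml_term (Suc m) t) sums cdf \<rho> t"
proof -
  have "(\<lambda>l. (-1) ^ Suc l * ml_term (Suc l) t) sums
    (mittag_leffler \<alpha> (- (lam powr \<alpha> * t powr \<alpha>)) - 1)"
    using mittag_leffler_sums[of "-1" t] by (subst sums_Suc_iff) (simp add: ml_term_def)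
  from sums_minus[OF this] show ?thesis
    using assms by (simp add: cdf_eq ml_cdf_def)
qed

lemma AE_pos: "AE x in \<rho>. 0 < x"
proof -
  have "cdf \<rho> 0 = 0"
    using cdf_sums[of 0] sums_unique2[OF _ sums_zero] by (simp add: ml_term_Suc)
  then have "emeasure \<rho> {..0} = 0"
    by (simp add: cdf_def emeasure_eq_measure)
  then show ?thesis
    by (intro AE_I[of _ _ "{..0}"]) auto
qed

lemma nn_integral_powr_waiting:
  assumes a: "0 < a" and t: "0 \<le> t"
  shows "(\<integral>\<^sup>+x. ennreal ((t - x) powr a) * indicator {..t} x \<partial>\<rho>)
    = (\<integral>\<^sup>+u. ennreal (a * (t - u) powr (a - 1) * cdf \<rho> u) * indicator {0..t} u \<partial>lborel)"
proof -
  have inner: "ennreal ((t - x) powr a) * indicator {..t} x =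
      (\<integral>\<^sup>+u. ennreal (a * (t - u) powr (a - 1)) * indicator {x..t} u \<partial>lborel)" for x
  proof (cases "x \<le> t")
    case True
    have "(\<integral>\<^sup>+u. ennreal (a * (t - u) powr (a - 1)) * indicator {x..t} u \<partial>lborel)
      = (\<integral>\<^sup>+u. ennreal (a * ((t - x) - u) powr (a - 1)) * indicator {0..t-x} u \<partial>lborel)"
      by (subst nn_integral_real_affine[where c = 1 and t = x])
         (auto intro!: nn_integral_cong simp: indicator_def algebra_simps)
    \<comment> \<open>The inserted factor is 1 except at the single point u = 0; with it the
      integral is the Beta convolution for b = 0.\<close>
    also have "\<dots> = (\<integral>\<^sup>+u. ennreal (a * ((t - x) - u) powr (a - 1) * u powr 0) * indicator {0..t-x} u \<partial>lborel)"
      by (intro nn_integral_cong_AE AE_I[of _ _ "{0}"]) (auto simp: indicator_def)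
    also have "\<dots> = ennreal ((t - x) powr a)"
      using True a Gamma_real_pos[of "1 + a"]
      by (subst nn_integral_beta_convolution) (auto simp: Gamma_eq_zero_iff dest: nonpos_Ints_nonpos)
    finally show ?thesis using True by simp
  qed simp
  have "(\<integral>\<^sup>+x. ennreal ((t - x) powr a) * indicator {..t} x \<partial>\<rho>)
    = (\<integral>\<^sup>+x. (\<integral>\<^sup>+u. ennreal (a * (t - u) powr (a - 1)) * indicator {0..t} u * indicator {x..} u \<partial>lborel) \<partial>\<rho>)"
  proof (rule nn_integral_cong_AE, rule AE_mp[OF AE_pos], intro AE_I2 impI)
    fix x :: real assume "0 < x"
    then show "ennreal ((t - x) powr a) * indicator {..t} x
      = (\<integral>\<^sup>+u. ennreal (a * (t - u) powr (a - 1)) * indicator {0..t} u * indicator {x..} u \<partial>lborel)"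
      unfolding inner by (intro nn_integral_cong) (auto simp: indicator_def)
  qed
  also have "\<dots> = (\<integral>\<^sup>+u. (\<integral>\<^sup>+x. ennreal (a * (t - u) powr (a - 1)) * indicator {0..t} u * indicator {x..} u \<partial>\<rho>) \<partial>lborel)"
  proof (rule pair_sigma_finite.Fubini'[symmetric])
    show "pair_sigma_finite \<rho> lborel"
      by (intro pair_sigma_finite.intro sigma_finite_measure_axioms lborel.sigma_finite_measure_axioms)
    have "(\<lambda>(x, u). ennreal (a * (t - u) powr (a - 1)) * indicator {0..t} u * indicator {x..} u)
      = (\<lambda>z :: real \<times> real. ennreal (a * (t - snd z) powr (a - 1)) * indicator {0..t} (snd z) * (if fst z \<le> snd z then 1 else 0))"
      by (auto simp: indicator_def fun_eq_iff)
    also have "\<dots> \<in> borel_measurable (\<rho> \<Otimes>\<^sub>M lborel)"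
      by measurable
    finally show "(\<lambda>(x, u). ennreal (a * (t - u) powr (a - 1)) * indicator {0..t} u * indicator {x..} u)
      \<in> borel_measurable (\<rho> \<Otimes>\<^sub>M lborel)" .
  qed
  also have "\<dots> = (\<integral>\<^sup>+u. ennreal (a * (t - u) powr (a - 1) * cdf \<rho> u) * indicator {0..t} u \<partial>lborel)"
  proof (rule nn_integral_cong)
    fix u :: real
    have "(\<integral>\<^sup>+x. ennreal (a * (t - u) powr (a - 1)) * indicator {0..t} u * indicator {x..} u \<partial>\<rho>)
      = (\<integral>\<^sup>+x. ennreal (a * (t - u) powr (a - 1)) * indicator {0..t} u * indicator {..u} x \<partial>\<rho>)"
      by (intro nn_integral_cong) (auto simp: indicator_def)
    also have "\<dots> = ennreal (a * (t - u) powr (a - 1)) * indicator {0..t} u * emeasure \<rho> {..u}"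
      by (subst nn_integral_cmult_indicator) auto
    also have "\<dots> = ennreal (a * (t - u) powr (a - 1) * cdf \<rho> u) * indicator {0..t} u"
      using a by (simp add: cdf_def emeasure_eq_measure ennreal_mult mult_ac)
    finally show "(\<integral>\<^sup>+x. ennreal (a * (t - u) powr (a - 1)) * indicator {0..t} u * indicator {x..} u \<partial>\<rho>)
      = ennreal (a * (t - u) powr (a - 1) * cdf \<rho> u) * indicator {0..t} u" .
  qed
  finally show ?thesis .
qed

text \<open>Effect of one more waiting time on a single series term. After integration by parts the
  distribution function is expanded in its alternating series, and the Beta convolution adds the
  indices l + 1 and m + 1.\<close>

lemma has_bochner_integral_ml_term_waiting:
  assumes t: "0 \<le> t"
  shows "has_bochner_integral \<rho> (\<lambda>x. ml_term (Suc l) (t - x) * indicator {..t} x)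
    (\<Sum>m. (-1) ^ m * ml_term (l + m + 2) t)"
proof -
  define a where "a = \<alpha> * real (Suc l)"
  define C where "C = (lam powr \<alpha>) ^ Suc l / Gamma (1 + a)"
  have a: "0 < a" using index_pos by (simp add: a_def)
  have Ga: "Gamma (1 + a) > 0" using a by (intro Gamma_real_pos) simp
  have C: "0 < C" using Ga scale_pos by (simp add: C_def)
  have mt: "ml_term (Suc l) u = C * u powr a" for u by (simp only: ml_term_Suc C_def a_def)
  define g where "g u = a * (t - u) powr (a - 1) * indicator {0..t} u" for u
  have g0: "0 \<le> g u" for u using a by (simp add: g_def)
  have [measurable]: "g \<in> borel_measurable borel" unfolding g_def by measurable
  \<comment> \<open>The value of the m-th Beta convolution. Dividing by C removes the coefficient of
    \<open>ml_term (Suc l)\<close>, which g does not carry.\<close>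
  define J where "J m = ml_term (l + m + 2) t / C" for m
  have J0: "0 \<le> J m" for m unfolding J_def using C ml_term_nonneg by simp
  have hb: "has_bochner_integral lborel (\<lambda>u. g u * ml_term (Suc m) u) (J m)" for m
  proof (rule has_bochner_integral_nn_integral)
    show "AE u in lborel. 0 \<le> g u * ml_term (Suc m) u" using g0 ml_term_nonneg by auto
    define b where "b = \<alpha> * real (Suc m)"
    have b: "0 < b" using index_pos by (simp add: b_def)
    have Gb: "Gamma (1 + b) > 0" using b by (intro Gamma_real_pos) simp
    define D where "D = (lam powr \<alpha>) ^ Suc m / Gamma (1 + b)"
    have D: "0 \<le> D" using Gb by (simp add: D_def)
    have mt: "ml_term (Suc m) u = D * u powr b" for u by (simp only: ml_term_Suc D_def b_def)
    have "(\<integral>\<^sup>+u. ennreal (g u * ml_term (Suc m) u) \<partial>lborel)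
      = (\<integral>\<^sup>+u. ennreal D * (ennreal (a * (t - u) powr (a - 1) * u powr b) * indicator {0..t} u) \<partial>lborel)"
      using D a by (intro nn_integral_cong)
        (auto simp: g_def mt indicator_def ennreal_mult[symmetric] mult_ac)
    also have "\<dots> = ennreal (D * (Gamma (1 + a) * Gamma (1 + b) / Gamma (1 + a + b) * t powr (a + b)))"
      unfolding ennreal_mult'[OF D]
      by (subst nn_integral_cmult, force, subst nn_integral_beta_convolution) (use a b t in simp_all)
    also have "D * (Gamma (1 + a) * Gamma (1 + b) / Gamma (1 + a + b) * t powr (a + b)) = J m"
    proof -
      have ab: "a + b = \<alpha> * real (Suc (Suc (l + m)))" by (simp add: a_def b_def algebra_simps)
      have "ml_term (l + m + 2) t = ml_term (Suc (Suc (l + m))) t" by simp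
      also have "\<dots> = (lam powr \<alpha>) ^ Suc (Suc (l + m)) / Gamma (1 + (a + b)) * t powr (a + b)"
        by (simp only: ml_term_Suc ab)
      finally have "ml_term (l + m + 2) t = (lam powr \<alpha>) ^ Suc l * (lam powr \<alpha>) ^ Suc m / Gamma (1 + a + b) * t powr (a + b)"
        by (simp add: power_add mult_ac add_ac)
      then show ?thesis
        using Ga Gb scale_pos unfolding J_def C_def D_def by (simp add: field_simps)
    qed
    finally show "(\<integral>\<^sup>+u. ennreal (g u * ml_term (Suc m) u) \<partial>lborel) = ennreal (J m)" .
  qed (use J0 in auto)
  define h where "h m u = (-1) ^ m * (g u * ml_term (Suc m) u)" for m u
  have ih: "integrable lborel (h m)" for m
    unfolding h_def using hb[of m] by (auto simp: has_bochner_integral_iff)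
  have nh: "norm (h m u) = g u * ml_term (Suc m) u" for m u
    using g0 ml_term_nonneg by (simp add: h_def abs_mult power_abs)
  have sumJ: "summable J"
    unfolding J_def using summable_ml_term_shift[of "l + 2" t] by (auto simp: add_ac intro!: summable_divide)
  have s1: "AE u in lborel. summable (\<lambda>m. norm (h m u))"
    unfolding nh by (intro always_eventually allI summable_mult) (use summable_ml_term_shift[of 1] in simp)
  have s2: "summable (\<lambda>m. \<integral>u. norm (h m u) \<partial>lborel)"
    unfolding nh using hb sumJ by (simp add: has_bochner_integral_iff)
  have hs: "(\<Sum>m. h m u) = g u * cdf \<rho> u" for u
  proof (cases "0 \<le> u")
    case True
    have "(\<lambda>m. g u * ((-1) ^ m * ml_term (Suc m) u)) sums (g u * cdf \<rho> u)"
      by (intro sums_mult cdf_sums True)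
    then show ?thesis by (simp add: h_def sums_iff mult_ac)
  next
    case False
    then show ?thesis by (simp add: h_def g_def)
  qed
  have int: "integrable lborel (\<lambda>u. g u * cdf \<rho> u)"
    using integrable_suminf[OF ih s1 s2] by (simp add: hs)
  have "(\<lambda>m. (-1) ^ m * J m) sums (\<integral>u. g u * cdf \<rho> u \<partial>lborel)"
    using sums_integral[OF ih s1 s2] hb unfolding hs by (simp add: h_def has_bochner_integral_iff)
  from sums_mult[OF this, of C] C
  have val: "(\<Sum>m. (-1) ^ m * ml_term (l + m + 2) t) = C * (\<integral>u. g u * cdf \<rho> u \<partial>lborel)"
    by (simp add: J_def sums_iff)
  show ?thesis
  proof (rule has_bochner_integral_nn_integral)
    show "AE x in \<rho>. 0 \<le> ml_term (Suc l) (t - x) * indicator {..t} x"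
      using ml_term_nonneg by auto
    have gc: "0 \<le> g u * cdf \<rho> u" for u using g0 by (simp add: cdf_def)
    then show "0 \<le> (\<Sum>m. (-1) ^ m * ml_term (l + m + 2) t)"
      unfolding val using C by simp
    have "(\<integral>\<^sup>+x. ennreal (ml_term (Suc l) (t - x) * indicator {..t} x) \<partial>\<rho>)
      = (\<integral>\<^sup>+x. ennreal C * (ennreal ((t - x) powr a) * indicator {..t} x) \<partial>\<rho>)"
      unfolding mt using C by (intro nn_integral_cong) (auto simp: indicator_def ennreal_mult'')
    also have "\<dots> = ennreal C * (\<integral>\<^sup>+u. ennreal (g u * cdf \<rho> u) \<partial>lborel)"
      by (subst nn_integral_cmult, force, subst nn_integral_powr_waiting[OF a t])
         (auto simp: g_def indicator_def intro!: arg_cong[where f = "\<lambda>x. _ * x"] nn_integral_cong)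
    also have "\<dots> = ennreal (\<Sum>m. (-1) ^ m * ml_term (l + m + 2) t)"
      unfolding val using C gc int by (subst nn_integral_eq_integral) (auto simp: ennreal_mult')
    finally show "(\<integral>\<^sup>+x. ennreal (ml_term (Suc l) (t - x) * indicator {..t} x) \<partial>\<rho>) = \<dots>" .
  qed auto
qed

end

section \<open>Arrival times\<close>

text \<open>An i.i.d. sequence is a first coordinate followed by an independent copy of the
  sequence; this is the basis of first-step decompositions.\<close>

lemma (in sequence_space) nn_integral_case_nat:
  assumes [measurable]: "f \<in> borel_measurable S"
  shows "(\<integral>\<^sup>+\<omega>. f \<omega> \<partial>S) = (\<integral>\<^sup>+x. (\<integral>\<^sup>+\<omega>. f (case_nat x \<omega>) \<partial>S) \<partial>M)"
proof -
  have "(\<integral>\<^sup>+\<omega>. f \<omega> \<partial>S) = (\<integral>\<^sup>+z. f (case z of (s, \<omega>) \<Rightarrow> case_nat s \<omega>) \<partial>(M \<Otimes>\<^sub>M S))"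
    by (subst PiM_iter[symmetric], subst nn_integral_distr) auto
  also have "\<dots> = (\<integral>\<^sup>+x. (\<integral>\<^sup>+\<omega>. f (case_nat x \<omega>) \<partial>S) \<partial>M)"
    by (subst P.nn_integral_fst[symmetric]) auto
  finally show ?thesis .
qed

text \<open>The sum is twice the derivative of (z - 1)^k at z = 1, which vanishes unless k = 1. It
  evaluates the series for the weights 2n.\<close>

lemma alternating_binomial_sum:
  "(\<Sum>n\<le>k. 2 * real n * ((-1) ^ (k - n) * real (k choose n))) = (if k = 1 then 2 else 0)"
proof (cases k)
  case (Suc j)
  have "(\<Sum>n\<le>k. 2 * real n * ((-1) ^ (k - n) * real (k choose n)))
    = (\<Sum>i\<le>j. 2 * real (Suc i) * ((-1) ^ (j - i) * real (Suc j choose Suc i)))"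
    unfolding Suc by (subst sum.atMost_Suc_shift) simp
  also have "\<dots> = 2 * real (Suc j) * (\<Sum>i\<le>j. real (j choose i) * 1 ^ i * (-1) ^ (j - i))"
    unfolding sum_distrib_left
  proof (intro sum.cong refl)
    fix i assume "i \<in> {..j}"
    have "real (Suc i) * real (Suc j choose Suc i) = real (Suc j) * real (j choose i)"
      using Suc_times_binomial[of i j] by (metis of_nat_mult)
    note e = this
    have "2 * real (Suc i) * ((-1) ^ (j - i) * real (Suc j choose Suc i))
      = 2 * (-1) ^ (j - i) * (real (Suc i) * real (Suc j choose Suc i))"
      by (simp only: mult_ac)
    also have "\<dots> = 2 * real (Suc j) * (real (j choose i) * 1 ^ i * (-1) ^ (j - i))"
      unfolding e by (simp only: mult_ac power_one mult_1_right mult_1_left)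
    finally show "2 * real (Suc i) * ((-1) ^ (j - i) * real (Suc j choose Suc i))
      = 2 * real (Suc j) * (real (j choose i) * 1 ^ i * (-1) ^ (j - i))" .
  qed
  also have "(\<Sum>i\<le>j. real (j choose i) * 1 ^ i * (-1) ^ (j - i)) = (1 + (-1)) ^ j"
    by (subst binomial_ring) simp
  finally show ?thesis using Suc by (simp add: power_0_left)
qed simp

context ml_renewal
begin

sublocale seq: sequence_space \<rho>
  by unfold_locales

lemma ml_term_mono: "0 \<le> s \<Longrightarrow> s \<le> t \<Longrightarrow> ml_term l s \<le> ml_term l t"
  unfolding ml_term_def using Gamma_index_pos[of l] index_pos
  by (intro divide_right_mono power_mono mult_left_mono powr_mono2) auto

text \<open>A binomial coefficient is at most a power of 2, and that power is absorbed into the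
  argument of the Mittag-Leffler series.\<close>

lemma summable_binomial_ml_term:
  "summable (\<lambda>k. real ((n + k) choose k) * ml_term (Suc (n + k)) t)"
proof (rule summable_comparison_test')
  show "summable (\<lambda>k. 2 ^ (k + Suc n) * ml_term (k + Suc n) t)"
    by (rule summable_ignore_initial_segment[OF summable_ml_term])
  fix k :: nat
  have "real ((n + k) choose k) \<le> 2 ^ (n + k)"
    using binomial_le_pow2[of "n + k" k] of_nat_mono by fastforce
  also have "\<dots> \<le> 2 ^ (k + Suc n)" by (intro power_increasing) auto
  finally show "norm (real ((n + k) choose k) * ml_term (Suc (n + k)) t) \<le> 2 ^ (k + Suc n) * ml_term (k + Suc n) t"
    using ml_term_nonneg[of "Suc (n + k)" t] by (simp add: add.commute mult_right_mono)
qed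

definition arrival_cdf :: "nat \<Rightarrow> real \<Rightarrow> real" where
  "arrival_cdf n t = measure seq.S {x \<in> space seq.S. (\<Sum>k<n. x k) \<le> t}"

lemma AE_waiting_pos: "AE x in seq.S. \<forall>k. 0 < x k"
  unfolding AE_all_countable by (intro allI seq.AE_component AE_pos) auto

lemma arrival_cdf_neg:
  assumes "t < 0"
  shows "arrival_cdf n t = 0"
proof -
  have "AE x in seq.S. \<not> (\<Sum>k<n. x k) \<le> t"
    using AE_waiting_pos
  proof (eventually_elim)
    case (elim x)
    then have "0 \<le> (\<Sum>k<n. x k)" by (intro sum_nonneg) (auto intro: less_imp_le)
    then show ?case using assms by auto
  qed
  then have "measure seq.S {x \<in> space seq.S. (\<Sum>k<n. x k) \<le> t} = measure seq.S {}"
    by (intro seq.P.finite_measure_eq_AE) auto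
  then show ?thesis by (simp add: arrival_cdf_def)
qed

lemma arrival_cdf_0: "0 \<le> t \<Longrightarrow> arrival_cdf 0 t = 1"
  by (simp add: arrival_cdf_def seq.P.prob_space)

text \<open>Renewal equation, obtained by splitting off the first waiting time. The indicator costs
  nothing, since arrival times are almost surely nonnegative, and it confines the induction to
  arguments t - x >= 0, where the series formula holds.\<close>

lemma ennreal_arrival_cdf_Suc:
  "ennreal (arrival_cdf (Suc n) t) = (\<integral>\<^sup>+x. ennreal (arrival_cdf n (t - x) * indicator {..t} x) \<partial>\<rho>)"
proof -
  have e: "ennreal (arrival_cdf n t) = (\<integral>\<^sup>+\<omega>. (if (\<Sum>k<n. \<omega> k) \<le> t then 1 else 0) \<partial>seq.S)" for n t
  proof -
    have "(\<integral>\<^sup>+\<omega>. (if (\<Sum>k<n. \<omega> k) \<le> t then 1 else 0) \<partial>seq.S)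
      = (\<integral>\<^sup>+\<omega>. indicator {x \<in> space seq.S. (\<Sum>k<n. x k) \<le> t} \<omega> \<partial>seq.S)"
      by (intro nn_integral_cong) (auto simp: indicator_def)
    then show ?thesis by (simp add: arrival_cdf_def seq.P.emeasure_eq_measure)
  qed
  have [measurable]: "(\<lambda>\<omega>. if (\<Sum>k<Suc n. \<omega> k) \<le> t then 1 else (0::ennreal)) \<in> borel_measurable seq.S"
    by measurable
  have "ennreal (arrival_cdf (Suc n) t) =
      (\<integral>\<^sup>+x. (\<integral>\<^sup>+\<omega>. (if (\<Sum>k<Suc n. case_nat x \<omega> k) \<le> t then 1 else 0) \<partial>seq.S) \<partial>\<rho>)"
    unfolding e by (subst seq.nn_integral_case_nat) auto
  also have "\<dots> = (\<integral>\<^sup>+x. ennreal (arrival_cdf n (t - x)) \<partial>\<rho>)"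
    unfolding e
    by (intro nn_integral_cong) (auto simp: lessThan_Suc_eq_insert_0 sum.reindex algebra_simps)
  also have "\<dots> = (\<integral>\<^sup>+x. ennreal (arrival_cdf n (t - x) * indicator {..t} x) \<partial>\<rho>)"
    by (intro nn_integral_cong) (auto simp: indicator_def arrival_cdf_neg)
  finally show ?thesis .
qed

text \<open>Each series term is convolved with one more waiting time. On the antidiagonal i + j = k
  all terms carry the sign (-1)^k and the same power of t, so only the binomial coefficients are
  added, and the hockey-stick identity sum_{i<=k} binom(n+i, i) = binom(n+1+k, k) gives the next
  row.\<close>

lemma arrival_cdf_eq:
  assumes "0 \<le> t"
  shows "arrival_cdf (Suc n) t = (\<Sum>m. (-1) ^ m * real ((n + m) choose m) * ml_term (Suc (n + m)) t)"
  using assms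
proof (induction n arbitrary: t)
  case 0
  have "ennreal (arrival_cdf (Suc 0) t) = (\<integral>\<^sup>+x. indicator {..t} x \<partial>\<rho>)"
    unfolding ennreal_arrival_cdf_Suc
    by (intro nn_integral_cong) (auto simp: indicator_def arrival_cdf_0)
  then have "arrival_cdf (Suc 0) t = cdf \<rho> t"
    by (simp add: cdf_def emeasure_eq_measure arrival_cdf_def)
  then show ?case using cdf_sums[OF 0] by (simp add: sums_iff)
next
  case (Suc n)
  define a where "a m = (-1) ^ m * real ((n + m) choose m)" for m
  have abs_a: "\<bar>a m\<bar> = real ((n + m) choose m)" for m by (simp add: a_def abs_mult power_abs)
  define h where "h m x = a m * (ml_term (Suc (n + m)) (t - x) * indicator {..t} x)" for m x
  note hb = has_bochner_integral_ml_term_waiting[OF Suc.prems]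
  have ih: "integrable \<rho> (h m)" for m
    unfolding h_def using hb[of "n + m"] by (simp add: has_bochner_integral_iff)
  have nh: "norm (h m x) = \<bar>a m\<bar> * (ml_term (Suc (n + m)) (t - x) * indicator {..t} x)" for m x
    using ml_term_nonneg by (simp add: h_def abs_mult)
  \<comment> \<open>For x > 0 monotonicity replaces t - x by t, giving a summable bound that does
    not depend on x.\<close>
  have nh_le: "norm (h m x) \<le> \<bar>a m\<bar> * ml_term (Suc (n + m)) t" if "0 < x" for m x
    using that ml_term_mono[of "t - x" t] ml_term_nonneg
    unfolding nh by (intro mult_left_mono) (auto simp: indicator_def)
  have sT: "summable (\<lambda>m. \<bar>a m\<bar> * ml_term (Suc (n + m)) t)"
    unfolding abs_a by (rule summable_binomial_ml_term)
  have s1: "AE x in \<rho>. summable (\<lambda>m. norm (h m x))"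
    using AE_pos
  proof eventually_elim
    case (elim x)
    then show ?case by (intro summable_comparison_test'[OF sT, of 0]) (use nh_le in auto)
  qed
  have s2: "summable (\<lambda>m. \<integral>x. norm (h m x) \<partial>\<rho>)"
  proof (rule summable_comparison_test'[OF sT, of 0])
    fix m
    have "(\<integral>x. norm (h m x) \<partial>\<rho>) \<le> \<bar>a m\<bar> * ml_term (Suc (n + m)) t"
    proof (rule integral_le_const)
      show "AE x in \<rho>. norm (h m x) \<le> \<bar>a m\<bar> * ml_term (Suc (n + m)) t"
        using AE_pos by eventually_elim (rule nh_le)
    qed (use ih in auto)
    then show "norm (\<integral>x. norm (h m x) \<partial>\<rho>) \<le> \<bar>a m\<bar> * ml_term (Suc (n + m)) t" by simp
  qed
  define f where "f m j = a m * ((-1) ^ j * ml_term (n + m + j + 2) t)" for m j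
  have int_h: "integral\<^sup>L \<rho> (h m) = (\<Sum>j. f m j)" for m
  proof -
    have "summable (\<lambda>j. (-1) ^ j * ml_term (n + m + j + 2) t)"
      by (rule summable_comparison_test'[OF summable_ml_term_shift[of "n + m + 2" t], of 0])
         (use ml_term_nonneg in \<open>auto simp: abs_mult power_abs add_ac\<close>)
    then show ?thesis
      unfolding h_def f_def using hb[of "n + m"]
      by (simp add: has_bochner_integral_iff suminf_mult)
  qed
  have hs: "(\<Sum>m. h m x) = arrival_cdf (Suc n) (t - x) * indicator {..t} x" for x
  proof (cases "x \<le> t")
    case True
    then show ?thesis by (simp add: h_def Suc.IH a_def mult_ac)
  qed (simp add: h_def)
  have "ennreal (arrival_cdf (Suc (Suc n)) t) = (\<integral>\<^sup>+x. ennreal (\<Sum>m. h m x) \<partial>\<rho>)"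
    unfolding ennreal_arrival_cdf_Suc hs ..
  also have "\<dots> = ennreal (\<integral>x. (\<Sum>m. h m x) \<partial>\<rho>)"
    by (intro nn_integral_eq_integral integrable_suminf ih s1 s2) (auto simp: hs arrival_cdf_def)
  finally have "arrival_cdf (Suc (Suc n)) t = (\<integral>x. (\<Sum>m. h m x) \<partial>\<rho>)"
    by (subst (asm) ennreal_inj) (auto simp: hs arrival_cdf_def)
  also have "\<dots> = (\<Sum>m. \<Sum>j. f m j)"
    by (subst integral_suminf[OF ih s1 s2]) (simp add: int_h)
  also have "\<dots> = (\<Sum>k. \<Sum>i\<le>k. f i (k - i))"
  proof -
    have "(\<Sum>i\<le>k. \<bar>f i (k - i)\<bar>) = real ((Suc n + k) choose k) * ml_term (Suc (Suc n + k)) t" for k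
    proof -
      have "(\<Sum>i\<le>k. \<bar>f i (k - i)\<bar>) = (\<Sum>i\<le>k. real ((n + i) choose i) * ml_term (Suc (Suc n + k)) t)"
        using ml_term_nonneg by (intro sum.cong) (auto simp: f_def abs_mult abs_a power_abs)
      also have "\<dots> = real ((Suc n + k) choose k) * ml_term (Suc (Suc n + k)) t"
        using sum_choose_lower[of n k] by (simp add: sum_distrib_right[symmetric] flip: of_nat_sum)
      finally show ?thesis .
    qed
    then have "summable (\<lambda>k. \<Sum>i\<le>k. \<bar>f i (k - i)\<bar>)"
      using summable_binomial_ml_term[of "Suc n" t] by simp
    from triangle_sums(1)[OF this] show ?thesis by (simp add: sums_iff)
  qed
  also have "(\<lambda>k. \<Sum>i\<le>k. f i (k - i)) = (\<lambda>k. (-1) ^ k * real ((Suc n + k) choose k) * ml_term (Suc (Suc n + k)) t)"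
  proof
    fix k
    have "(\<Sum>i\<le>k. f i (k - i)) = (\<Sum>i\<le>k. real ((n + i) choose i) * ((-1) ^ k * ml_term (Suc (Suc n + k)) t))"
    proof (intro sum.cong refl)
      fix i assume "i \<in> {..k}"
      then have "(-1) ^ i * (-1) ^ (k - i) = (-1 :: real) ^ k" and "n + i + (k - i) + 2 = Suc (Suc n + k)"
        by (simp_all flip: power_add)
      then show "f i (k - i) = real ((n + i) choose i) * ((-1) ^ k * ml_term (Suc (Suc n + k)) t)"
        unfolding f_def a_def by (metis mult.assoc mult.commute)
    qed
    also have "\<dots> = (-1) ^ k * real ((Suc n + k) choose k) * ml_term (Suc (Suc n + k)) t"
      unfolding sum_distrib_right[symmetric] of_nat_sum[symmetric] sum_choose_lower by (simp add: mult_ac)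
    finally show "(\<Sum>i\<le>k. f i (k - i)) = (-1) ^ k * real ((Suc n + k) choose k) * ml_term (Suc (Suc n + k)) t" .
  qed
  finally show ?case .
qed

text \<open>After exchanging the sums, the coefficient of \<open>ml_term (Suc k) t\<close> is the
  k-th finite difference of w at 0. It is (z - 1)^k for w n = z^n and vanishes for large k when w is
  a polynomial. The growth bound R^n keeps the absolute antidiagonal sums below (R + 1)^k, by the
  binomial theorem.\<close>

lemma weighted_arrival_cdf_sums:
  assumes t: "0 \<le> t" and w: "\<And>n. 0 \<le> w n" "\<And>n. w n \<le> R ^ n"
  shows "(\<lambda>n. w n * arrival_cdf (Suc n) t) sums
    (\<Sum>k. (\<Sum>n\<le>k. w n * ((-1) ^ (k - n) * real (k choose n))) * ml_term (Suc k) t)"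
proof -
  define f where "f n m = w n * ((-1) ^ m * real ((n + m) choose m) * ml_term (Suc (n + m)) t)" for n m
  have R: "0 \<le> R" using w[of 1] by simp
  have "summable (\<lambda>k. \<Sum>n\<le>k. \<bar>f n (k - n)\<bar>)"
  proof (rule summable_comparison_test')
    show "summable (\<lambda>k. (R + 1) ^ (k + 1) * ml_term (k + 1) t)"
      by (rule summable_ignore_initial_segment[OF summable_ml_term])
    fix k :: nat
    have "(\<Sum>n\<le>k. \<bar>f n (k - n)\<bar>) = (\<Sum>n\<le>k. w n * real (k choose n)) * ml_term (Suc k) t"
      unfolding sum_distrib_right using ml_term_nonneg w
      by (intro sum.cong) (auto simp: f_def abs_mult power_abs binomial_symmetric[symmetric])
    also have "(\<Sum>n\<le>k. w n * real (k choose n)) \<le> (\<Sum>n\<le>k. real (k choose n) * R ^ n * 1 ^ (k - n))"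
      using w by (intro sum_mono) (simp add: mult.commute mult_left_mono)
    also have "\<dots> = (R + 1) ^ k" by (subst binomial_ring) simp
    also have "\<dots> \<le> (R + 1) ^ (k + 1)" using R by (intro power_increasing) auto
    finally show "norm (\<Sum>n\<le>k. \<bar>f n (k - n)\<bar>) \<le> (R + 1) ^ (k + 1) * ml_term (k + 1) t"
      using ml_term_nonneg[of "Suc k" t] by (simp add: mult_right_mono sum_nonneg)
  qed
  note tri = triangle_sums[OF this]
  have "(\<Sum>m. f n m) = w n * arrival_cdf (Suc n) t" for n
  proof -
    have "summable (\<lambda>m. (-1) ^ m * real ((n + m) choose m) * ml_term (Suc (n + m)) t)"
      by (rule summable_comparison_test'[OF summable_binomial_ml_term[of n t], of 0])
         (use ml_term_nonneg in \<open>auto simp: abs_mult power_abs\<close>)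
    then show ?thesis unfolding f_def arrival_cdf_eq[OF t] by (simp add: suminf_mult)
  qed
  moreover have "(\<Sum>n\<le>k. f n (k - n)) = (\<Sum>n\<le>k. w n * ((-1) ^ (k - n) * real (k choose n))) * ml_term (Suc k) t" for k
    unfolding sum_distrib_right
    by (intro sum.cong) (auto simp: f_def binomial_symmetric[symmetric])
  ultimately show ?thesis using tri(1) by simp
qed

lemma geometric_arrival_cdf_sums:
  assumes "0 \<le> t" "0 \<le> z"
  shows "(\<lambda>n. z ^ n * arrival_cdf (Suc n) t) sums (\<Sum>k. (z - 1) ^ k * ml_term (Suc k) t)"
proof -
  have "(\<Sum>n\<le>k. z ^ n * ((-1) ^ (k - n) * real (k choose n))) = (z - 1) ^ k" for k
    using binomial_ring[of z "-1" k] by (simp add: mult_ac)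
  then show ?thesis
    using weighted_arrival_cdf_sums[of t "\<lambda>n. z ^ n" z] assms by simp
qed

lemma mittag_leffler_minus_1:
  "z * (\<Sum>k. z ^ k * ml_term (Suc k) t) = mittag_leffler \<alpha> (lam powr \<alpha> * t powr \<alpha> * z) - 1"
proof (cases "z = 0")
  case True
  then show ?thesis using mittag_leffler_sums[of 0 t] sums_unique2[OF _ powser_sums_zero, of "\<lambda>l. ml_term l t"]
    by (simp add: mult.commute ml_term_def)
next
  case False
  have "(\<lambda>l. z ^ Suc l * ml_term (Suc l) t) sums (mittag_leffler \<alpha> (lam powr \<alpha> * t powr \<alpha> * z) - 1)"
    using mittag_leffler_sums[of z t] by (subst sums_Suc_iff) (simp add: ml_term_def)
  then have "(\<lambda>l. z * (z ^ l * ml_term (Suc l) t)) sums (mittag_leffler \<alpha> (lam powr \<alpha> * t powr \<alpha> * z) - 1)"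
    by (simp add: mult_ac)
  then show ?thesis
    using False by (subst suminf_mult[symmetric]) (auto simp: sums_iff summable_mult_D)
qed

lemma arrival_cdf_sums_1:
  assumes "0 \<le> t"
  shows "(\<lambda>n. arrival_cdf (Suc n) t) sums ml_term 1 t"
proof -
  have "(\<lambda>k. 0 ^ k * ml_term (Suc k) t) sums ml_term 1 t"
    using powser_sums_zero[of "\<lambda>k. ml_term (Suc k) t"] by (simp add: mult.commute)
  then show ?thesis using geometric_arrival_cdf_sums[OF assms, of 1] by (simp add: sums_iff)
qed

lemma arrival_cdf_sums_2:
  assumes "0 \<le> t"
  shows "(\<lambda>n. 2 * real n * arrival_cdf (Suc n) t) sums (2 * ml_term 2 t)"
proof -
  \<comment> \<open>This supplies the growth bound with R = 2 for the weights 2n.\<close>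
  have "2 * n \<le> 2 ^ n" for n :: nat
  proof (induction n)
    case (Suc n) then show ?case by (cases n) auto
  qed simp
  then have le: "2 * real n \<le> 2 ^ n" for n
    by (metis of_nat_le_iff of_nat_mult of_nat_numeral of_nat_power)
  have "(\<lambda>k. (if k = 1 then 2 else 0) * ml_term (Suc k) t) sums (2 * ml_term 2 t)"
    using sums_single[of 1 "\<lambda>k. 2 * ml_term (Suc k) t"] by (auto simp: if_distrib if_distribR numeral_2_eq_2 cong: if_cong)
  then show ?thesis
    using weighted_arrival_cdf_sums[OF assms, of "\<lambda>n. 2 * real n" 2] le
    by (simp add: alternating_binomial_sum sums_iff)
qed

end

section \<open>The renewal counting process\<close>

text \<open>The duality N(t) >= n iff S_n <= t. Some partial sum above t makes the set under
  \<open>Max\<close> finite, and nonnegative waiting times make it an initial segment.\<close>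

lemma renewal_count_ge_iff:
  fixes x :: "nat \<Rightarrow> real"
  assumes "\<And>k. 0 \<le> x k" "0 \<le> t" "t < (\<Sum>k<m. x k)"
  shows "n \<le> renewal_count t x \<longleftrightarrow> (\<Sum>k<n. x k) \<le> t"
proof -
  let ?A = "{n. (\<Sum>k<n. x k) \<le> t}"
  have mono: "(\<Sum>k<i. x k) \<le> (\<Sum>k<j. x k)" if "i \<le> j" for i j
    using that assms(1) by (intro sum_mono2) auto
  have fin: "finite ?A"
  proof (rule finite_subset)
    show "?A \<subseteq> {..m}"
    proof
      fix n assume "n \<in> ?A"
      then have "\<not> m \<le> n" using assms(3) mono[of m n] by auto
      then show "n \<in> {..m}" by simp
    qed
  qed simp
  have ne: "?A \<noteq> {}" using assms(2) by (auto intro: exI[of _ 0])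
  have "renewal_count t x \<in> ?A"
    unfolding renewal_count_def using Max_in[OF fin ne] .
  then show ?thesis
    unfolding renewal_count_def using mono[of n "Max ?A"] Max_ge[OF fin, of n] by auto
qed

lemma measurable_renewal_count[measurable]:
  assumes "sets \<mu> = sets borel"
  shows "renewal_count t \<in> measurable (Pi\<^sub>M UNIV (\<lambda>_::nat. \<mu>)) (count_space UNIV)"
proof -
  have [measurable_cong]: "sets \<mu> = sets borel" by fact
  show ?thesis unfolding renewal_count_def by measurable
qed

lemma measurable_path:
  assumes "\<And>t. 0 \<le> t \<Longrightarrow> N t \<in> measurable \<mu> (count_space UNIV)"
  shows "path N \<in> measurable \<mu> path_space"
  unfolding path_def path_space_def using assms by (intro measurable_restrict) auto

context ml_renewal
begin

text \<open>The probabilities P(S_{n+1} <= T) are summable in n, hence tend to 0. Integer levels T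
  suffice, so countably many null sets are combined.\<close>

lemma AE_arrivals_unbounded: "AE x in seq.S. \<forall>t. \<exists>n. t < (\<Sum>k<n. x k)"
proof -
  have "AE x in seq.S. \<exists>n. real T < (\<Sum>k<n. x k)" for T :: nat
  proof -
    let ?A = "{x \<in> space seq.S. \<forall>n. (\<Sum>k<n. x k) \<le> real T}"
    have A: "?A \<in> sets seq.S" by measurable
    have "measure seq.S ?A \<le> arrival_cdf (Suc n) (real T)" for n
      unfolding arrival_cdf_def by (intro seq.P.finite_measure_mono) (auto simp del: sum.lessThan_Suc)
    moreover have "(\<lambda>n. arrival_cdf (Suc n) (real T)) \<longlonglongrightarrow> 0"
      using arrival_cdf_sums_1[of "real T"] by (intro summable_LIMSEQ_zero) (auto simp: sums_iff)
    ultimately have "measure seq.S ?A \<le> 0"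
      by (intro LIMSEQ_le_const) auto
    then have "emeasure seq.S ?A = 0"
      by (simp add: seq.P.emeasure_eq_measure measure_le_0_iff)
    then show ?thesis using A by (intro AE_I[of _ _ ?A]) (auto simp: not_less)
  qed
  then have "AE x in seq.S. \<forall>T::nat. \<exists>n. real T < (\<Sum>k<n. x k)"
    by (simp add: AE_all_countable)
  then show ?thesis
  proof eventually_elim
    case (elim x)
    show ?case
    proof
      fix t :: real
      obtain T :: nat where "t \<le> real T" using real_arch_simple by blast
      then show "\<exists>n. t < (\<Sum>k<n. x k)" using elim by (meson le_less_trans)
    qed
  qed
qed

lemma AE_renewal_count_ge_iff:
  assumes "0 \<le> t"
  shows "AE x in seq.S. \<forall>n. n \<le> renewal_count t x \<longleftrightarrow> (\<Sum>k<n. x k) \<le> t"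
  using AE_waiting_pos AE_arrivals_unbounded
proof eventually_elim
  case (elim x)
  then obtain m where "t < (\<Sum>k<m. x k)" by blast
  then show ?case using renewal_count_ge_iff[of x t m] elim(1) assms by (auto intro: less_imp_le)
qed

lemma measurable_renewal_count_S[measurable]: "renewal_count t \<in> measurable seq.S (count_space UNIV)"
  by (rule measurable_renewal_count) simp

text \<open>By duality, the sum of w n over n < N(t) is the sum over all n of w n times the
  indicator of S_{n+1} <= t, and the series is integrated termwise. Any function of N(t) that starts
  at 0 and has increments w is covered.\<close>

lemma has_bochner_integral_renewal_weights:
  assumes t: "0 \<le> t" and w: "\<And>n. 0 \<le> w n"
    and sums: "(\<lambda>n. w n * arrival_cdf (Suc n) t) sums v"
  shows "has_bochner_integral seq.S (\<lambda>x. \<Sum>n<renewal_count t x. w n) v"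
proof (rule has_bochner_integral_nn_integral)
  have nn: "0 \<le> w n * arrival_cdf (Suc n) t" for n
    using w by (simp add: arrival_cdf_def)
  show "0 \<le> v" using sums nn by (auto simp: sums_iff intro: suminf_nonneg)
  show "AE x in seq.S. 0 \<le> (\<Sum>n<renewal_count t x. w n)" using w by (auto intro: sum_nonneg)
  let ?I = "\<lambda>n. indicator {x \<in> space seq.S. (\<Sum>k<Suc n. x k) \<le> t}"
  have "(\<integral>\<^sup>+x. ennreal (\<Sum>n<renewal_count t x. w n) \<partial>seq.S)
    = (\<integral>\<^sup>+x. (\<Sum>n. ennreal (w n) * ?I n x) \<partial>seq.S)"
  proof (rule nn_integral_cong_AE)
    show "AE x in seq.S. ennreal (\<Sum>n<renewal_count t x. w n) = (\<Sum>n. ennreal (w n) * ?I n x)"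
      using AE_renewal_count_ge_iff[OF t] AE_space
    proof eventually_elim
      case (elim x)
      have "(\<Sum>n. ennreal (w n) * ?I n x) = (\<Sum>n<renewal_count t x. ennreal (w n) * ?I n x)"
      proof (rule suminf_finite)
        fix n assume "n \<notin> {..<renewal_count t x}"
        then have "\<not> Suc n \<le> renewal_count t x" by auto
        then show "ennreal (w n) * ?I n x = 0" using elim(1) by (simp del: sum.lessThan_Suc)
      qed simp
      also have "\<dots> = (\<Sum>n<renewal_count t x. ennreal (w n))"
      proof (intro sum.cong refl)
        fix n assume "n \<in> {..<renewal_count t x}"
        then have "Suc n \<le> renewal_count t x" by auto
        then show "ennreal (w n) * ?I n x = ennreal (w n)" using elim by (simp del: sum.lessThan_Suc)
      qed
      finally show ?case using w by (simp add: sum_ennreal)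
    qed
  qed
  also have "\<dots> = (\<Sum>n. ennreal (w n) * emeasure seq.S {x \<in> space seq.S. (\<Sum>k<Suc n. x k) \<le> t})"
    by (subst nn_integral_suminf) (simp_all add: nn_integral_cmult_indicator del: sum.lessThan_Suc)
  also have "\<dots> = (\<Sum>n. ennreal (w n * arrival_cdf (Suc n) t))"
    using w by (simp add: arrival_cdf_def seq.P.emeasure_eq_measure ennreal_mult del: sum.lessThan_Suc)
  also have "\<dots> = ennreal v"
    using sums nn by (subst suminf_ennreal2) (auto simp: sums_iff)
  finally show "(\<integral>\<^sup>+x. ennreal (\<Sum>n<renewal_count t x. w n) \<partial>seq.S) = ennreal v" .
qed measurable

text \<open>From z^N = 1 + (z - 1) (1 + z + ... + z^(N-1)), a form valid at z = 1 as well. For z < 1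
  the factor z - 1 is negative, hence the use of Bochner integrals in the last step.\<close>

lemma has_bochner_integral_power_renewal_count:
  assumes "0 \<le> t" "0 \<le> z"
  shows "has_bochner_integral seq.S (\<lambda>x. z ^ renewal_count t x)
    (mittag_leffler \<alpha> (lam powr \<alpha> * t powr \<alpha> * (z - 1)))"
proof -
  have "has_bochner_integral seq.S (\<lambda>x. \<Sum>n<renewal_count t x. z ^ n) (\<Sum>k. (z - 1) ^ k * ml_term (Suc k) t)"
    using assms geometric_arrival_cdf_sums by (intro has_bochner_integral_renewal_weights) auto
  moreover have "has_bochner_integral seq.S (\<lambda>x. 1 :: real) 1"
    using seq.P.prob_space by (simp add: has_bochner_integral_iff)
  ultimately have "has_bochner_integral seq.S (\<lambda>x. 1 + (z - 1) * (\<Sum>n<renewal_count t x. z ^ n))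
      (1 + (z - 1) * (\<Sum>k. (z - 1) ^ k * ml_term (Suc k) t))"
    by (intro has_bochner_integral_add has_bochner_integral_mult_right)
  then show ?thesis
    by (simp add: mittag_leffler_minus_1 power_diff_1_eq[symmetric])
qed

lemma has_bochner_integral_renewal_count:
  assumes "0 \<le> t"
  shows "has_bochner_integral seq.S (\<lambda>x. real (renewal_count t x)) (ml_term 1 t)"
  using has_bochner_integral_renewal_weights[OF assms, of "\<lambda>_. 1"] arrival_cdf_sums_1[OF assms] by simp

lemma has_bochner_integral_renewal_count_2:
  assumes "0 \<le> t"
  shows "has_bochner_integral seq.S (\<lambda>x. real (renewal_count t x) * (real (renewal_count t x) - 1)) (2 * ml_term 2 t)"
proof -
  have "(\<Sum>n<k. 2 * real n) = real k * (real k - 1)" for k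
    by (induction k) (auto simp: algebra_simps)
  then show ?thesis
    using has_bochner_integral_renewal_weights[OF assms, of "\<lambda>n. 2 * real n"] arrival_cdf_sums_2[OF assms] by simp
qed

end

section \<open>Thinning of a renewal process\<close>

definition drop_seq :: "nat \<Rightarrow> (nat \<Rightarrow> 'b) \<Rightarrow> nat \<Rightarrow> 'b" where
  "drop_seq m x = (\<lambda>k. x (k + m))"

lemma drop_seq_0 [simp]: "drop_seq 0 x = x"
  by (simp add: drop_seq_def)

lemma drop_seq_drop_seq [simp]: "drop_seq m (drop_seq n x) = drop_seq (m + n) x"
  by (simp add: drop_seq_def add.assoc)

lemma drop_seq_comb_seq [simp]: "drop_seq m (comb_seq m \<omega> \<omega>') = \<omega>'"
  by (simp add: drop_seq_def comb_seq_def)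

context sequence_space
begin

lemma measurable_drop_seq [measurable]: "drop_seq m \<in> measurable S S"
  unfolding drop_seq_def by (rule measurable_PiM_single') (auto simp: space_PiM)

text \<open>Markov property at the fixed time m: the hypothesis on \<open>comb_seq\<close> says that
  u depends on the first m coordinates only, and the remaining coordinates are an independent copy
  of the whole sequence.\<close>

lemma nn_integral_drop_seq:
  assumes [measurable]: "u \<in> borel_measurable S" "v \<in> borel_measurable S"
    and u: "\<And>\<omega> \<omega>'. u (comb_seq m \<omega> \<omega>') = u \<omega>"
  shows "(\<integral>\<^sup>+\<omega>. u \<omega> * v (drop_seq m \<omega>) \<partial>S) = (\<integral>\<^sup>+\<omega>. u \<omega> \<partial>S) * (\<integral>\<^sup>+\<omega>. v \<omega> \<partial>S)"
proof -
  have "(\<integral>\<^sup>+\<omega>. u \<omega> * v (drop_seq m \<omega>) \<partial>S) = (\<integral>\<^sup>+z. (case z of (\<omega>, \<omega>') \<Rightarrow> u \<omega> * v \<omega>') \<partial>(S \<Otimes>\<^sub>M S))"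
    by (subst PiM_comb_seq[of m, symmetric], subst nn_integral_distr)
       (auto intro!: nn_integral_cong measurable_comb_seq simp: u)
  also have "\<dots> = (\<integral>\<^sup>+\<omega>. (\<integral>\<^sup>+\<omega>'. u \<omega> * v \<omega>' \<partial>S) \<partial>S)"
    by (subst P.nn_integral_fst[symmetric]) auto
  also have "\<dots> = (\<integral>\<^sup>+\<omega>. u \<omega> \<partial>S) * (\<integral>\<^sup>+\<omega>. v \<omega> \<partial>S)"
    by (simp add: nn_integral_cmult nn_integral_multc)
  finally show ?thesis .
qed

lemma nn_integral_drop_seq_1:
  assumes [measurable]: "v \<in> borel_measurable S"
  shows "(\<integral>\<^sup>+\<omega>. v (drop_seq m \<omega>) \<partial>S) = (\<integral>\<^sup>+\<omega>. v \<omega> \<partial>S)"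
  using nn_integral_drop_seq[of "\<lambda>_. 1" v m] by (simp add: P.emeasure_space_1)

lemma nn_integral_prod_coordinates:
  assumes [measurable]: "\<And>k. g k \<in> borel_measurable M"
  shows "(\<integral>\<^sup>+\<omega>. (\<Prod>k<n. g k (\<omega> k)) \<partial>S) = (\<Prod>k<n. \<integral>\<^sup>+x. g k x \<partial>M)"
  using assms
proof (induction n arbitrary: g)
  case 0
  then show ?case by (simp add: P.emeasure_space_1)
next
  case (Suc n)
  note [measurable] = Suc.prems
  have "(\<integral>\<^sup>+\<omega>. (\<Prod>k<Suc n. g k (\<omega> k)) \<partial>S) = (\<integral>\<^sup>+x. (\<integral>\<^sup>+\<omega>. g 0 x * (\<Prod>k<n. g (Suc k) (\<omega> k)) \<partial>S) \<partial>M)"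
    by (subst nn_integral_case_nat) (auto simp: prod.lessThan_Suc_shift simp del: prod.lessThan_Suc)
  also have "\<dots> = (\<Prod>k<Suc n. \<integral>\<^sup>+x. g k x \<partial>M)"
    by (simp add: nn_integral_cmult nn_integral_multc Suc.IH[of "\<lambda>k. g (Suc k)"] prod.lessThan_Suc_shift
      del: prod.lessThan_Suc)
  finally show ?case .
qed

end

definition first_mark :: "'b set \<Rightarrow> (nat \<Rightarrow> 'b) \<Rightarrow> nat" where
  "first_mark B c = (LEAST n. c n \<in> B)"

text \<open>The number of original events up to and including the n-th marked one, that is, one more
  than its zero-based position.\<close>

primrec marked_index :: "'b set \<Rightarrow> (nat \<Rightarrow> 'b) \<Rightarrow> nat \<Rightarrow> nat" where
  "marked_index B c 0 = 0"
| "marked_index B c (Suc n) = Suc (first_mark B (drop_seq (marked_index B c n) c)) + marked_index B c n"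

definition marked_waiting :: "'b set \<Rightarrow> (nat \<Rightarrow> real) \<times> (nat \<Rightarrow> 'b) \<Rightarrow> real" where
  "marked_waiting B = (\<lambda>(x, c). \<Sum>k<Suc (first_mark B c). x k)"

definition marked_shift :: "'b set \<Rightarrow> (nat \<Rightarrow> real) \<times> (nat \<Rightarrow> 'b) \<Rightarrow> (nat \<Rightarrow> real) \<times> (nat \<Rightarrow> 'b)" where
  "marked_shift B = (\<lambda>(x, c). (drop_seq (Suc (first_mark B c)) x, drop_seq (Suc (first_mark B c)) c))"

text \<open>Defined by iterating the shift past a mark rather than by differences of arrival times,
  so that independence can be proved one block at a time.\<close>

definition thinned_waiting :: "'b set \<Rightarrow> (nat \<Rightarrow> real) \<times> (nat \<Rightarrow> 'b) \<Rightarrow> nat \<Rightarrow> real" where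
  "thinned_waiting B w n = marked_waiting B ((marked_shift B ^^ n) w)"

lemma thinned_waiting_0: "thinned_waiting B w 0 = marked_waiting B w"
  by (simp add: thinned_waiting_def)

lemma thinned_waiting_Suc: "thinned_waiting B w (Suc n) = thinned_waiting B (marked_shift B w) n"
  by (simp add: thinned_waiting_def funpow_swap1)

lemma marked_shift_power:
  "(marked_shift B ^^ n) (x, c) = (drop_seq (marked_index B c n) x, drop_seq (marked_index B c n) c)"
  by (induction n) (simp_all add: marked_shift_def)

text \<open>The blocks are consecutive, so their lengths telescope: every arrival of the thinned
  process is an arrival of the original one.\<close>

lemma sum_thinned_waiting:
  "(\<Sum>k<n. thinned_waiting B (x, c) k) = (\<Sum>k<marked_index B c n. x k)"
proof (induction n)
  case (Suc n)
  let ?f = "Suc (first_mark B (drop_seq (marked_index B c n) c))" and ?m = "marked_index B c n"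
  have "(\<Sum>k<n. thinned_waiting B (x, c) k) + thinned_waiting B (x, c) n
      = (\<Sum>k<?m. x k) + (\<Sum>k<?f. x (k + ?m))"
    unfolding Suc.IH by (simp add: thinned_waiting_def marked_shift_power marked_waiting_def drop_seq_def)
  also have "(\<Sum>k<?f. x (k + ?m)) = (\<Sum>k=?m..<?f + ?m. x k)"
    using sum.shift_bounds_nat_ivl[of x 0 ?m ?f] by (simp add: atLeast0LessThan)
  also have "(\<Sum>k<?m. x k) + (\<Sum>k=?m..<?f + ?m. x k) = (\<Sum>k<?f + ?m. x k)"
    using sum.atLeastLessThan_concat[of 0 ?m "?f + ?m" x] by (simp add: atLeast0LessThan)
  finally show ?case by simp
qed simp

text \<open>Infinitely many marks ensure that every \<open>LEAST\<close> is attained. The second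
  claim says that each block ends with a mark, so that \<open>marked_index B c n\<close> is the
  shortest prefix containing n marks.\<close>

lemma card_marked_index:
  assumes "\<And>m. \<exists>n\<ge>m. c n \<in> B"
  shows "card {k. k < marked_index B c n \<and> c k \<in> B} = n"
    and "0 < n \<Longrightarrow> 0 < marked_index B c n \<and> c (marked_index B c n - 1) \<in> B"
proof -
  have first: "c (marked_index B c n + first_mark B (drop_seq (marked_index B c n) c)) \<in> B"
    and before: "k < first_mark B (drop_seq (marked_index B c n) c) \<Longrightarrow> c (marked_index B c n + k) \<notin> B" for n k
  proof -
    obtain j where "j \<ge> marked_index B c n" "c j \<in> B" using assms by blast
    then have "drop_seq (marked_index B c n) c (j - marked_index B c n) \<in> B"
      by (simp add: drop_seq_def)
    then have "drop_seq (marked_index B c n) c (first_mark B (drop_seq (marked_index B c n) c)) \<in> B"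
      unfolding first_mark_def by (rule LeastI)
    then show "c (marked_index B c n + first_mark B (drop_seq (marked_index B c n) c)) \<in> B"
      by (simp add: drop_seq_def add.commute)
    assume "k < first_mark B (drop_seq (marked_index B c n) c)"
    then have "drop_seq (marked_index B c n) c k \<notin> B"
      unfolding first_mark_def by (rule not_less_Least)
    then show "c (marked_index B c n + k) \<notin> B"
      by (simp add: drop_seq_def add.commute)
  qed
  show "0 < n \<Longrightarrow> 0 < marked_index B c n \<and> c (marked_index B c n - 1) \<in> B"
    using first by (cases n) (auto simp: add.commute)
  show "card {k. k < marked_index B c n \<and> c k \<in> B} = n"
  proof (induction n)
    case (Suc n)
    let ?f = "first_mark B (drop_seq (marked_index B c n) c)" and ?m = "marked_index B c n"
    have "{k. k < marked_index B c (Suc n) \<and> c k \<in> B} = insert (?m + ?f) {k. k < ?m \<and> c k \<in> B}"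
    proof (intro set_eqI iffI)
      fix k assume k: "k \<in> {k. k < marked_index B c (Suc n) \<and> c k \<in> B}"
      show "k \<in> insert (?m + ?f) {k. k < ?m \<and> c k \<in> B}"
      proof (cases "k < ?m")
        case False
        then have "\<not> k - ?m < ?f" using before[of "k - ?m" n] k by auto
        then show ?thesis using k False by auto
      qed (use k in auto)
    qed (use first in auto)
    then show ?case using Suc.IH by simp
  qed simp
qed

text \<open>Pathwise form of thinning: the n-th thinned arrival is at most t iff the first
  \<open>marked_index B c n\<close> original events have occurred, iff at least n of the first N(t)
  events are marked.\<close>

lemma renewal_count_thinned_waiting:
  assumes marks: "\<And>m. \<exists>n\<ge>m. c n \<in> B"
    and x: "\<And>k. 0 \<le> x k" and t: "0 \<le> t" "t < (\<Sum>k<m. x k)"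
  shows "renewal_count t (thinned_waiting B (x, c)) = card {n. n < renewal_count t x \<and> c n \<in> B}"
proof -
  let ?N = "renewal_count t x"
  have "(\<Sum>k<n. thinned_waiting B (x, c) k) \<le> t \<longleftrightarrow> n \<le> card {n. n < ?N \<and> c n \<in> B}" for n
  proof -
    have "(\<Sum>k<n. thinned_waiting B (x, c) k) \<le> t \<longleftrightarrow> marked_index B c n \<le> ?N"
      unfolding sum_thinned_waiting using renewal_count_ge_iff[OF x t] by simp
    also have "\<dots> \<longleftrightarrow> n \<le> card {n. n < ?N \<and> c n \<in> B}"
    proof
      assume le: "marked_index B c n \<le> ?N"
      have "card {k. k < marked_index B c n \<and> c k \<in> B} \<le> card {n. n < ?N \<and> c n \<in> B}"
        using le by (intro card_mono) auto
      then show "n \<le> card {n. n < ?N \<and> c n \<in> B}"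
        by (simp add: card_marked_index(1)[OF marks])
    next
      assume le: "n \<le> card {n. n < ?N \<and> c n \<in> B}"
      show "marked_index B c n \<le> ?N"
      proof (rule ccontr)
        assume gt: "\<not> marked_index B c n \<le> ?N"
        then have "0 < n" by (cases n) auto
        then have last: "0 < marked_index B c n" "c (marked_index B c n - 1) \<in> B"
          using card_marked_index(2)[OF marks] by auto
        \<comment> \<open>The position \<open>marked_index B c n - 1\<close> carries a mark and is
          at least ?N, so it witnesses strict inclusion.\<close>
        have "card {n. n < ?N \<and> c n \<in> B} < card {k. k < marked_index B c n \<and> c k \<in> B}"
          using gt last
          by (intro psubset_card_mono psubsetI)
             (auto simp: set_eq_iff intro!: exI[of _ "marked_index B c n - 1"])
        then show False using le by (simp add: card_marked_index(1)[OF marks])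
      qed
    qed
    finally show ?thesis .
  qed
  then have "{n. (\<Sum>k<n. thinned_waiting B (x, c) k) \<le> t} = {..card {n. n < ?N \<and> c n \<in> B}}"
    by auto
  then show ?thesis
    unfolding renewal_count_def[of t "thinned_waiting B (x, c)"] by (simp add: Max_eq_iff)
qed

lemma card_marks_eq_sum:
  fixes N :: nat
  shows "card {n. n < N \<and> c n \<in> B} = (\<Sum>n<N. if c n \<in> B then 1 else 0)"
proof -
  have "card {n. n < N \<and> c n \<in> B} = (\<Sum>n | n < N \<and> c n \<in> B. 1)" by simp
  also have "\<dots> = (\<Sum>n<N. if c n \<in> B then 1 else 0)"
    using sum.inter_filter[of "{..<N}" "\<lambda>_. 1 :: nat" "\<lambda>n. c n \<in> B"] by simp
  finally show ?thesis .
qed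

section \<open>Law of the waiting times between marked events\<close>

locale marked_renewal = ml_renewal \<rho> \<alpha> lam + marks: prob_space \<kappa>
  for \<rho> :: "real measure" and \<alpha> lam and \<kappa> :: "'b measure" +
  fixes B :: "'b set"
  assumes B_sets [measurable]: "B \<in> sets \<kappa>" and B_pos: "0 < measure \<kappa> B"
begin

sublocale mk: sequence_space \<kappa>
  by unfold_locales

abbreviation "W \<equiv> seq.S \<Otimes>\<^sub>M mk.S"

sublocale W: pair_prob_space seq.S mk.S
  by unfold_locales

lemma measurable_first_mark [measurable]: "first_mark B \<in> measurable mk.S (count_space UNIV)"
  unfolding first_mark_def by measurable

lemma measurable_marked_waiting [measurable]: "marked_waiting B \<in> borel_measurable W"
proof -
  have "(\<lambda>w. (\<lambda>n w. \<Sum>k<Suc n. fst w k) (first_mark B (snd w)) w) \<in> borel_measurable W"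
    by (rule measurable_compose_countable) (auto simp del: sum.lessThan_Suc)
  then show ?thesis by (simp add: marked_waiting_def case_prod_unfold)
qed

lemma measurable_marked_shift [measurable]: "marked_shift B \<in> measurable W W"
proof -
  have "(\<lambda>w. (\<lambda>n w. (drop_seq (Suc n) (fst w), drop_seq (Suc n) (snd w))) (first_mark B (snd w)) w) \<in> measurable W W"
    by (rule measurable_compose_countable) auto
  then show ?thesis by (simp add: marked_shift_def case_prod_unfold)
qed

lemma measurable_thinned_waiting [measurable]: "(\<lambda>w. thinned_waiting B w n) \<in> borel_measurable W"
proof -
  have "(\<lambda>w. (marked_shift B ^^ n) w) \<in> measurable W W"
    by (induction n) (auto intro: measurable_compose[OF _ measurable_marked_shift])
  then show ?thesis
    unfolding thinned_waiting_def by (rule measurable_compose[OF _ measurable_marked_waiting])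
qed

text \<open>For sequences with a mark, the indicator that the first one sits at position m. The
  product form shows at once that it depends on the first m + 1 coordinates only and that its
  integral factorizes.\<close>

definition first_event :: "nat \<Rightarrow> (nat \<Rightarrow> 'b) \<Rightarrow> ennreal" where
  "first_event m c = (\<Prod>k<Suc m. indicator (if k < m then space \<kappa> - B else B) (c k))"

lemma measurable_first_event [measurable]: "first_event m \<in> borel_measurable mk.S"
proof -
  have "(\<lambda>c. indicator (if k < m then space \<kappa> - B else B) (c k) :: ennreal) \<in> borel_measurable mk.S" for k
    by (cases "k < m") auto
  then show ?thesis unfolding first_event_def by (intro borel_measurable_prod_ennreal)
qed

lemma first_event_comb_seq: "first_event m (comb_seq (Suc m) c c') = first_event m c"
  unfolding first_event_def by (intro prod.cong) (auto simp: comb_seq_def)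

lemma nn_integral_first_event:
  "(\<integral>\<^sup>+c. first_event m c \<partial>mk.S) = ennreal (measure \<kappa> B * (1 - measure \<kappa> B) ^ m)"
proof -
  have "(\<integral>\<^sup>+c. first_event m c \<partial>mk.S)
      = (\<Prod>k<Suc m. \<integral>\<^sup>+b. indicator (if k < m then space \<kappa> - B else B) b \<partial>\<kappa>)"
    unfolding first_event_def by (rule mk.nn_integral_prod_coordinates) auto
  also have "\<dots> = (\<Prod>k<Suc m. ennreal (if k < m then 1 - measure \<kappa> B else measure \<kappa> B))"
    by (intro prod.cong) (auto simp: marks.emeasure_eq_measure marks.prob_compl)
  also have "\<dots> = ennreal (\<Prod>k<Suc m. if k < m then 1 - measure \<kappa> B else measure \<kappa> B)"
    by (intro prod_ennreal) auto
  also have "(\<Prod>k<Suc m. if k < m then 1 - measure \<kappa> B else measure \<kappa> B) = measure \<kappa> B * (1 - measure \<kappa> B) ^ m"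
    by simp
  finally show ?thesis .
qed

lemma first_event_eq:
  assumes "c \<in> space mk.S" "\<exists>n. c n \<in> B"
  shows "first_event m c = indicator {first_mark B c} m"
proof -
  have sp: "c k \<in> space \<kappa>" for k using assms(1) by (auto simp: space_PiM)
  have in_B: "c (first_mark B c) \<in> B" unfolding first_mark_def using assms(2) by (rule LeastI_ex)
  have notin: "c k \<notin> B" if "k < first_mark B c" for k
    using that unfolding first_mark_def by (rule not_less_Least)
  show ?thesis
  proof (cases "m = first_mark B c")
    case True
    then have "first_event m c = 1"
      unfolding first_event_def using sp in_B notin by (intro prod.neutral) (auto simp: less_Suc_eq)
    then show ?thesis using True by simp
  next
    case False
    have "\<exists>k<Suc m. indicator (if k < m then space \<kappa> - B else B) (c k) = (0 :: ennreal)"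
    proof (cases "m < first_mark B c")
      case True
      then show ?thesis using notin[of m] by (intro exI[of _ m]) auto
    next
      case False
      with \<open>m \<noteq> first_mark B c\<close> show ?thesis using in_B by (intro exI[of _ "first_mark B c"]) auto
    qed
    then have "first_event m c = 0"
      unfolding first_event_def by (intro prod_zero) blast+
    then show ?thesis using False by simp
  qed
qed

text \<open>No mark among the first m coordinates has probability (1 - P)^m, which tends to 0, so
  there is a mark; invariance of the i.i.d. law under shifts then gives one beyond every
  position.\<close>

lemma AE_infinitely_many_marks: "AE c in mk.S. \<forall>m. \<exists>n\<ge>m. c n \<in> B"
proof -
  have one: "AE c in mk.S. \<exists>n. c n \<in> B"
  proof -
    let ?A = "{c \<in> space mk.S. \<forall>n. c n \<notin> B}"
    have A: "?A \<in> sets mk.S" by measurable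
    have "measure mk.S ?A \<le> (1 - measure \<kappa> B) ^ m" for m
    proof -
      have "emeasure mk.S ?A = (\<integral>\<^sup>+c. indicator ?A c \<partial>mk.S)" using A by simp
      also have "\<dots> \<le> (\<integral>\<^sup>+c. (\<Prod>k<m. indicator (space \<kappa> - B) (c k)) \<partial>mk.S)"
      proof (rule nn_integral_mono)
        fix c show "indicator ?A c \<le> (\<Prod>k<m. indicator (space \<kappa> - B) (c k) :: ennreal)"
        proof (cases "c \<in> ?A")
          case True
          then have "(\<Prod>k<m. indicator (space \<kappa> - B) (c k) :: ennreal) = 1"
            by (intro prod.neutral) (auto simp: space_PiM PiE_iff indicator_def)
          then show ?thesis by (simp add: indicator_def)
        qed simp
      qed
      also have "\<dots> = ennreal ((1 - measure \<kappa> B) ^ m)"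
        by (subst mk.nn_integral_prod_coordinates)
           (auto simp: marks.emeasure_eq_measure marks.prob_compl ennreal_power)
      finally show ?thesis by (simp add: mk.P.emeasure_eq_measure)
    qed
    moreover have "(\<lambda>m. (1 - measure \<kappa> B) ^ m) \<longlonglongrightarrow> 0"
      using B_pos marks.prob_le_1[of B] by (intro LIMSEQ_power_zero) (unfold real_norm_def, linarith)
    ultimately have "measure mk.S ?A \<le> 0" by (intro LIMSEQ_le_const) auto
    then have "emeasure mk.S ?A = 0" by (simp add: mk.P.emeasure_eq_measure measure_le_0_iff)
    then show ?thesis using A by (intro AE_I[of _ _ ?A]) auto
  qed
  have "AE c in mk.S. \<exists>n\<ge>m. c n \<in> B" for m
  proof -
    have drop: "distr mk.S mk.S (drop_seq m) = mk.S"
    proof (rule measure_eqI)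
      fix A assume "A \<in> sets (distr mk.S mk.S (drop_seq m))"
      then have [measurable]: "A \<in> sets mk.S" by simp
      have "emeasure (distr mk.S mk.S (drop_seq m)) A = (\<integral>\<^sup>+c. indicator A c \<partial>distr mk.S mk.S (drop_seq m))"
        by simp
      also have "\<dots> = emeasure mk.S A"
        by (subst nn_integral_distr) (auto simp: mk.nn_integral_drop_seq_1)
      finally show "emeasure (distr mk.S mk.S (drop_seq m)) A = emeasure mk.S A" .
    qed simp
    have "AE c in distr mk.S mk.S (drop_seq m). \<exists>n. c n \<in> B" unfolding drop by (rule one)
    then have "AE c in mk.S. \<exists>n. drop_seq m c n \<in> B"
      by (rule AE_distrD[rotated]) simp
    then show ?thesis by eventually_elim (auto simp: drop_seq_def intro: exI[of _ "_ + m"])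
  qed
  then show ?thesis by (simp add: AE_all_countable)
qed

lemma AE_W_infinitely_many_marks: "AE (x, c) in W. \<forall>m. \<exists>n\<ge>m. c n \<in> B"
proof -
  have "AE x in seq.S. AE c in mk.S. \<forall>m. \<exists>n\<ge>m. c n \<in> B"
    using AE_infinitely_many_marks by simp
  then have "AE w in W. \<forall>m. \<exists>n\<ge>m. snd w n \<in> B"
    by (intro W.AE_pair_measure) auto
  then show ?thesis by (simp add: case_prod_unfold)
qed

text \<open>Strong Markov property at the first mark. Splitting by its position m replaces the
  random shift by a fixed one, for which both sequences factorize; the factor of g does not depend
  on m and leaves the sum.\<close>

lemma nn_integral_marked_shift:
  assumes [measurable]: "f \<in> borel_measurable borel" "g \<in> borel_measurable W"
  shows "(\<integral>\<^sup>+w. f (marked_waiting B w) * g (marked_shift B w) \<partial>W)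
    = (\<Sum>m. ennreal (measure \<kappa> B * (1 - measure \<kappa> B) ^ m) * (\<integral>\<^sup>+x. f (\<Sum>k<Suc m. x k) \<partial>seq.S))
      * (\<integral>\<^sup>+w. g w \<partial>W)"
proof -
  define h where "h m = (\<lambda>(x, c). f (\<Sum>k<Suc m. x k) * first_event m c * g (drop_seq (Suc m) x, drop_seq (Suc m) c))" for m
  have [measurable]: "h m \<in> borel_measurable W" for m
    unfolding h_def by measurable
  have "(\<integral>\<^sup>+w. f (marked_waiting B w) * g (marked_shift B w) \<partial>W) = (\<integral>\<^sup>+w. (\<Sum>m. h m w) \<partial>W)"
  proof (rule nn_integral_cong_AE)
    show "AE w in W. f (marked_waiting B w) * g (marked_shift B w) = (\<Sum>m. h m w)"
      using AE_W_infinitely_many_marks AE_space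
    proof eventually_elim
      case (elim w)
      obtain x c where w: "w = (x, c)" by (cases w)
      then have c: "c \<in> space mk.S" "\<exists>n. c n \<in> B" using elim by (auto simp: space_pair_measure)
      have "(\<Sum>m. h m w) = (\<Sum>m\<in>{first_mark B c}. h m w)"
        by (rule suminf_finite) (auto simp: h_def w first_event_eq[OF c])
      also have "\<dots> = f (marked_waiting B w) * g (marked_shift B w)"
        by (simp add: h_def w first_event_eq[OF c] marked_waiting_def marked_shift_def)
      finally show ?case by simp
    qed
  qed
  also have "\<dots> = (\<Sum>m. \<integral>\<^sup>+w. h m w \<partial>W)"
    by (rule nn_integral_suminf) simp
  also have "\<dots> = (\<Sum>m. ennreal (measure \<kappa> B * (1 - measure \<kappa> B) ^ m) * (\<integral>\<^sup>+x. f (\<Sum>k<Suc m. x k) \<partial>seq.S)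
      * (\<integral>\<^sup>+w. g w \<partial>W))"
  proof (intro suminf_cong)
    fix m
    define A where "A = (\<integral>\<^sup>+x. f (\<Sum>k<Suc m. x k) \<partial>seq.S)"
    have [measurable]: "(\<lambda>x. f (\<Sum>k<Suc m. x k)) \<in> borel_measurable seq.S"
      by measurable
    have [measurable]: "(\<lambda>c. \<integral>\<^sup>+x. g (x, c) \<partial>seq.S) \<in> borel_measurable mk.S"
      by measurable
    have "(\<integral>\<^sup>+w. h m w \<partial>W) = (\<integral>\<^sup>+c. (\<integral>\<^sup>+x. h m (x, c) \<partial>seq.S) \<partial>mk.S)"
      by (rule W.nn_integral_snd[symmetric]) simp
    also have "\<dots> = (\<integral>\<^sup>+c. first_event m c * (A * (\<integral>\<^sup>+x. g (x, drop_seq (Suc m) c) \<partial>seq.S)) \<partial>mk.S)"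
    proof (rule nn_integral_cong)
      fix c assume c: "c \<in> space mk.S"
      then have "drop_seq (Suc m) c \<in> space mk.S"
        using measurable_space[OF mk.measurable_drop_seq] by blast
      then have [measurable]: "(\<lambda>x. g (x, drop_seq (Suc m) c)) \<in> borel_measurable seq.S" by measurable
      have "(\<integral>\<^sup>+x. h m (x, c) \<partial>seq.S)
        = (\<integral>\<^sup>+x. first_event m c * (f (\<Sum>k<Suc m. x k) * g (drop_seq (Suc m) x, drop_seq (Suc m) c)) \<partial>seq.S)"
        by (intro nn_integral_cong) (simp add: h_def mult_ac del: sum.lessThan_Suc)
      also have "\<dots> = first_event m c * (\<integral>\<^sup>+x. f (\<Sum>k<Suc m. x k) * g (drop_seq (Suc m) x, drop_seq (Suc m) c) \<partial>seq.S)"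
        by (rule nn_integral_cmult) measurable
      also have "(\<integral>\<^sup>+x. f (\<Sum>k<Suc m. x k) * g (drop_seq (Suc m) x, drop_seq (Suc m) c) \<partial>seq.S)
        = A * (\<integral>\<^sup>+x. g (x, drop_seq (Suc m) c) \<partial>seq.S)"
        unfolding A_def
      proof (rule seq.nn_integral_drop_seq[where v = "\<lambda>x. g (x, drop_seq (Suc m) c)"])
        show "f (\<Sum>k<Suc m. comb_seq (Suc m) \<omega> \<omega>' k) = f (\<Sum>k<Suc m. \<omega> k)" for \<omega> \<omega>'
          by (intro arg_cong[where f = f] sum.cong) (auto simp: comb_seq_def)
      qed measurable
      finally show "(\<integral>\<^sup>+x. h m (x, c) \<partial>seq.S)
        = first_event m c * (A * (\<integral>\<^sup>+x. g (x, drop_seq (Suc m) c) \<partial>seq.S))" .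
    qed
    also have "\<dots> = (\<integral>\<^sup>+c. first_event m c \<partial>mk.S) * (\<integral>\<^sup>+c. A * (\<integral>\<^sup>+x. g (x, c) \<partial>seq.S) \<partial>mk.S)"
      by (rule mk.nn_integral_drop_seq[where v = "\<lambda>c. A * (\<integral>\<^sup>+x. g (x, c) \<partial>seq.S)"])
         (auto simp: first_event_comb_seq)
    also have "(\<integral>\<^sup>+c. A * (\<integral>\<^sup>+x. g (x, c) \<partial>seq.S) \<partial>mk.S) = A * (\<integral>\<^sup>+w. g w \<partial>W)"
      by (subst nn_integral_cmult) (auto simp: W.nn_integral_snd)
    finally show "(\<integral>\<^sup>+w. h m w \<partial>W) = ennreal (measure \<kappa> B * (1 - measure \<kappa> B) ^ m) * A * (\<integral>\<^sup>+w. g w \<partial>W)"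
      by (simp add: nn_integral_first_event mult_ac)
  qed
  finally show ?thesis by (simp add: ennreal_suminf_multc)
qed

lemma nn_integral_marked_waiting:
  assumes [measurable]: "f \<in> borel_measurable borel"
  shows "(\<integral>\<^sup>+w. f (marked_waiting B w) \<partial>W)
    = (\<Sum>m. ennreal (measure \<kappa> B * (1 - measure \<kappa> B) ^ m) * (\<integral>\<^sup>+x. f (\<Sum>k<Suc m. x k) \<partial>seq.S))"
  using nn_integral_marked_shift[of f "\<lambda>_. 1"] by (simp add: W.P.emeasure_space_1)

lemma nn_integral_prod_thinned_waiting:
  assumes [measurable]: "\<And>k. f k \<in> borel_measurable borel"
  shows "(\<integral>\<^sup>+w. (\<Prod>k<n. f k (thinned_waiting B w k)) \<partial>W) = (\<Prod>k<n. \<integral>\<^sup>+w. f k (marked_waiting B w) \<partial>W)"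
  using assms
proof (induction n arbitrary: f)
  case 0
  then show ?case by (simp add: W.P.emeasure_space_1)
next
  case (Suc n)
  note [measurable] = Suc.prems
  have "(\<integral>\<^sup>+w. (\<Prod>k<Suc n. f k (thinned_waiting B w k)) \<partial>W)
    = (\<integral>\<^sup>+w. f 0 (marked_waiting B w) * (\<Prod>k<n. f (Suc k) (thinned_waiting B (marked_shift B w) k)) \<partial>W)"
    by (simp add: prod.lessThan_Suc_shift thinned_waiting_0 thinned_waiting_Suc del: prod.lessThan_Suc)
  also have "\<dots> = (\<integral>\<^sup>+w. f 0 (marked_waiting B w) \<partial>W) * (\<integral>\<^sup>+w. (\<Prod>k<n. f (Suc k) (thinned_waiting B w k)) \<partial>W)"
    by (subst nn_integral_marked_shift[where g = "\<lambda>w. \<Prod>k<n. f (Suc k) (thinned_waiting B w k)"])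
       (auto simp: nn_integral_marked_waiting)
  finally show ?case
    using Suc.IH[of "\<lambda>k. f (Suc k)"] by (simp add: prod.lessThan_Suc_shift del: prod.lessThan_Suc)
qed

definition thinned_law :: "real measure" where
  "thinned_law = distr W borel (marked_waiting B)"

lemma real_distribution_thinned_law: "real_distribution thinned_law"
  unfolding thinned_law_def by (intro W.P.real_distribution_distr) simp

lemma distr_thinned_waiting:
  "distr W (Pi\<^sub>M UNIV (\<lambda>_. thinned_law)) (thinned_waiting B) = Pi\<^sub>M UNIV (\<lambda>_. thinned_law)"
proof -
  interpret T: real_distribution thinned_law by (rule real_distribution_thinned_law)
  have one: "emeasure thinned_law UNIV = 1" using T.emeasure_space_1 by simp
  interpret T: sequence_space thinned_law by unfold_locales
  have tw: "thinned_waiting B \<in> measurable W T.S"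
    by (rule measurable_PiM_single') (auto simp: space_PiM)
  show ?thesis
  proof (rule T.PiM_eq)
    fix J :: "nat set" and F assume J: "finite J" "\<And>j. j \<in> J \<Longrightarrow> F j \<in> sets thinned_law"
    then have F: "j \<in> J \<Longrightarrow> F j \<in> sets borel" for j by simp
    obtain n where n: "J \<subseteq> {..<n}" using J(1) finite_nat_iff_bounded by blast
    \<comment> \<open>Coordinates outside J receive the constant 1, so a cylinder set becomes a
      product over an initial segment of coordinates.\<close>
    define f :: "nat \<Rightarrow> real \<Rightarrow> ennreal" where "f k = indicator (if k \<in> J then F k else UNIV)" for k
    have [measurable]: "f k \<in> borel_measurable borel" for k
      unfolding f_def using F by auto
    let ?E = "prod_emb UNIV (\<lambda>_. thinned_law) J (Pi\<^sub>E J F)"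
    have E: "?E \<in> sets T.S" using J by (intro sets_PiM_I) auto
    have "emeasure (distr W T.S (thinned_waiting B)) ?E = (\<integral>\<^sup>+w. indicator ?E (thinned_waiting B w) \<partial>W)"
      using E tw by (subst nn_integral_indicator[symmetric], simp, subst nn_integral_distr) auto
    also have "\<dots> = (\<integral>\<^sup>+w. (\<Prod>k<n. f k (thinned_waiting B w k)) \<partial>W)"
    proof (rule nn_integral_cong)
      fix w
      show "indicator ?E (thinned_waiting B w) = (\<Prod>k<n. f k (thinned_waiting B w k))"
      proof (cases "\<forall>j\<in>J. thinned_waiting B w j \<in> F j")
        case True
        then have "thinned_waiting B w \<in> ?E" by (auto simp: prod_emb_def PiE_iff)
        moreover have "(\<Prod>k<n. f k (thinned_waiting B w k)) = 1"
          using True by (intro prod.neutral) (auto simp: f_def)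
        ultimately show ?thesis by simp
      next
        case False
        then obtain j where j: "j \<in> J" "thinned_waiting B w j \<notin> F j" by auto
        then have "thinned_waiting B w \<notin> ?E" by (auto simp: prod_emb_def PiE_iff)
        moreover have "(\<Prod>k<n. f k (thinned_waiting B w k)) = 0"
          using j n by (intro prod_zero) (auto simp: f_def intro!: bexI[of _ j])
        ultimately show ?thesis by simp
      qed
    qed
    also have "\<dots> = (\<Prod>k<n. \<integral>\<^sup>+w. f k (marked_waiting B w) \<partial>W)"
      by (rule nn_integral_prod_thinned_waiting) simp
    also have "\<dots> = (\<Prod>k<n. \<integral>\<^sup>+y. f k y \<partial>thinned_law)"
      unfolding thinned_law_def by (subst nn_integral_distr) auto
    also have "\<dots> = (\<Prod>k\<in>J. \<integral>\<^sup>+y. f k y \<partial>thinned_law)"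
      using n by (intro prod.mono_neutral_right) (auto simp: f_def one)
    also have "\<dots> = (\<Prod>k\<in>J. emeasure thinned_law (F k))"
      using J by (intro prod.cong) (auto simp: f_def)
    finally show "emeasure (distr W T.S (thinned_waiting B)) ?E = (\<Prod>k\<in>J. emeasure thinned_law (F k))" .
  qed simp
qed

text \<open>The geometric weights are the case z = 1 - P, with finite differences (-P)^k. The
  remaining factor P completes the series to 1 - E_alpha(-P lam^alpha t^alpha), and P =
  (P^(1/alpha))^alpha is absorbed into the scale.\<close>

lemma cdf_thinned_law: "cdf thinned_law t = ml_cdf \<alpha> (lam * measure \<kappa> B powr (1 / \<alpha>)) t"
proof -
  let ?P = "measure \<kappa> B"
  have P1: "0 \<le> 1 - ?P" by simp
  interpret T: real_distribution thinned_law by (rule real_distribution_thinned_law)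
  have "ennreal (cdf thinned_law t) = emeasure thinned_law {..t}"
    by (simp add: cdf_def T.emeasure_eq_measure)
  also have "\<dots> = (\<integral>\<^sup>+w. indicator {..t} (marked_waiting B w) \<partial>W)"
    by (subst nn_integral_indicator[symmetric], simp, unfold thinned_law_def, subst nn_integral_distr) auto
  also have "\<dots> = (\<Sum>m. ennreal (?P * (1 - ?P) ^ m) * (\<integral>\<^sup>+x. indicator {..t} (\<Sum>k<Suc m. x k) \<partial>seq.S))"
    by (rule nn_integral_marked_waiting) simp
  also have "\<dots> = (\<Sum>m. ennreal (?P * ((1 - ?P) ^ m * arrival_cdf (Suc m) t)))"
  proof (intro suminf_cong)
    fix m
    have "(\<integral>\<^sup>+x. indicator {..t} (\<Sum>k<Suc m. x k) \<partial>seq.S)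
      = (\<integral>\<^sup>+x. indicator {x \<in> space seq.S. (\<Sum>k<Suc m. x k) \<le> t} x \<partial>seq.S)"
      by (intro nn_integral_cong) (simp add: indicator_def del: sum.lessThan_Suc)
    also have "\<dots> = ennreal (arrival_cdf (Suc m) t)"
      by (simp add: arrival_cdf_def seq.P.emeasure_eq_measure del: sum.lessThan_Suc)
    finally show "ennreal (?P * (1 - ?P) ^ m) * (\<integral>\<^sup>+x. indicator {..t} (\<Sum>k<Suc m. x k) \<partial>seq.S)
      = ennreal (?P * ((1 - ?P) ^ m * arrival_cdf (Suc m) t))"
      by (simp add: ennreal_mult'[symmetric] ennreal_mult''[symmetric] arrival_cdf_def mult_ac del: sum.lessThan_Suc)
  qed
  finally have eq: "ennreal (cdf thinned_law t) = (\<Sum>m. ennreal (?P * ((1 - ?P) ^ m * arrival_cdf (Suc m) t)))" .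
  show ?thesis
  proof (cases "t < 0")
    case True
    then show ?thesis using eq by (simp add: arrival_cdf_neg ml_cdf_def cdf_def)
  next
    case False
    then have t: "0 \<le> t" by simp
    have nn: "0 \<le> ?P * ((1 - ?P) ^ m * arrival_cdf (Suc m) t)" for m
      by (simp add: arrival_cdf_def)
    have g: "(\<lambda>m. (1 - ?P) ^ m * arrival_cdf (Suc m) t) sums (\<Sum>k. (- ?P) ^ k * ml_term (Suc k) t)"
      using geometric_arrival_cdf_sums[OF t P1] by simp
    have e: "?P * (\<Sum>k. (- ?P) ^ k * ml_term (Suc k) t) = 1 - mittag_leffler \<alpha> (lam powr \<alpha> * t powr \<alpha> * (- ?P))"
      using mittag_leffler_minus_1[of "- ?P" t] by linarith
    have s: "(\<lambda>m. ?P * ((1 - ?P) ^ m * arrival_cdf (Suc m) t)) sums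
        (1 - mittag_leffler \<alpha> (lam powr \<alpha> * t powr \<alpha> * (- ?P)))"
      using sums_mult[OF g, of ?P] unfolding e .
    have "ennreal (cdf thinned_law t) = ennreal (1 - mittag_leffler \<alpha> (lam powr \<alpha> * t powr \<alpha> * (- ?P)))"
      unfolding eq using s nn by (subst suminf_ennreal2) (auto simp: sums_iff)
    moreover have "0 \<le> 1 - mittag_leffler \<alpha> (lam powr \<alpha> * t powr \<alpha> * (- ?P))"
      by (rule sums_le[OF nn sums_zero s])
    ultimately have "cdf thinned_law t = 1 - mittag_leffler \<alpha> (lam powr \<alpha> * t powr \<alpha> * (- ?P))"
      by (subst (asm) ennreal_inj) (auto simp: cdf_def)
    also have "lam powr \<alpha> * t powr \<alpha> * (- ?P) = - ((lam * ?P powr (1 / \<alpha>)) powr \<alpha> * t powr \<alpha>)"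
      using index_pos scale_pos B_pos by (simp add: powr_mult powr_powr)
    finally show ?thesis using t by (simp add: ml_cdf_def)
  qed
qed

definition thinned_count :: "real \<Rightarrow> (nat \<Rightarrow> real) \<times> (nat \<Rightarrow> 'b) \<Rightarrow> nat" where
  "thinned_count t = (\<lambda>(x, c). card {n. n < renewal_count t x \<and> c n \<in> B})"

lemma measurable_thinned_count [measurable]: "thinned_count t \<in> measurable W (count_space UNIV)"
proof -
  have "(\<lambda>w. (\<lambda>N w. \<Sum>n<N. if snd w n \<in> B then 1 else (0::nat)) (renewal_count t (fst w)) w) \<in> measurable W (count_space UNIV)"
    by (rule measurable_compose_countable) auto
  then show ?thesis by (simp add: thinned_count_def card_marks_eq_sum case_prod_unfold)
qed

text \<open>The pathwise identity holds for all t >= 0 outside one null set, so it transfers the law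
  of the whole path and not only of each marginal.\<close>

lemma process_law_thinned_count:
  "process_law W thinned_count = process_law (Pi\<^sub>M UNIV (\<lambda>_::nat. thinned_law)) renewal_count"
proof -
  interpret T: real_distribution thinned_law by (rule real_distribution_thinned_law)
  have tw: "thinned_waiting B \<in> measurable W (Pi\<^sub>M UNIV (\<lambda>_. thinned_law))"
    by (rule measurable_PiM_single') (auto simp: space_PiM)
  have pr: "path renewal_count \<in> measurable (Pi\<^sub>M UNIV (\<lambda>_::nat. thinned_law)) path_space"
    by (intro measurable_path measurable_renewal_count) simp
  have "process_law (Pi\<^sub>M UNIV (\<lambda>_::nat. thinned_law)) renewal_count
      = distr W path_space (path renewal_count \<circ> thinned_waiting B)"
    unfolding process_law_def by (subst distr_thinned_waiting[symmetric], subst distr_distr[OF pr tw]) simp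
  also have "\<dots> = process_law W thinned_count"
    unfolding process_law_def
  proof (rule distr_cong_AE)
    have "AE x in distr W seq.S fst. (\<forall>k. 0 < x k) \<and> (\<forall>t. \<exists>n. t < (\<Sum>k<n. x k))"
      unfolding mk.P.distr_pair_fst using AE_waiting_pos AE_arrivals_unbounded by eventually_elim simp
    then have "AE w in W. (\<forall>k. 0 < fst w k) \<and> (\<forall>t. \<exists>n. t < (\<Sum>k<n. fst w k))"
      by (rule AE_distrD[rotated]) simp
    then show "AE w in W. (path renewal_count \<circ> thinned_waiting B) w = path thinned_count w"
      using AE_W_infinitely_many_marks
    proof eventually_elim
      case (elim w)
      obtain x c where w: "w = (x, c)" by (cases w)
      have "renewal_count t (thinned_waiting B (x, c)) = thinned_count t (x, c)" if t: "0 \<le> t" for t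
      proof -
        obtain n where "t < (\<Sum>k<n. x k)" using elim w by (metis fst_conv)
        then show ?thesis
          unfolding thinned_count_def using elim w t
          by (auto intro!: renewal_count_thinned_waiting intro: less_imp_le)
      qed
      then show ?case by (auto simp: path_def w fun_eq_iff restrict_def)
    qed
    show "path thinned_count \<in> measurable W path_space"
      by (intro measurable_path) simp
  qed (use tw pr in \<open>auto intro: measurable_comp\<close>)
  finally show ?thesis ..
qed

end

section \<open>Independent classification\<close>

locale classified_renewal = ml_renewal \<rho> \<alpha> lam + M: prob_space M
  for \<rho> :: "real measure" and \<alpha> lam and M :: "'a measure" +
  fixes N :: "real \<Rightarrow> 'a \<Rightarrow> nat" and C :: "nat \<Rightarrow> 'a \<Rightarrow> nat" and I :: "nat set" and p :: "nat \<Rightarrow> real"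
  assumes finite_I: "finite I" and p_pos: "\<And>i. i \<in> I \<Longrightarrow> 0 < p i"
    and measurable_N: "\<And>t. 0 \<le> t \<Longrightarrow> N t \<in> measurable M (count_space UNIV)"
    and law_N: "process_law M N = process_law (Pi\<^sub>M UNIV (\<lambda>_::nat. \<rho>)) renewal_count"
    and measurable_C [measurable]: "\<And>n. C n \<in> measurable M (count_space I)"
    and prob_C: "\<And>n i. i \<in> I \<Longrightarrow> measure M {\<omega> \<in> space M. C n \<omega> = i} = p i"
    and indep: "M.indep_sets (case_option (events_of M path_space (path N))
      (\<lambda>n. events_of M (count_space I) (C n))) UNIV"
begin

lemma p_nonneg: "i \<in> I \<Longrightarrow> 0 \<le> p i"
  using p_pos[of i] by simp

text \<open>The common law of all \<open>C n\<close>, since they share the point masses p i.\<close>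

definition \<kappa> :: "nat measure" where
  "\<kappa> = distr M (count_space I) (C 0)"

lemma sets_\<kappa> [measurable_cong]: "sets \<kappa> = sets (count_space I)"
  by (simp add: \<kappa>_def)

lemma space_\<kappa>: "space \<kappa> = I"
  by (simp add: \<kappa>_def)

lemma emeasure_C:
  assumes "F \<subseteq> I"
  shows "emeasure M (C n -` F \<inter> space M) = ennreal (\<Sum>i\<in>F. p i)"
proof -
  have fin: "finite F" using assms finite_subset finite_I by blast
  have "emeasure M (C n -` F \<inter> space M) = emeasure (distr M (count_space I) (C n)) F"
    using assms by (subst emeasure_distr) auto
  also have "\<dots> = (\<Sum>i\<in>F. emeasure (distr M (count_space I) (C n)) {i})"
    using fin assms by (intro emeasure_eq_sum_singleton) auto
  also have "\<dots> = (\<Sum>i\<in>F. ennreal (p i))"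
  proof (intro sum.cong refl)
    fix i assume "i \<in> F"
    then have i: "i \<in> I" using assms by auto
    then have "emeasure (distr M (count_space I) (C n)) {i} = emeasure M {\<omega> \<in> space M. C n \<omega> = i}"
      by (subst emeasure_distr) (auto intro!: arg_cong[where f = "emeasure M"])
    then show "emeasure (distr M (count_space I) (C n)) {i} = ennreal (p i)"
      using prob_C[OF i] by (simp add: M.emeasure_eq_measure)
  qed
  also have "\<dots> = ennreal (\<Sum>i\<in>F. p i)"
    using p_nonneg assms by (intro sum_ennreal) auto
  finally show ?thesis .
qed

lemma emeasure_\<kappa>: "F \<subseteq> I \<Longrightarrow> emeasure \<kappa> F = ennreal (\<Sum>i\<in>F. p i)"
  unfolding \<kappa>_def by (subst emeasure_distr) (auto simp: emeasure_C)

lemma prob_space_\<kappa>: "prob_space \<kappa>"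
  unfolding \<kappa>_def by (rule M.prob_space_distr) simp

sublocale mk: sequence_space \<kappa>
  using prob_space_\<kappa> by (intro sequence_space.intro product_prob_space.intro product_sigma_finite.intro
    product_prob_space_axioms.intro) (simp_all add: prob_space_imp_sigma_finite)

lemma measurable_path_N [measurable]: "path N \<in> measurable M path_space"
  using measurable_N by (rule measurable_path)

lemma measurable_path_renewal_count [measurable]: "path renewal_count \<in> measurable seq.S path_space"
  by (intro measurable_path) simp

lemma measurable_class_seq [measurable]: "(\<lambda>\<omega> n. C n \<omega>) \<in> measurable M mk.S"
  by (rule measurable_PiM_single')
     (use measurable_space[OF measurable_C] in \<open>auto simp: space_PiM space_\<kappa>\<close>)

lemma independent_rectangle:
  assumes A: "A \<in> sets path_space" and J: "finite J" and F: "\<And>j. j \<in> J \<Longrightarrow> F j \<subseteq> I"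
  shows "emeasure M (path N -` A \<inter> space M \<inter> {\<omega> \<in> space M. \<forall>j\<in>J. C j \<omega> \<in> F j})
    = emeasure M (path N -` A \<inter> space M) * (\<Prod>j\<in>J. emeasure \<kappa> (F j))"
proof -
  define E where "E = case_option (path N -` A \<inter> space M) (\<lambda>j. C j -` F j \<inter> space M)"
  let ?J = "insert None (Some ` J)"
  have "M.prob (\<Inter>j\<in>?J. E j) = (\<Prod>j\<in>?J. M.prob (E j))"
    by (rule M.indep_setsD[OF indep]) (use A J F in \<open>auto simp: E_def events_of_def\<close>)
  also have "(\<Inter>j\<in>?J. E j) = path N -` A \<inter> space M \<inter> {\<omega> \<in> space M. \<forall>j\<in>J. C j \<omega> \<in> F j}"
    by (auto simp: E_def)
  also have "(\<Prod>j\<in>?J. M.prob (E j)) = M.prob (path N -` A \<inter> space M) * (\<Prod>j\<in>J. M.prob (C j -` F j \<inter> space M))"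
    using J by (subst prod.insert) (auto simp: prod.reindex E_def)
  also have "(\<Prod>j\<in>J. M.prob (C j -` F j \<inter> space M)) = (\<Prod>j\<in>J. \<Sum>i\<in>F j. p i)"
  proof (intro prod.cong refl)
    fix j assume "j \<in> J"
    then have "F j \<subseteq> I" using F by simp
    moreover from this have "0 \<le> (\<Sum>i\<in>F j. p i)"
      using p_nonneg by (intro sum_nonneg) auto
    ultimately show "M.prob (C j -` F j \<inter> space M) = (\<Sum>i\<in>F j. p i)"
      using emeasure_C[of "F j" j] by (simp add: M.emeasure_eq_measure)
  qed
  finally have "M.prob (path N -` A \<inter> space M \<inter> {\<omega> \<in> space M. \<forall>j\<in>J. C j \<omega> \<in> F j})
    = M.prob (path N -` A \<inter> space M) * (\<Prod>j\<in>J. \<Sum>i\<in>F j. p i)" .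
  moreover have nn: "0 \<le> (\<Sum>i\<in>F j. p i)" if "j \<in> J" for j
    using p_nonneg F[OF that] by (intro sum_nonneg) auto
  moreover have "(\<Prod>j\<in>J. emeasure \<kappa> (F j)) = ennreal (\<Prod>j\<in>J. \<Sum>i\<in>F j. p i)"
    using F nn by (simp add: emeasure_\<kappa> prod_ennreal)
  ultimately show ?thesis
    by (simp add: M.emeasure_eq_measure ennreal_mult prod_nonneg)
qed

text \<open>Independence speaks of finitely many classes at a time. For a fixed event A of the path,
  the law of the class sequence under M restricted to A is a finite measure that agrees with P(A)
  times the product measure on cylinders, hence everywhere; the rectangles A x D then determine the
  joint law.\<close>

lemma joint_law_eq_product:
  "distr M path_space (path N) \<Otimes>\<^sub>M mk.S = distr M (path_space \<Otimes>\<^sub>M mk.S) (\<lambda>\<omega>. (path N \<omega>, \<lambda>n. C n \<omega>))"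
proof (rule pair_measure_eqI)
  show "sigma_finite_measure (distr M path_space (path N))"
    by (intro prob_space_imp_sigma_finite M.prob_space_distr) simp
  show "sigma_finite_measure mk.S"
    by (rule mk.P.sigma_finite_measure_axioms)
  show "sets (distr M path_space (path N) \<Otimes>\<^sub>M mk.S) =
      sets (distr M (path_space \<Otimes>\<^sub>M mk.S) (\<lambda>\<omega>. (path N \<omega>, \<lambda>n. C n \<omega>)))"
    by (simp cong: sets_pair_measure_cong)
  fix A D assume "A \<in> sets (distr M path_space (path N))" and D [measurable]: "D \<in> sets mk.S"
  then have A [measurable]: "A \<in> sets path_space" by simp
  let ?A = "path N -` A \<inter> space M"
  have A' [measurable]: "?A \<in> sets M" by measurable
  let ?D = "density M (indicator ?A)"
  have mC: "(\<lambda>\<omega> n. C n \<omega>) \<in> measurable ?D mk.S" by simp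
  have nuE: "emeasure (distr ?D mk.S (\<lambda>\<omega> n. C n \<omega>)) E = emeasure M (?A \<inter> {\<omega> \<in> space M. (\<lambda>n. C n \<omega>) \<in> E})"
    if [measurable]: "E \<in> sets mk.S" for E
  proof -
    have [measurable]: "{\<omega> \<in> space M. (\<lambda>n. C n \<omega>) \<in> E} \<in> sets M" by measurable
    have "emeasure (distr ?D mk.S (\<lambda>\<omega> n. C n \<omega>)) E = emeasure ?D {\<omega> \<in> space M. (\<lambda>n. C n \<omega>) \<in> E}"
      by (subst emeasure_distr[OF mC]) (auto intro!: arg_cong[where f = "emeasure _"])
    also have "\<dots> = (\<integral>\<^sup>+\<omega>. indicator ?A \<omega> * indicator {\<omega> \<in> space M. (\<lambda>n. C n \<omega>) \<in> E} \<omega> \<partial>M)"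
      by (subst emeasure_density) auto
    also have "\<dots> = (\<integral>\<^sup>+\<omega>. indicator (?A \<inter> {\<omega> \<in> space M. (\<lambda>n. C n \<omega>) \<in> E}) \<omega> \<partial>M)"
      by (intro nn_integral_cong) (auto simp: indicator_def)
    finally show ?thesis by simp
  qed
  have "distr ?D mk.S (\<lambda>\<omega> n. C n \<omega>) = scale_measure (emeasure M ?A) mk.S"
  proof (rule measure_eqI_PiM_infinite)
    fix F and J :: "nat set" assume J: "finite J" and F: "\<And>i. i \<in> J \<Longrightarrow> F i \<in> sets \<kappa>"
    let ?E = "prod_emb UNIV (\<lambda>_. \<kappa>) J (Pi\<^sub>E J F)"
    have E: "?E \<in> sets mk.S" using J F by (intro sets_PiM_I) auto
    have FK: "F j \<subseteq> I" if "j \<in> J" for j using F[OF that] by (simp add: sets_\<kappa>)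
    have "{\<omega> \<in> space M. (\<lambda>n. C n \<omega>) \<in> ?E} = {\<omega> \<in> space M. \<forall>j\<in>J. C j \<omega> \<in> F j}"
      using measurable_space[OF measurable_C] by (auto simp: prod_emb_def PiE_iff space_\<kappa>)
    then have "emeasure (distr ?D mk.S (\<lambda>\<omega> n. C n \<omega>)) ?E = emeasure M ?A * (\<Prod>j\<in>J. emeasure \<kappa> (F j))"
      unfolding nuE[OF E] using independent_rectangle[OF A J FK] by simp
    also have "(\<Prod>j\<in>J. emeasure \<kappa> (F j)) = emeasure mk.S ?E"
      using J F by (intro mk.emeasure_PiM_emb[symmetric]) auto
    finally show "emeasure (distr ?D mk.S (\<lambda>\<omega> n. C n \<omega>)) ?E = emeasure (scale_measure (emeasure M ?A) mk.S) ?E"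
      by simp
  next
    have "emeasure (distr ?D mk.S (\<lambda>\<omega> n. C n \<omega>)) (space mk.S) \<noteq> \<infinity>"
      unfolding nuE[OF sets.top] by (simp add: M.emeasure_eq_measure)
    then show "finite_measure (distr ?D mk.S (\<lambda>\<omega> n. C n \<omega>))"
      by (intro finite_measureI) simp
  qed simp_all
  then have "emeasure M ?A * emeasure mk.S D = emeasure M (?A \<inter> {\<omega> \<in> space M. (\<lambda>n. C n \<omega>) \<in> D})"
    using nuE[OF D] by simp
  also have "\<dots> = emeasure (distr M (path_space \<Otimes>\<^sub>M mk.S) (\<lambda>\<omega>. (path N \<omega>, \<lambda>n. C n \<omega>))) (A \<times> D)"
    by (subst emeasure_distr) (auto intro!: arg_cong[where f = "emeasure M"])
  finally show "emeasure (distr M path_space (path N)) A * emeasure mk.S D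
    = emeasure (distr M (path_space \<Otimes>\<^sub>M mk.S) (\<lambda>\<omega>. (path N \<omega>, \<lambda>n. C n \<omega>))) (A \<times> D)"
    by (subst emeasure_distr) auto
qed

lemma measurable_joint [measurable]: "(\<lambda>\<omega>. (path N \<omega>, \<lambda>n. C n \<omega>)) \<in> measurable M (path_space \<Otimes>\<^sub>M mk.S)"
  by measurable

lemma measurable_joint_renewal [measurable]:
  "(\<lambda>(x, c). (path renewal_count x, c)) \<in> measurable (seq.S \<Otimes>\<^sub>M mk.S) (path_space \<Otimes>\<^sub>M mk.S)"
  by measurable

text \<open>From here on N may be replaced by the canonical renewal count, which has explicit
  waiting times independent of the classes.\<close>

lemma joint_law:
  "distr M (path_space \<Otimes>\<^sub>M mk.S) (\<lambda>\<omega>. (path N \<omega>, \<lambda>n. C n \<omega>))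
    = distr (seq.S \<Otimes>\<^sub>M mk.S) (path_space \<Otimes>\<^sub>M mk.S) (\<lambda>(x, c). (path renewal_count x, c))"
proof -
  have id: "distr mk.S mk.S (\<lambda>c. c) = mk.S" by (rule distr_id)
  have "distr M path_space (path N) \<Otimes>\<^sub>M mk.S = distr seq.S path_space (path renewal_count) \<Otimes>\<^sub>M distr mk.S mk.S (\<lambda>c. c)"
    using law_N unfolding process_law_def id by simp
  also have "\<dots> = distr (seq.S \<Otimes>\<^sub>M mk.S) (path_space \<Otimes>\<^sub>M mk.S) (\<lambda>(x, c). (path renewal_count x, c))"
    by (rule pair_measure_distr) (simp_all add: id mk.P.sigma_finite_measure_axioms)
  finally show ?thesis unfolding joint_law_eq_product .
qed

lemma measurable_path_coordinate: "0 \<le> t \<Longrightarrow> (\<lambda>f. f t) \<in> measurable path_space (count_space UNIV)"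
  unfolding path_space_def by (rule measurable_component_singleton) simp

text \<open>The classes are integrated first, with the number of events held fixed.\<close>

lemma nn_integral_classified:
  fixes h :: "nat \<Rightarrow> (nat \<Rightarrow> nat) \<Rightarrow> ennreal"
  assumes t: "0 \<le> t" and h [measurable]: "\<And>n. h n \<in> borel_measurable mk.S"
  shows "(\<integral>\<^sup>+\<omega>. h (N t \<omega>) (\<lambda>n. C n \<omega>) \<partial>M) = (\<integral>\<^sup>+x. (\<integral>\<^sup>+c. h (renewal_count t x) c \<partial>mk.S) \<partial>seq.S)"
proof -
  let ?h = "\<lambda>z. h (fst z t) (snd z)"
  note [measurable] = measurable_path_coordinate[OF t]
  have [measurable]: "?h \<in> borel_measurable (path_space \<Otimes>\<^sub>M mk.S)"
    by (rule measurable_compose_countable[where f = "\<lambda>n z. h n (snd z)" and g = "\<lambda>z. fst z t"]) measurable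
  have "(\<integral>\<^sup>+\<omega>. h (N t \<omega>) (\<lambda>n. C n \<omega>) \<partial>M)
    = (\<integral>\<^sup>+z. ?h z \<partial>distr M (path_space \<Otimes>\<^sub>M mk.S) (\<lambda>\<omega>. (path N \<omega>, \<lambda>n. C n \<omega>)))"
    using t by (subst nn_integral_distr[OF measurable_joint]) (simp_all add: path_def)
  also have "\<dots> = (\<integral>\<^sup>+z. (case z of (x, c) \<Rightarrow> h (renewal_count t x) c) \<partial>(seq.S \<Otimes>\<^sub>M mk.S))"
    unfolding joint_law using t
    by (subst nn_integral_distr[OF measurable_joint_renewal]) (auto simp: path_def intro!: nn_integral_cong)
  also have "\<dots> = (\<integral>\<^sup>+x. (\<integral>\<^sup>+c. h (renewal_count t x) c \<partial>mk.S) \<partial>seq.S)"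
  proof (subst mk.P.nn_integral_fst[symmetric])
    show "(\<lambda>(x, c). h (renewal_count t x) c) \<in> borel_measurable (seq.S \<Otimes>\<^sub>M mk.S)"
      unfolding case_prod_unfold
      by (rule measurable_compose_countable[where f = "\<lambda>n z. h n (snd z)" and g = "\<lambda>z. renewal_count t (fst z)"]) measurable
  qed simp
  finally show ?thesis .
qed

lemma measurable_card_class:
  assumes "0 \<le> t"
  shows "(\<lambda>\<omega>. card {n. n < N t \<omega> \<and> C n \<omega> \<in> B}) \<in> measurable M (count_space UNIV)"
proof -
  note [measurable] = measurable_N[OF assms]
  have [measurable]: "Measurable.pred M (\<lambda>\<omega>. C n \<omega> \<in> B)" for n
    by (rule measurable_compose[OF measurable_C]) simp
  have "(\<lambda>\<omega>. (\<lambda>m \<omega>. \<Sum>n<m. if C n \<omega> \<in> B then 1 else (0::nat)) (N t \<omega>) \<omega>) \<in> measurable M (count_space UNIV)"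
    by (rule measurable_compose_countable) measurable
  then show ?thesis unfolding card_marks_eq_sum .
qed

text \<open>Single classes and initial segments of classes are both instances of keeping a set B.
  The kept count is one fixed functional of the pair (path, class sequence), so the joint law
  carries it to the thinned renewal process.\<close>

lemma has_FPP_law_classes:
  assumes B: "B \<subseteq> I" "B \<noteq> {}"
  shows "has_FPP_law M (\<lambda>t \<omega>. card {n. n < N t \<omega> \<and> C n \<omega> \<in> B}) \<alpha> (lam * (\<Sum>i\<in>B. p i) powr (1 / \<alpha>))"
proof -
  have pos: "0 < (\<Sum>i\<in>B. p i)"
    using B p_pos finite_subset[OF B(1) finite_I] by (intro sum_pos) auto
  then have P: "measure \<kappa> B = (\<Sum>i\<in>B. p i)"
    using B by (simp add: measure_def emeasure_\<kappa>)
  interpret marked_renewal \<rho> \<alpha> lam \<kappa> B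
    by unfold_locales (use B P pos in \<open>auto simp: sets_\<kappa>\<close>)
  let ?Z = "\<lambda>(t::real) z. card {n. n < fst z t \<and> snd z n \<in> B}"
  have Z: "path ?Z \<in> measurable (path_space \<Otimes>\<^sub>M mk.S) path_space"
  proof (rule measurable_path)
    fix t :: real assume "0 \<le> t"
    note [measurable] = measurable_path_coordinate[OF this]
    show "?Z t \<in> measurable (path_space \<Otimes>\<^sub>M mk.S) (count_space UNIV)"
      unfolding card_marks_eq_sum
      by (rule measurable_compose_countable[where f = "\<lambda>m z. \<Sum>n<m. if snd z n \<in> B then 1 else 0" and g = "\<lambda>z. fst z t"]) measurable
  qed
  have "process_law M (\<lambda>t \<omega>. card {n. n < N t \<omega> \<and> C n \<omega> \<in> B})
    = distr (distr M (path_space \<Otimes>\<^sub>M mk.S) (\<lambda>\<omega>. (path N \<omega>, \<lambda>n. C n \<omega>))) path_space (path ?Z)"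
    unfolding process_law_def by (subst distr_distr[OF Z measurable_joint]) (auto simp: comp_def path_def restrict_def intro!: distr_cong)
  also have "\<dots> = process_law (seq.S \<Otimes>\<^sub>M mk.S) thinned_count"
    unfolding joint_law process_law_def
    by (subst distr_distr[OF Z measurable_joint_renewal]) (auto simp: comp_def path_def restrict_def thinned_count_def fun_eq_iff intro!: distr_cong)
  also have "\<dots> = process_law (Pi\<^sub>M UNIV (\<lambda>_::nat. thinned_law)) renewal_count"
    by (rule process_law_thinned_count)
  finally have law: "process_law M (\<lambda>t \<omega>. card {n. n < N t \<omega> \<and> C n \<omega> \<in> B})
    = process_law (Pi\<^sub>M UNIV (\<lambda>_::nat. thinned_law)) renewal_count" .
  show ?thesis
    unfolding has_FPP_law_def
  proof (intro conjI allI impI exI[of _ thinned_law])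
    show "cdf thinned_law x = ml_cdf \<alpha> (lam * (\<Sum>i\<in>B. p i) powr (1 / \<alpha>)) x" for x
      using cdf_thinned_law[of x] by (simp only: P)
  qed (rule measurable_card_class real_distribution_thinned_law law; assumption?)+
qed

section \<open>Moment generating function of the class counts\<close>

lemma nn_integral_\<kappa>:
  fixes f :: "nat \<Rightarrow> ennreal"
  shows "(\<integral>\<^sup>+i. f i \<partial>\<kappa>) = (\<Sum>i\<in>I. f i * ennreal (p i))"
proof -
  have "\<kappa> = point_measure I (\<lambda>i. ennreal (p i))"
    by (rule measure_eqI) (auto simp: sets_\<kappa> sets_point_measure emeasure_\<kappa> emeasure_point_measure_finite
      p_nonneg finite_I subset_eq intro!: sum_ennreal[symmetric])
  then show ?thesis by (simp add: nn_integral_point_measure_finite finite_I mult.commute)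
qed

text \<open>Regrouped by events, the exponential is a product of i.i.d. factors exp (s (C n)) with
  mean z = sum p_i e^(s_i). Integrating out the classes leaves z^N(t), and z - 1 has the required
  form because the p_i sum to 1.\<close>

lemma has_bochner_integral_exp_class_counts:
  assumes t: "0 \<le> t" and sum_p: "(\<Sum>i\<in>I. p i) = 1"
  shows "has_bochner_integral M (\<lambda>\<omega>. exp (\<Sum>i\<in>I. s i * real (class_count N C i t \<omega>)))
    (mittag_leffler \<alpha> (lam powr \<alpha> * t powr \<alpha> * (\<Sum>i\<in>I. p i * (exp (s i) - 1))))"
proof -
  define z where "z = (\<Sum>i\<in>I. p i * exp (s i))"
  have z: "0 \<le> z" unfolding z_def using p_nonneg by (intro sum_nonneg) auto
  have z1: "(\<Sum>i\<in>I. p i * (exp (s i) - 1)) = z - 1"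
    by (simp add: z_def sum_p right_diff_distrib sum_subtractf)
  have exp_eq: "exp (\<Sum>i\<in>I. s i * real (class_count N C i t \<omega>)) = (\<Prod>n<N t \<omega>. exp (s (C n \<omega>)))"
    if \<omega>: "\<omega> \<in> space M" for \<omega>
  proof -
    have "(\<Sum>i\<in>I. s i * real (class_count N C i t \<omega>)) = (\<Sum>i\<in>I. \<Sum>n<N t \<omega>. if C n \<omega> = i then s i else 0)"
      using card_marks_eq_sum[of "N t \<omega>" "\<lambda>n. C n \<omega>" "{_}"]
      by (intro sum.cong) (auto simp: class_count_def sum_distrib_left intro!: sum.cong)
    also have "\<dots> = (\<Sum>n<N t \<omega>. \<Sum>i\<in>I. if C n \<omega> = i then s i else 0)"
      by (rule sum.swap)
    also have "\<dots> = (\<Sum>n<N t \<omega>. s (C n \<omega>))"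
      using measurable_space[OF measurable_C \<omega>] by (intro sum.cong) (auto simp: sum.delta' finite_I)
    finally show ?thesis by (simp add: exp_sum finite_I)
  qed
  have ng: "\<And>k. (\<lambda>i. ennreal (exp (s i))) \<in> borel_measurable \<kappa>"
    by (simp cong: measurable_cong_sets add: sets_\<kappa>)
  have meas: "class_count N C i t \<in> measurable M (count_space UNIV)" for i
    using measurable_card_class[OF t, of "{i}"] unfolding class_count_def[abs_def] by (simp only: singleton_iff)
  have hb: "has_bochner_integral seq.S (\<lambda>x. z ^ renewal_count t x) (mittag_leffler \<alpha> (lam powr \<alpha> * t powr \<alpha> * (z - 1)))"
    by (rule has_bochner_integral_power_renewal_count[OF t z])
  have "(\<integral>\<^sup>+\<omega>. ennreal (exp (\<Sum>i\<in>I. s i * real (class_count N C i t \<omega>))) \<partial>M)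
    = (\<integral>\<^sup>+\<omega>. (\<Prod>n<N t \<omega>. ennreal (exp (s (C n \<omega>)))) \<partial>M)"
    by (intro nn_integral_cong) (simp add: exp_eq prod_ennreal)
  also have "\<dots> = (\<integral>\<^sup>+x. (\<integral>\<^sup>+c. (\<Prod>n<renewal_count t x. ennreal (exp (s (c n)))) \<partial>mk.S) \<partial>seq.S)"
    by (intro nn_integral_classified[OF t, of "\<lambda>m c. \<Prod>n<m. ennreal (exp (s (c n)))"]
        borel_measurable_prod_ennreal measurable_compose[OF measurable_component_singleton[of _ UNIV "\<lambda>_. \<kappa>"] ng]) simp
  also have "\<dots> = (\<integral>\<^sup>+x. ennreal (z ^ renewal_count t x) \<partial>seq.S)"
  proof (rule nn_integral_cong)
    fix x
    have "(\<integral>\<^sup>+i. ennreal (exp (s i)) \<partial>\<kappa>) = ennreal z"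
      unfolding nn_integral_\<kappa> z_def using p_nonneg
      by (subst sum_ennreal[symmetric]) (auto simp: ennreal_mult'' mult.commute)
    then show "(\<integral>\<^sup>+c. (\<Prod>n<renewal_count t x. ennreal (exp (s (c n)))) \<partial>mk.S) = ennreal (z ^ renewal_count t x)"
      using z by (subst mk.nn_integral_prod_coordinates[OF ng]) (simp_all add: ennreal_power)
  qed
  also have "\<dots> = ennreal (mittag_leffler \<alpha> (lam powr \<alpha> * t powr \<alpha> * (z - 1)))"
    using hb z by (subst nn_integral_eq_integral) (auto simp: has_bochner_integral_iff)
  finally show ?thesis
    unfolding z1
  proof (rule has_bochner_integral_nn_integral[rotated -1])
    show "0 \<le> mittag_leffler \<alpha> (lam powr \<alpha> * t powr \<alpha> * (z - 1))"
      using has_bochner_integral_integral_eq[OF hb] Bochner_Integration.integral_nonneg[of seq.S "\<lambda>x. z ^ renewal_count t x"] z by simp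
    show "(\<lambda>\<omega>. exp (\<Sum>i\<in>I. s i * real (class_count N C i t \<omega>))) \<in> borel_measurable M"
      using meas by measurable
  qed auto
qed

section \<open>Moments and covariance of the class counts\<close>

lemma borel_measurable_\<kappa>: "f \<in> borel_measurable \<kappa>"
  by (simp cong: measurable_cong_sets add: sets_\<kappa>)

lemma measurable_class_count: "0 \<le> t \<Longrightarrow> class_count N C i t \<in> measurable M (count_space UNIV)"
  using measurable_card_class[of t "{i}"] unfolding class_count_def[abs_def] by (simp only: singleton_iff)

lemma measurable_indicator_coordinate [measurable]:
  "(\<lambda>c. indicator {i} (c n) :: ennreal) \<in> borel_measurable mk.S"
  by (rule measurable_compose[OF measurable_component_singleton[of _ UNIV "\<lambda>_. \<kappa>"] borel_measurable_\<kappa>]) simp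

lemma nn_integral_indicator_coordinate:
  assumes "i \<in> I"
  shows "(\<integral>\<^sup>+c. indicator {i} (c n) \<partial>mk.S) = ennreal (p i)"
proof -
  have "(\<integral>\<^sup>+c. indicator {i} (c n) \<partial>mk.S) = (\<integral>\<^sup>+b. indicator {i} b \<partial>distr mk.S \<kappa> (\<lambda>c. c n))"
    by (subst nn_integral_distr) (auto intro: borel_measurable_\<kappa>)
  also have "distr mk.S \<kappa> (\<lambda>c. c n) = \<kappa>"
    by (rule mk.PiM_component) simp
  also have "(\<integral>\<^sup>+b. indicator {i} b \<partial>\<kappa>) = emeasure \<kappa> {i}"
    using assms by (intro nn_integral_indicator) (simp add: sets_\<kappa>)
  finally show ?thesis using assms by (simp add: emeasure_\<kappa>)
qed

lemma nn_integral_indicator_two_coordinates: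
  assumes i: "i \<in> I" and j: "j \<in> I" and "i \<noteq> j"
  shows "(\<integral>\<^sup>+c. indicator {i} (c n) * indicator {j} (c m) \<partial>mk.S) = (if n = m then 0 else ennreal (p i * p j))"
proof (cases "n = m")
  case True
  then show ?thesis using \<open>i \<noteq> j\<close> by (subst nn_integral_cong[where v = "\<lambda>_. 0"]) (auto simp: indicator_def)
next
  case False
  define g where "g k = (if k = n then indicator {i} else if k = m then indicator {j} else (\<lambda>_. 1 :: ennreal))" for k :: nat
  let ?J = "{..<Suc (max n m)}"
  have split: "(\<Prod>k\<in>?J. f k) = f n * f m" if "\<And>k. k \<noteq> n \<Longrightarrow> k \<noteq> m \<Longrightarrow> f k = 1" for f :: "nat \<Rightarrow> ennreal"
  proof -
    have "(\<Prod>k\<in>?J. f k) = (\<Prod>k\<in>{n, m}. f k)"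
      using that by (intro prod.mono_neutral_right) auto
    then show ?thesis using False by simp
  qed
  have "(\<integral>\<^sup>+c. indicator {i} (c n) * indicator {j} (c m) \<partial>mk.S) = (\<integral>\<^sup>+c. (\<Prod>k\<in>?J. g k (c k)) \<partial>mk.S)"
    using False by (subst split) (auto simp: g_def)
  also have "\<dots> = (\<Prod>k\<in>?J. \<integral>\<^sup>+b. g k b \<partial>\<kappa>)"
    by (rule mk.nn_integral_prod_coordinates[OF borel_measurable_\<kappa>])
  also have "\<dots> = (\<integral>\<^sup>+b. g n b \<partial>\<kappa>) * (\<integral>\<^sup>+b. g m b \<partial>\<kappa>)"
    by (rule split) (simp add: g_def mk.M.emeasure_space_1)
  also have "\<dots> = emeasure \<kappa> {i} * emeasure \<kappa> {j}"
    using False i j by (auto simp: g_def sets_\<kappa>)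
  also have "\<dots> = ennreal (p i * p j)"
    using i j p_nonneg by (simp add: emeasure_\<kappa> ennreal_mult)
  finally show ?thesis using False by simp
qed

lemma class_count_eq_sum:
  "ennreal (real (class_count N C i t \<omega>)) = (\<Sum>n<N t \<omega>. indicator {i} (C n \<omega>))"
proof -
  have e: "class_count N C i t \<omega> = (\<Sum>n<N t \<omega>. if C n \<omega> \<in> {i} then 1 else 0)"
    unfolding class_count_def using card_marks_eq_sum[of "N t \<omega>" "\<lambda>n. C n \<omega>" "{i}"] by simp
  have "ennreal (real (class_count N C i t \<omega>)) = ennreal (\<Sum>n<N t \<omega>. indicator {i} (C n \<omega>))"
    unfolding e of_nat_sum by (intro arg_cong[where f = ennreal] sum.cong) auto
  also have "\<dots> = (\<Sum>n<N t \<omega>. ennreal (indicator {i} (C n \<omega>)))"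
    by (rule sum_ennreal[symmetric]) simp
  finally show ?thesis by (simp add: ennreal_indicator)
qed

lemma has_bochner_integral_class_count:
  assumes t: "0 \<le> t" and i: "i \<in> I"
  shows "has_bochner_integral M (\<lambda>\<omega>. real (class_count N C i t \<omega>)) (p i * ml_term 1 t)"
proof (rule has_bochner_integral_nn_integral)
  note [measurable] = measurable_class_count[OF t]
  show "(\<lambda>\<omega>. real (class_count N C i t \<omega>)) \<in> borel_measurable M" by measurable
  show "0 \<le> p i * ml_term 1 t" using p_nonneg[OF i] ml_term_nonneg by simp
  have "(\<integral>\<^sup>+\<omega>. ennreal (real (class_count N C i t \<omega>)) \<partial>M)
    = (\<integral>\<^sup>+x. (\<integral>\<^sup>+c. (\<Sum>n<renewal_count t x. indicator {i} (c n)) \<partial>mk.S) \<partial>seq.S)"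
    unfolding class_count_eq_sum
    by (rule nn_integral_classified[OF t, of "\<lambda>m c. \<Sum>n<m. indicator {i} (c n)"]) measurable
  also have "\<dots> = (\<integral>\<^sup>+x. ennreal (p i) * ennreal (real (renewal_count t x)) \<partial>seq.S)"
    by (intro nn_integral_cong)
       (simp add: nn_integral_sum nn_integral_indicator_coordinate[OF i] ennreal_of_nat_eq_real_of_nat mult.commute)
  also have "\<dots> = ennreal (p i) * (\<integral>\<^sup>+x. ennreal (real (renewal_count t x)) \<partial>seq.S)"
    by (rule nn_integral_cmult) measurable
  also have "(\<integral>\<^sup>+x. ennreal (real (renewal_count t x)) \<partial>seq.S) = ennreal (ml_term 1 t)"
    using has_bochner_integral_renewal_count[OF t]
    by (subst nn_integral_eq_integral) (auto simp: has_bochner_integral_iff)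
  finally show "(\<integral>\<^sup>+\<omega>. ennreal (real (class_count N C i t \<omega>)) \<partial>M) = ennreal (p i * ml_term 1 t)"
    using p_nonneg[OF i] ml_term_nonneg by (simp add: ennreal_mult)
qed auto

text \<open>Expand into ordered pairs of events. The diagonal vanishes since an event has only one
  class, and each of the k (k - 1) other pairs contributes p_i p_j, so the factorial moment E N(N-1)
  appears.\<close>

lemma has_bochner_integral_class_count_product:
  assumes t: "0 \<le> t" and i: "i \<in> I" and j: "j \<in> I" and "i \<noteq> j"
  shows "has_bochner_integral M (\<lambda>\<omega>. real (class_count N C i t \<omega>) * real (class_count N C j t \<omega>))
    (p i * p j * (2 * ml_term 2 t))"
proof (rule has_bochner_integral_nn_integral)
  note [measurable] = measurable_class_count[OF t]
  show "(\<lambda>\<omega>. real (class_count N C i t \<omega>) * real (class_count N C j t \<omega>)) \<in> borel_measurable M" by measurable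
  have pp: "0 \<le> p i * p j" using p_nonneg[OF i] p_nonneg[OF j] by simp
  show "0 \<le> p i * p j * (2 * ml_term 2 t)" using pp ml_term_nonneg by simp
  have inner: "(\<integral>\<^sup>+c. (\<Sum>n<k. indicator {i} (c n)) * (\<Sum>m<k. indicator {j} (c m)) \<partial>mk.S)
    = ennreal (p i * p j) * ennreal (real k * (real k - 1))" for k
  proof -
    have "(\<integral>\<^sup>+c. (\<Sum>n<k. indicator {i} (c n)) * (\<Sum>m<k. indicator {j} (c m)) \<partial>mk.S)
      = (\<Sum>n<k. \<Sum>m<k. \<integral>\<^sup>+c. indicator {i} (c n) * indicator {j} (c m) \<partial>mk.S)"
      unfolding sum_product
      by (subst nn_integral_sum, measurable, intro sum.cong refl, subst nn_integral_sum, measurable)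
    also have "\<dots> = (\<Sum>n<k. \<Sum>m<k. ennreal (if n = m then 0 else p i * p j))"
      by (intro sum.cong) (simp_all add: nn_integral_indicator_two_coordinates[OF i j \<open>i \<noteq> j\<close>])
    also have "\<dots> = (\<Sum>n<k. ennreal (\<Sum>m<k. if n = m then 0 else p i * p j))"
      using pp by (intro sum.cong refl sum_ennreal) auto
    also have "\<dots> = ennreal (\<Sum>n<k. \<Sum>m<k. if n = m then 0 else p i * p j)"
      using pp by (intro sum_ennreal sum_nonneg) auto
    also have "(\<Sum>n<k. \<Sum>m<k. if n = m then 0 else p i * p j) = (\<Sum>n<k. real k * (p i * p j) - p i * p j)"
    proof (intro sum.cong refl)
      fix n assume "n \<in> {..<k}"
      have "(\<Sum>m<k. if n = m then 0 else p i * p j) = (\<Sum>m<k. p i * p j - (if n = m then p i * p j else 0))"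
        by (intro sum.cong) auto
      also have "\<dots> = real k * (p i * p j) - p i * p j"
        using \<open>n \<in> {..<k}\<close> by (simp add: sum_subtractf)
      finally show "(\<Sum>m<k. if n = m then 0 else p i * p j) = real k * (p i * p j) - p i * p j" .
    qed
    also have "\<dots> = p i * p j * (real k * (real k - 1))"
      by (simp add: algebra_simps)
    finally show ?thesis using pp by (simp add: ennreal_mult')
  qed
  have "(\<integral>\<^sup>+\<omega>. ennreal (real (class_count N C i t \<omega>) * real (class_count N C j t \<omega>)) \<partial>M)
    = (\<integral>\<^sup>+\<omega>. (\<Sum>n<N t \<omega>. indicator {i} (C n \<omega>)) * (\<Sum>n<N t \<omega>. indicator {j} (C n \<omega>)) \<partial>M)"
    by (simp add: ennreal_mult class_count_eq_sum)
  also have "\<dots> = (\<integral>\<^sup>+x. (\<integral>\<^sup>+c. (\<Sum>n<renewal_count t x. indicator {i} (c n)) * (\<Sum>m<renewal_count t x. indicator {j} (c m)) \<partial>mk.S) \<partial>seq.S)"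
    by (rule nn_integral_classified[OF t, of "\<lambda>k c. (\<Sum>n<k. indicator {i} (c n)) * (\<Sum>m<k. indicator {j} (c m))"]) measurable
  also have "\<dots> = (\<integral>\<^sup>+x. ennreal (p i * p j) * ennreal (real (renewal_count t x) * (real (renewal_count t x) - 1)) \<partial>seq.S)"
    unfolding inner ..
  also have "\<dots> = ennreal (p i * p j) * (\<integral>\<^sup>+x. ennreal (real (renewal_count t x) * (real (renewal_count t x) - 1)) \<partial>seq.S)"
    by (rule nn_integral_cmult) measurable
  also have "(\<integral>\<^sup>+x. ennreal (real (renewal_count t x) * (real (renewal_count t x) - 1)) \<partial>seq.S) = ennreal (2 * ml_term 2 t)"
  proof -
    have "0 \<le> real k * (real k - 1)" for k by (cases k) auto
    then show ?thesis
      using has_bochner_integral_renewal_count_2[OF t]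
      by (subst nn_integral_eq_integral) (auto simp: has_bochner_integral_iff)
  qed
  finally show "(\<integral>\<^sup>+\<omega>. ennreal (real (class_count N C i t \<omega>) * real (class_count N C j t \<omega>)) \<partial>M)
    = ennreal (p i * p j * (2 * ml_term 2 t))"
    using pp ml_term_nonneg by (simp add: ennreal_mult)
qed auto

text \<open>Domination by N(t)^2 = N(t) (N(t) - 1) + N(t). Square integrability is recorded because
  a Bochner integral defaults to 0 on non-integrable functions, so a covariance formula alone would
  not guarantee that the moments exist.\<close>

lemma integrable_class_count_square:
  assumes t: "0 \<le> t"
  shows "integrable M (\<lambda>\<omega>. (real (class_count N C i t \<omega>))\<^sup>2)"
proof -
  note [measurable] = measurable_class_count[OF t] measurable_N[OF t]
  have "integrable seq.S (\<lambda>x. real (renewal_count t x) * (real (renewal_count t x) - 1) + real (renewal_count t x))"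
    using has_bochner_integral_renewal_count_2[OF t] has_bochner_integral_renewal_count[OF t]
    by (auto simp: has_bochner_integral_iff)
  then have "integrable seq.S (\<lambda>x. (real (renewal_count t x))\<^sup>2)"
    by (simp add: algebra_simps power2_eq_square)
  then have "(\<integral>\<^sup>+x. ennreal ((real (renewal_count t x))\<^sup>2) \<partial>seq.S) < \<infinity>"
    by (simp add: integrable_iff_bounded)
  moreover have "(\<integral>\<^sup>+\<omega>. ennreal ((real (N t \<omega>))\<^sup>2) \<partial>M) = (\<integral>\<^sup>+x. ennreal ((real (renewal_count t x))\<^sup>2) \<partial>seq.S)"
    using nn_integral_classified[OF t, of "\<lambda>m _. ennreal ((real m)\<^sup>2)"] by (simp add: mk.P.emeasure_space_1)
  ultimately have "integrable M (\<lambda>\<omega>. (real (N t \<omega>))\<^sup>2)"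
    by (auto simp: integrable_iff_bounded)
  then show ?thesis
  proof (rule Bochner_Integration.integrable_bound)
    have "class_count N C i t \<omega> \<le> card {..<N t \<omega>}" for \<omega>
      unfolding class_count_def by (intro card_mono) auto
    then show "AE \<omega> in M. norm ((real (class_count N C i t \<omega>))\<^sup>2) \<le> norm ((real (N t \<omega>))\<^sup>2)"
      by (auto intro!: AE_I2 power_mono)
  qed measurable
qed

text \<open>The covariance is p_i p_j (E N(N-1) - (E N)^2). The numerator 2 is that of E N(N-1) = 2
  (lam t)^(2 alpha) / Gamma (1 + 2 alpha). At alpha = 1 the bracket is 2/2 - 1 = 0, in accordance
  with the independence of the parts of a split Poisson process.\<close>

lemma covariance_class_counts:
  assumes t: "0 \<le> t" and i: "i \<in> I" and j: "j \<in> I" and "i \<noteq> j"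
  shows "covariance M (\<lambda>\<omega>. real (class_count N C i t \<omega>)) (\<lambda>\<omega>. real (class_count N C j t \<omega>)) =
    p i * p j * lam powr (2 * \<alpha>) * t powr (2 * \<alpha>) * (2 / Gamma (1 + 2 * \<alpha>) - 1 / (Gamma (1 + \<alpha>))\<^sup>2)"
proof -
  let ?X = "\<lambda>\<omega>. real (class_count N C i t \<omega>)" and ?Y = "\<lambda>\<omega>. real (class_count N C j t \<omega>)"
  note X = has_bochner_integral_class_count[OF t i] and Y = has_bochner_integral_class_count[OF t j]
    and XY = has_bochner_integral_class_count_product[OF assms]
  define a where "a = p i * ml_term 1 t"
  define b where "b = p j * ml_term 1 t"
  have "covariance M ?X ?Y = (\<integral>\<omega>. (?X \<omega> - a) * (?Y \<omega> - b) \<partial>M)"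
    using X Y by (simp add: covariance_def has_bochner_integral_iff a_def b_def)
  also have "\<dots> = (\<integral>\<omega>. ?X \<omega> * ?Y \<omega> - b * ?X \<omega> - a * ?Y \<omega> + a * b \<partial>M)"
    by (intro Bochner_Integration.integral_cong) (auto simp: algebra_simps)
  also have "\<dots> = p i * p j * (2 * ml_term 2 t) - b * a - a * b + a * b"
    using X Y XY by (simp add: has_bochner_integral_iff M.prob_space a_def b_def)
  also have "\<dots> = p i * p j * (2 * ml_term 2 t - (ml_term 1 t)\<^sup>2)"
    by (simp add: a_def b_def algebra_simps power2_eq_square)
  also have "2 * ml_term 2 t - (ml_term 1 t)\<^sup>2
    = (lam powr \<alpha> * t powr \<alpha>)\<^sup>2 * (2 / Gamma (1 + 2 * \<alpha>) - 1 / (Gamma (1 + \<alpha>))\<^sup>2)"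
    by (simp add: ml_term_def power_divide right_diff_distrib mult.commute)
  also have "(lam powr \<alpha> * t powr \<alpha>)\<^sup>2 = lam powr (2 * \<alpha>) * t powr (2 * \<alpha>)"
    by (simp only: power_mult_distrib) (simp add: power2_eq_square powr_add[symmetric] flip: mult_2)
  finally show ?thesis by (simp add: mult_ac)
qed

end

section \<open>Inverse stable subordinators\<close>

text \<open>Support in [-1, 1] bounds the n-th term of the exponential series by |t|^n / n!, so the
  characteristic function is a series in the moments and Levy's uniqueness theorem applies.\<close>

lemma real_distribution_eqI_moments:
  assumes "real_distribution \<mu>" "real_distribution \<nu>"
    and \<mu>_le: "AE x in \<mu>. \<bar>x\<bar> \<le> 1" and \<nu>_le: "AE x in \<nu>. \<bar>x\<bar> \<le> 1"
    and moments: "\<And>n. (\<integral>x. x ^ n \<partial>\<mu>) = (\<integral>x. x ^ n \<partial>\<nu>)"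
  shows "\<mu> = \<nu>"
proof (rule Levy_uniqueness)
  have char_eq: "char \<eta> t = (\<Sum>n. (\<i> * complex_of_real t) ^ n /\<^sub>R fact n * complex_of_real (\<integral>x. x ^ n \<partial>\<eta>))"
    if "real_distribution \<eta>" and le: "AE x in \<eta>. \<bar>x\<bar> \<le> 1" for \<eta> t
  proof -
    interpret real_distribution \<eta> by fact
    define f where "f n x = (\<i> * complex_of_real t) ^ n /\<^sub>R fact n * complex_of_real (x ^ n)" for n and x :: real
    have bound: "AE x in \<eta>. norm (f n x) \<le> \<bar>t\<bar> ^ n /\<^sub>R fact n" for n
      using le
    proof eventually_elim
      case (elim x)
      then have "\<bar>x\<bar> ^ n \<le> 1" by (intro power_le_one) auto
      moreover have "norm (f n x) = \<bar>t\<bar> ^ n /\<^sub>R fact n * \<bar>x\<bar> ^ n"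
        by (simp add: f_def norm_mult norm_power power_abs)
      ultimately show ?case by (simp add: mult_left_le)
    qed
    have int: "integrable \<eta> (f n)" for n
      by (rule integrable_const_bound[OF bound]) (simp add: f_def)
    have sum_t: "summable (\<lambda>n. \<bar>t\<bar> ^ n /\<^sub>R fact n)"
      by (rule summable_exp_generic)
    have s1: "AE x in \<eta>. summable (\<lambda>n. norm (f n x))"
    proof -
      have "AE x in \<eta>. \<forall>n. norm (f n x) \<le> \<bar>t\<bar> ^ n /\<^sub>R fact n"
        using bound by (simp add: AE_all_countable)
      then show ?thesis
        by eventually_elim (rule summable_comparison_test'[OF sum_t, of 0], simp)
    qed
    have s2: "summable (\<lambda>n. \<integral>x. norm (f n x) \<partial>\<eta>)"
    proof (rule summable_comparison_test'[OF sum_t, of 0])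
      fix n
      have "(\<integral>x. norm (f n x) \<partial>\<eta>) \<le> \<bar>t\<bar> ^ n /\<^sub>R fact n"
        by (rule integral_le_const[OF integrable_norm[OF int] bound])
      then show "norm (\<integral>x. norm (f n x) \<partial>\<eta>) \<le> \<bar>t\<bar> ^ n /\<^sub>R fact n" by simp
    qed
    have "char \<eta> t = (\<integral>x. (\<Sum>n. f n x) \<partial>\<eta>)"
      unfolding char_def
    proof (rule Bochner_Integration.integral_cong[OF refl])
      fix x :: real
      have "f n x = (\<i> * complex_of_real (t * x)) ^ n /\<^sub>R fact n" for n
        by (simp add: f_def power_mult_distrib)
      then show "iexp (t * x) = (\<Sum>n. f n x)" by (simp add: exp_def)
    qed
    also have "\<dots> = (\<Sum>n. integral\<^sup>L \<eta> (f n))"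
      by (rule integral_suminf[OF int s1 s2])
    also have "\<dots> = (\<Sum>n. (\<i> * complex_of_real t) ^ n /\<^sub>R fact n * complex_of_real (\<integral>x. x ^ n \<partial>\<eta>))"
      unfolding f_def integral_mult_right_zero integral_complex_of_real ..
    finally show ?thesis .
  qed
  show "char \<mu> = char \<nu>"
    using char_eq[OF assms(1) \<mu>_le] char_eq[OF assms(2) \<nu>_le] moments by (simp add: fun_eq_iff)
qed fact+

text \<open>exp (-X) lies in [0, 1], and its n-th moment is the Laplace transform of X at n; natural
  arguments therefore suffice, and -ln recovers X.\<close>

lemma (in prob_space) distr_eqI_laplace:
  fixes X Y :: "'a \<Rightarrow> real"
  assumes [measurable]: "X \<in> borel_measurable M" "Y \<in> borel_measurable M"
    and nonneg: "AE \<omega> in M. 0 \<le> X \<omega>" "AE \<omega> in M. 0 \<le> Y \<omega>"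
    and laplace: "\<And>n. (\<integral>\<omega>. exp (- real n * X \<omega>) \<partial>M) = (\<integral>\<omega>. exp (- real n * Y \<omega>) \<partial>M)"
  shows "distr M borel X = distr M borel Y"
proof -
  have "distr M borel (\<lambda>\<omega>. exp (- X \<omega>)) = distr M borel (\<lambda>\<omega>. exp (- Y \<omega>))"
  proof (rule real_distribution_eqI_moments)
    fix n :: nat
    have e: "exp (- x) ^ n = exp (- real n * x)" for x :: real
      by (simp add: exp_of_nat_mult[symmetric])
    show "(\<integral>y. y ^ n \<partial>distr M borel (\<lambda>\<omega>. exp (- X \<omega>))) = (\<integral>y. y ^ n \<partial>distr M borel (\<lambda>\<omega>. exp (- Y \<omega>)))"
      using laplace[of n] by (simp add: integral_distr e)
  qed (use nonneg in \<open>auto simp: AE_distr_iff intro: real_distribution_distr\<close>)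
  then have "distr (distr M borel (\<lambda>\<omega>. exp (- X \<omega>))) borel (\<lambda>y. - ln y)
    = distr (distr M borel (\<lambda>\<omega>. exp (- Y \<omega>))) borel (\<lambda>y. - ln y)" by simp
  then show ?thesis by (simp add: distr_distr comp_def)
qed

text \<open>Right-continuity lets an open half-line be compared with a closed one at every u > s.
  First-passage events provide only this weaker comparison.\<close>

lemma cdf_le_of_open:
  assumes "real_distribution \<mu>" "real_distribution \<nu>"
    and le: "\<And>u. s < u \<Longrightarrow> measure \<mu> {..<u} \<le> cdf \<nu> u"
  shows "cdf \<mu> s \<le> cdf \<nu> s"
proof (rule tendsto_lowerbound)
  interpret \<mu>: real_distribution \<mu> by fact
  interpret \<nu>: finite_borel_measure \<nu> using assms(2) by (rule real_distribution.finite_borel_measure_M)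
  show "(cdf \<nu> \<longlongrightarrow> cdf \<nu> s) (at_right s)"
    using \<nu>.cdf_is_right_cont by (simp add: continuous_within)
  have "cdf \<mu> s \<le> cdf \<nu> u" if "s < u" for u
  proof -
    have "cdf \<mu> s \<le> measure \<mu> {..<u}"
      unfolding cdf_def using that by (intro \<mu>.finite_measure_mono) auto
    also have "\<dots> \<le> cdf \<nu> u" using that by (rule le)
    finally show ?thesis .
  qed
  then show "\<forall>\<^sub>F u in at_right s. cdf \<mu> s \<le> cdf \<nu> u"
    by (auto simp: eventually_at_filter)
qed simp

text \<open>The integrand may be unbounded near 0, as \<open>u powr (\<theta> - 1)\<close> is for
  \<theta> < 1, so F is only assumed continuous there. The part over [0, 1] uses the interior form
  of the fundamental theorem, the rest its form on a half-line.\<close>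

lemma nn_integral_FTC_nonneg_axis:
  fixes f F :: "real \<Rightarrow> real"
  assumes [measurable]: "f \<in> borel_measurable borel"
    and cont: "continuous_on {0..} F"
    and der: "\<And>x. 0 < x \<Longrightarrow> (F has_real_derivative f x) (at x)"
    and nonneg: "\<And>x. 0 \<le> x \<Longrightarrow> 0 \<le> f x"
    and lim: "(F \<longlongrightarrow> T) at_top"
  shows "(\<integral>\<^sup>+x. ennreal (f x) * indicator {0..} x \<partial>lborel) = ennreal (T - F 0)"
proof -
  have FTC: "(f has_integral (F 1 - F 0)) {0..1}"
    using cont der by (intro fundamental_theorem_of_calculus_interior)
      (auto simp: has_real_derivative_iff_has_vector_derivative[symmetric] elim: continuous_on_subset)
  have one: "(\<integral>\<^sup>+x. ennreal (f x) * indicator {0..1} x \<partial>lborel) = ennreal (F 1 - F 0)"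
    using nonneg by (intro nn_integral_has_integral_lebesgue' FTC) auto
  have two: "(\<integral>\<^sup>+x. ennreal (f x) * indicator {1..} x \<partial>lborel) = ennreal (T - F 1)"
    using der nonneg by (intro nn_integral_FTC_atLeast lim) auto
  have "F 0 \<le> F 1"
    using has_integral_nonneg[OF FTC] nonneg by auto
  moreover have "F 1 \<le> T"
  proof (rule tendsto_lowerbound[OF lim])
    show "\<forall>\<^sub>F x in at_top. F 1 \<le> F x"
      using eventually_ge_at_top[of 1]
    proof eventually_elim
      case (elim x)
      show ?case
      proof (rule DERIV_nonneg_imp_nondecreasing[OF elim])
        fix y :: real assume "1 \<le> y"
        then show "\<exists>d. (F has_real_derivative d) (at y) \<and> 0 \<le> d"
          using der[of y] nonneg[of y] by auto
      qed
    qed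
  qed simp
  moreover have "(\<integral>\<^sup>+x. ennreal (f x) * indicator {0..} x \<partial>lborel)
    = (\<integral>\<^sup>+x. ennreal (f x) * indicator {0..1} x + ennreal (f x) * indicator {1..} x \<partial>lborel)"
    by (intro nn_integral_cong_AE AE_I[of _ _ "{1}"]) (auto simp: indicator_def)
  ultimately show ?thesis
    by (simp add: nn_integral_add one two ennreal_plus[symmetric] del: ennreal_plus)
qed

text \<open>Presents a negative power as a mixture of exponentials, which is how a Laplace transform
  yields negative moments.\<close>

lemma nn_integral_Gamma_scaled:
  fixes a x :: real
  assumes "0 < a" "0 < x"
  shows "(\<integral>\<^sup>+u. ennreal (u powr (a - 1) * exp (- u * x)) * indicator {0..} u \<partial>lborel) = ennreal (Gamma a * x powr (- a))"
proof -
  have "ennreal (Gamma a) = ennreal x * (\<integral>\<^sup>+u. ennreal (indicator {0..} (x * u) * (x * u) powr (a - 1) / exp (x * u)) \<partial>lborel)"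
    using assms by (subst Gamma_conv_nn_integral_real, simp, subst nn_integral_real_affine[where c = x and t = 0]) auto
  also have "(\<integral>\<^sup>+u. ennreal (indicator {0..} (x * u) * (x * u) powr (a - 1) / exp (x * u)) \<partial>lborel)
    = (\<integral>\<^sup>+u. ennreal (x powr (a - 1)) * (ennreal (u powr (a - 1) * exp (- u * x)) * indicator {0..} u) \<partial>lborel)"
    using assms by (intro nn_integral_cong)
      (auto simp: indicator_def zero_le_mult_iff powr_mult exp_minus field_simps ennreal_mult[symmetric])
  also have "\<dots> = ennreal (x powr (a - 1)) * (\<integral>\<^sup>+u. ennreal (u powr (a - 1) * exp (- u * x)) * indicator {0..} u \<partial>lborel)"
    by (rule nn_integral_cmult) measurable
  also have "ennreal x * \<dots> = ennreal (x powr a) * (\<integral>\<^sup>+u. ennreal (u powr (a - 1) * exp (- u * x)) * indicator {0..} u \<partial>lborel)"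
    using assms by (simp add: mult.assoc[symmetric] ennreal_mult[symmetric] powr_mult_base)
  finally have "ennreal (x powr (- a)) * ennreal (Gamma a)
    = ennreal (x powr (- a) * x powr a) * (\<integral>\<^sup>+u. ennreal (u powr (a - 1) * exp (- u * x)) * indicator {0..} u \<partial>lborel)"
    by (simp add: mult.assoc[symmetric] ennreal_mult)
  then show ?thesis
    using assms by (simp add: powr_add[symmetric] ennreal_mult'' Gamma_real_pos mult.commute less_imp_le)
qed

lemma filterlim_powr_at_top:
  fixes \<theta> :: real
  assumes "0 < \<theta>"
  shows "filterlim (\<lambda>x. x powr \<theta>) at_top at_top"
proof -
  have "filterlim (\<lambda>x. exp (\<theta> * ln x)) at_top at_top"
    by (intro filterlim_compose[OF exp_at_top] filterlim_tendsto_pos_mult_at_top[OF tendsto_const assms] ln_at_top)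
  moreover have "\<forall>\<^sub>F x in at_top. exp (\<theta> * ln x) = x powr \<theta>"
    using eventually_gt_at_top[of 0] by eventually_elim (simp add: powr_def)
  ultimately show ?thesis by (rule filterlim_cong[THEN iffD1, OF refl refl, rotated])
qed

text \<open>With v = u^\<theta> the integral is 1/\<theta> times that of exp (-v); the next lemma
  has v exp (-v) instead, with the same value since Gamma 1 = Gamma 2 = 1.\<close>

lemma nn_integral_powr_exp_powr_1:
  fixes \<theta> :: real
  assumes "0 < \<theta>"
  shows "(\<integral>\<^sup>+u. ennreal (u powr (\<theta> - 1) * exp (- (u powr \<theta>))) * indicator {0..} u \<partial>lborel) = ennreal (1 / \<theta>)"
proof -
  have lim: "((\<lambda>u. - exp (- (u powr \<theta>)) / \<theta>) \<longlongrightarrow> 0) at_top"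
  proof -
    have "((\<lambda>u. exp (- (u powr \<theta>))) \<longlongrightarrow> 0) at_top"
      by (rule filterlim_compose[OF exp_at_bot])
         (rule filterlim_compose[OF filterlim_uminus_at_bot_at_top filterlim_powr_at_top[OF assms]])
    from tendsto_divide[OF tendsto_minus[OF this] tendsto_const[of \<theta>]] assms show ?thesis by simp
  qed
  have "(\<integral>\<^sup>+u. ennreal (u powr (\<theta> - 1) * exp (- (u powr \<theta>))) * indicator {0..} u \<partial>lborel)
    = ennreal (0 - (- exp (- (0 powr \<theta>)) / \<theta>))"
  proof (rule nn_integral_FTC_nonneg_axis[OF _ _ _ _ lim])
    show "continuous_on {0..} (\<lambda>u. - exp (- (u powr \<theta>)) / \<theta>)"
      using assms by (intro continuous_intros continuous_on_powr') auto
    show "((\<lambda>u. - exp (- (u powr \<theta>)) / \<theta>) has_real_derivative u powr (\<theta> - 1) * exp (- (u powr \<theta>))) (at u)"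
      if "0 < u" for u
      using that assms by (auto intro!: derivative_eq_intros simp: field_simps)
  qed auto
  then show ?thesis by simp
qed

lemma nn_integral_powr_exp_powr_2:
  fixes \<theta> :: real
  assumes "0 < \<theta>"
  shows "(\<integral>\<^sup>+u. ennreal (u powr (2 * \<theta> - 1) * exp (- (u powr \<theta>))) * indicator {0..} u \<partial>lborel) = ennreal (1 / \<theta>)"
proof -
  \<comment> \<open>An antiderivative of v exp (-v) is -(v + 1) exp (-v), taken at v = u^\<theta>
    and divided by \<theta>.\<close>
  define F where "F u = - ((u powr \<theta> + 1) * exp (- (u powr \<theta>))) / \<theta>" for u
  have lim: "(F \<longlongrightarrow> 0) at_top"
  proof -
    have "((\<lambda>v :: real. v ^ 1 / exp v + v ^ 0 / exp v) \<longlongrightarrow> 0 + 0) at_top"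
      by (intro tendsto_add tendsto_power_div_exp_0)
    then have "((\<lambda>v :: real. (v + 1) * exp (- v)) \<longlongrightarrow> 0) at_top"
      by (simp add: exp_minus field_simps)
    from filterlim_compose[OF this filterlim_powr_at_top[OF assms]]
    have "((\<lambda>u. (u powr \<theta> + 1) * exp (- (u powr \<theta>))) \<longlongrightarrow> 0) at_top" .
    from tendsto_divide[OF tendsto_minus[OF this] tendsto_const[of \<theta>]] assms show ?thesis
      by (simp add: F_def[abs_def])
  qed
  have "(\<integral>\<^sup>+u. ennreal (u powr (2 * \<theta> - 1) * exp (- (u powr \<theta>))) * indicator {0..} u \<partial>lborel) = ennreal (0 - F 0)"
  proof (rule nn_integral_FTC_nonneg_axis[OF _ _ _ _ lim])
    show "continuous_on {0..} F"
      unfolding F_def using assms by (intro continuous_intros continuous_on_powr') auto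
    show "(F has_real_derivative u powr (2 * \<theta> - 1) * exp (- (u powr \<theta>))) (at u)" if "0 < u" for u
    proof -
      define G where "G = (\<lambda>v :: real. - ((v + 1) * exp (- v)) / \<theta>)"
      have "(G has_real_derivative v * exp (- v) / \<theta>) (at v)" for v
        unfolding G_def using assms by (auto intro!: derivative_eq_intros simp: field_simps)
      moreover have "((\<lambda>u. u powr \<theta>) has_real_derivative \<theta> * u powr (\<theta> - 1)) (at u)"
        using that by (auto intro!: derivative_eq_intros)
      ultimately have "((\<lambda>u. G (u powr \<theta>)) has_real_derivative
          (u powr \<theta> * exp (- (u powr \<theta>)) / \<theta>) * (\<theta> * u powr (\<theta> - 1))) (at u)"
        by (rule DERIV_chain2)
      moreover have "(u powr \<theta> * exp (- (u powr \<theta>)) / \<theta>) * (\<theta> * u powr (\<theta> - 1))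
        = (u powr \<theta> * u powr (\<theta> - 1)) * exp (- (u powr \<theta>))"
        using assms by simp
      moreover have "u powr \<theta> * u powr (\<theta> - 1) = u powr (2 * \<theta> - 1)"
        by (simp add: powr_add[symmetric])
      ultimately show ?thesis by (simp add: F_def[abs_def] G_def)
    qed
  qed auto
  then show ?thesis by (simp add: F_def)
qed

section \<open>First passage and self-similarity of the stable subordinator\<close>

locale stable_subordinator_process = prob_space Q for Q :: "'b measure" +
  fixes L :: "real \<Rightarrow> 'b \<Rightarrow> real" and \<theta> :: real
  assumes theta_pos: "0 < \<theta>"
    and measurable_L [measurable]: "\<And>s. 0 \<le> s \<Longrightarrow> L s \<in> borel_measurable Q"
    and L_0: "AE \<omega> in Q. L 0 \<omega> = 0"
    and mono_L: "\<And>\<omega> s u. \<omega> \<in> space Q \<Longrightarrow> 0 \<le> s \<Longrightarrow> s \<le> u \<Longrightarrow> L s \<omega> \<le> L u \<omega>"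
    and laplace_L: "\<And>s t. 0 \<le> s \<Longrightarrow> 0 \<le> t \<Longrightarrow> (\<integral>\<omega>. exp (- t * L s \<omega>) \<partial>Q) = exp (- s * t powr \<theta>)"
begin

lemma L_nonneg: "AE \<omega> in Q. \<forall>s\<ge>0. 0 \<le> L s \<omega>"
  using L_0 AE_space
proof eventually_elim
  case (elim \<omega>)
  then show ?case using mono_L[of \<omega> 0] by auto
qed

text \<open>A non-integrable function would have integral 0, but the Laplace transform is
  positive.\<close>

lemma integrable_exp_L:
  assumes "0 \<le> s" "0 \<le> t"
  shows "integrable Q (\<lambda>\<omega>. exp (- t * L s \<omega>))"
proof (rule ccontr)
  assume "\<not> ?thesis"
  then have "(\<integral>\<omega>. exp (- t * L s \<omega>) \<partial>Q) = 0" by (rule not_integrable_integral_eq)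
  then show False using laplace_L[OF assms] by simp
qed

text \<open>Exponential Markov inequality. With t = 1 and growing s it shows that L is unbounded;
  with s = 1, x = 0 and t tending to infinity it shows that L(1) > 0 almost surely.\<close>

lemma prob_L_le:
  assumes "0 \<le> s" "0 \<le> t"
  shows "prob {\<omega> \<in> space Q. L s \<omega> \<le> x} \<le> exp (t * x - s * t powr \<theta>)"
proof -
  note [measurable] = measurable_L[OF assms(1)]
  have "prob {\<omega> \<in> space Q. L s \<omega> \<le> x} = (\<integral>\<omega>. indicator {\<omega> \<in> space Q. L s \<omega> \<le> x} \<omega> \<partial>Q)"
    by simp
  also have "\<dots> \<le> (\<integral>\<omega>. exp (t * x) * exp (- t * L s \<omega>) \<partial>Q)"
  proof (rule integral_mono)
    show "integrable Q (\<lambda>\<omega>. exp (t * x) * exp (- t * L s \<omega>))"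
      using integrable_exp_L[OF assms] by (rule integrable_mult_right)
    fix \<omega>
    show "indicator {\<omega> \<in> space Q. L s \<omega> \<le> x} \<omega> \<le> exp (t * x) * exp (- t * L s \<omega>)"
    proof (cases "L s \<omega> \<le> x")
      case True
      then have "0 \<le> t * x - t * L s \<omega>"
        using assms(2) by (simp add: mult_left_mono)
      then have "1 \<le> exp (t * x) * exp (- t * L s \<omega>)" by (simp add: exp_add[symmetric])
      then show ?thesis by (simp add: indicator_def)
    qed (simp add: indicator_def)
  qed (simp add: integrable_indicator_iff emeasure_eq_measure)
  also have "\<dots> = exp (t * x - s * t powr \<theta>)"
    using laplace_L[OF assms] by (simp add: exp_diff exp_minus divide_inverse)
  finally show ?thesis .
qed

lemma AE_L_unbounded: "AE \<omega> in Q. \<exists>n::nat. t < L (real n) \<omega>"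
proof -
  let ?A = "{\<omega> \<in> space Q. \<forall>n::nat. L (real n) \<omega> \<le> t}"
  have A: "?A \<in> sets Q" by measurable
  have "prob ?A \<le> exp (t - real n)" for n
  proof -
    have "prob ?A \<le> prob {\<omega> \<in> space Q. L (real n) \<omega> \<le> t}"
      by (intro finite_measure_mono) (auto, measurable)
    also have "\<dots> \<le> exp (t - real n)" using prob_L_le[of "real n" 1 t] by simp
    finally show ?thesis .
  qed
  moreover have "(\<lambda>n. exp (t - real n)) \<longlonglongrightarrow> 0"
  proof -
    have "(\<lambda>n. exp (- real n)) \<longlonglongrightarrow> 0"
      by (rule filterlim_compose[OF exp_at_bot])
         (rule filterlim_compose[OF filterlim_uminus_at_bot_at_top filterlim_real_sequentially])
    from tendsto_mult_right_zero[OF this, of "exp t"] show ?thesis by (simp add: exp_diff exp_minus divide_inverse)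
  qed
  ultimately have "prob ?A \<le> 0" by (intro LIMSEQ_le_const) auto
  then have "emeasure Q ?A = 0" by (simp add: emeasure_eq_measure measure_le_0_iff)
  then show ?thesis using A by (intro AE_I[of _ _ ?A]) (auto simp: not_less)
qed

lemma AE_L_1_pos: "AE \<omega> in Q. 0 < L 1 \<omega>"
proof -
  let ?A = "{\<omega> \<in> space Q. L 1 \<omega> \<le> 0}"
  have A: "?A \<in> sets Q" by measurable
  have "((\<lambda>t. exp (- (t powr \<theta>))) \<longlongrightarrow> 0) at_top"
    by (rule filterlim_compose[OF exp_at_bot])
       (rule filterlim_compose[OF filterlim_uminus_at_bot_at_top filterlim_powr_at_top[OF theta_pos]])
  moreover have "\<forall>\<^sub>F t in at_top. prob ?A \<le> exp (- (t powr \<theta>))"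
    using eventually_ge_at_top[of 0]
  proof eventually_elim
    case (elim t)
    then show ?case using prob_L_le[of 1 t 0] by simp
  qed
  ultimately have "prob ?A \<le> 0" by (rule tendsto_lowerbound) simp
  then have "emeasure Q ?A = 0" by (simp add: emeasure_eq_measure measure_le_0_iff)
  then show ?thesis using A by (intro AE_I[of _ _ ?A]) (auto simp: not_less)
qed

lemma distr_L_self_similar:
  assumes "0 < s"
  shows "distr Q borel (L s) = distr Q borel (\<lambda>\<omega>. s powr (1 / \<theta>) * L 1 \<omega>)"
proof (rule distr_eqI_laplace)
  show "L s \<in> borel_measurable Q" using assms by simp
  show "AE \<omega> in Q. 0 \<le> L s \<omega>" "AE \<omega> in Q. 0 \<le> s powr (1 / \<theta>) * L 1 \<omega>"
    using L_nonneg assms by auto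
  fix n :: nat
  have "(\<integral>\<omega>. exp (- real n * (s powr (1 / \<theta>) * L 1 \<omega>)) \<partial>Q) = exp (- ((real n * s powr (1 / \<theta>)) powr \<theta>))"
    using laplace_L[of 1 "real n * s powr (1 / \<theta>)"] by (simp add: mult_ac)
  also have "(real n * s powr (1 / \<theta>)) powr \<theta> = real n powr \<theta> * s"
    using assms theta_pos by (simp add: powr_mult powr_powr)
  finally show "(\<integral>\<omega>. exp (- real n * L s \<omega>) \<partial>Q) = (\<integral>\<omega>. exp (- real n * (s powr (1 / \<theta>) * L 1 \<omega>)) \<partial>Q)"
    using laplace_L[of s "real n"] assms by (simp add: mult_ac)
qed simp

lemma inverse_process_le:
  assumes "0 < s" "t < L s \<omega>"
  shows "inverse_process L t \<omega> \<le> s"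
  unfolding inverse_process_def
  by (rule cInf_lower) (use assms in \<open>auto intro: bdd_belowI[of _ 0]\<close>)

text \<open>The level u above t keeps the set of passage times nonempty, so that its infimum is
  meaningful.\<close>

lemma inverse_process_ge:
  assumes "\<omega> \<in> space Q" "t < L u \<omega>" "0 < u" "L s \<omega> \<le> t"
  shows "s \<le> inverse_process L t \<omega>"
  unfolding inverse_process_def
proof (rule cInf_greatest)
  show "{s. 0 < s \<and> t < L s \<omega>} \<noteq> {}" using assms by blast
  fix v assume v: "v \<in> {s. 0 < s \<and> t < L s \<omega>}"
  show "s \<le> v"
  proof (rule ccontr)
    assume "\<not> s \<le> v"
    then have "L v \<omega> \<le> L s \<omega>" using v by (intro mono_L[OF assms(1)]) auto
    then show False using v assms(4) by auto
  qed
qed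

lemma inverse_process_nonneg:
  assumes "\<omega> \<in> space Q" "t < L u \<omega>" "0 < u"
  shows "0 \<le> inverse_process L t \<omega>"
  unfolding inverse_process_def by (rule cInf_greatest) (use assms in auto)

lemma AE_exceeds: "AE \<omega> in Q. \<exists>u>0. t < L u \<omega>"
  using AE_L_unbounded[of t] AE_space
proof eventually_elim
  case (elim \<omega>)
  then obtain n :: nat where "t < L (real n) \<omega>" by blast
  also have "L (real n) \<omega> \<le> L (real n + 1) \<omega>" by (rule mono_L) (use elim in auto)
  finally show ?case by (intro exI[of _ "real n + 1"]) auto
qed

text \<open>By monotonicity the infimum is below a iff L exceeds t at some positive rational below
  a. Paths that never exceed t form a separate measurable event, on which the value is the constant
  \<open>Inf {}\<close>.\<close>

lemma measurable_inverse_process: "inverse_process L t \<in> borel_measurable Q"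
  unfolding borel_measurable_iff_less
proof
  fix a :: real
  let ?E = "\<lambda>\<omega>. \<exists>n::nat. t < L (real (Suc n)) \<omega>"
  \<comment> \<open>The absolute value makes the time argument nonnegative for every rational, so
    measurability of L applies to each member of the union.\<close>
  let ?R = "\<lambda>\<omega>. \<exists>q::rat. 0 < q \<and> of_rat q < a \<and> t < L (\<bar>of_rat q\<bar>) \<omega>"
  have [measurable]: "Measurable.pred Q (\<lambda>\<omega>. t < L (\<bar>of_rat q\<bar>) \<omega>)" for q :: rat
    using measurable_L[of "\<bar>of_rat q\<bar>"] by measurable
  have "inverse_process L t \<omega> < a \<longleftrightarrow> (?E \<omega> \<and> ?R \<omega>) \<or> (\<not> ?E \<omega> \<and> Inf ({} :: real set) < a)"
    if \<omega>: "\<omega> \<in> space Q" for \<omega>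
  proof (cases "?E \<omega>")
    case True
    then obtain n :: nat where n: "t < L (real (Suc n)) \<omega>" by blast
    have "inverse_process L t \<omega> < a \<longleftrightarrow> (\<exists>v. 0 < v \<and> t < L v \<omega> \<and> v < a)"
    proof -
      have "{s. 0 < s \<and> t < L s \<omega>} \<noteq> {}" using n by (auto intro!: exI[of _ "real (Suc n)"])
      moreover have "bdd_below {s. 0 < s \<and> t < L s \<omega>}" by (auto intro: bdd_belowI[of _ 0])
      ultimately show ?thesis unfolding inverse_process_def by (subst cInf_less_iff) auto
    qed
    also have "\<dots> \<longleftrightarrow> ?R \<omega>"
    proof
      assume "\<exists>v. 0 < v \<and> t < L v \<omega> \<and> v < a"
      then obtain v where v: "0 < v" "t < L v \<omega>" "v < a" by blast
      obtain q :: rat where q: "v < of_rat q" "of_rat q < a" using of_rat_dense[OF v(3)] by blast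
      have "0 < q" using v(1) q(1) by (metis less_trans zero_less_of_rat_iff)
      have "L v \<omega> \<le> L \<bar>of_rat q\<bar> \<omega>" using v q \<open>0 < q\<close> by (intro mono_L[OF \<omega>]) auto
      then show "?R \<omega>" using v(2) q(2) \<open>0 < q\<close> by (intro exI[of _ q]) auto
    next
      assume "?R \<omega>"
      then obtain q :: rat where q: "0 < q" "of_rat q < a" "t < L \<bar>of_rat q\<bar> \<omega>" by blast
      then show "\<exists>v. 0 < v \<and> t < L v \<omega> \<and> v < a"
        by (intro exI[of _ "of_rat q :: real"]) auto
    qed
    finally show ?thesis using True by blast
  next
    case False
    have "\<not> t < L v \<omega>" if "0 < v" for v
    proof
      assume "t < L v \<omega>"
      moreover obtain n :: nat where "v \<le> real n" using real_arch_simple by blast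
      ultimately have "t < L (real (Suc n)) \<omega>"
        using mono_L[OF \<omega>, of v "real (Suc n)"] \<open>0 < v\<close> by auto
      then show False using False by blast
    qed
    then have empty: "{s. 0 < s \<and> t < L s \<omega>} = {}" by auto
    show ?thesis unfolding inverse_process_def empty using False by simp
  qed
  then have "{\<omega> \<in> space Q. inverse_process L t \<omega> < a} =
      {\<omega> \<in> space Q. (?E \<omega> \<and> ?R \<omega>) \<or> (\<not> ?E \<omega> \<and> Inf ({} :: real set) < a)}"
    by auto
  also have "\<dots> \<in> sets Q" by measurable
  finally show "{\<omega> \<in> space Q. inverse_process L t \<omega> < a} \<in> sets Q" .
qed

text \<open>Almost surely {Y < u} is contained in {L(u) > t}, which is contained in {Y <= u}. By
  self-similarity the middle event has probability P(Z < u) with Z = (t / L(1))^\<theta>; hence the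
  two distribution functions bound each other. The equality in law is for one fixed t.\<close>

lemma distr_inverse_process:
  assumes t: "0 \<le> t"
  shows "distr Q borel (inverse_process L t) = distr Q borel (\<lambda>\<omega>. (t / L 1 \<omega>) powr \<theta>)"
proof -
  let ?Y = "inverse_process L t" and ?Z = "\<lambda>\<omega>. (t / L 1 \<omega>) powr \<theta>"
  note [measurable] = measurable_inverse_process[of t]
  have Z [measurable]: "?Z \<in> borel_measurable Q" by measurable
  have Zlt: "prob {\<omega> \<in> space Q. ?Z \<omega> < u} = prob {\<omega> \<in> space Q. t < L u \<omega>}" if u: "0 < u" for u
  proof -
    have [measurable]: "L u \<in> borel_measurable Q" using u by simp
    have "prob {\<omega> \<in> space Q. t < L u \<omega>} = measure (distr Q borel (L u)) {t<..}"
      by (subst measure_distr) (auto intro!: arg_cong[where f = prob])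
    also have "\<dots> = prob {\<omega> \<in> space Q. t < u powr (1 / \<theta>) * L 1 \<omega>}"
      unfolding distr_L_self_similar[OF u] by (subst measure_distr) (auto intro!: arg_cong[where f = prob])
    also have "\<dots> = prob {\<omega> \<in> space Q. ?Z \<omega> < u}"
    proof (rule finite_measure_eq_AE)
      show "AE \<omega> in Q. \<omega> \<in> {\<omega> \<in> space Q. t < u powr (1 / \<theta>) * L 1 \<omega>} \<longleftrightarrow> \<omega> \<in> {\<omega> \<in> space Q. ?Z \<omega> < u}"
        using AE_L_1_pos
      proof eventually_elim
        case (elim \<omega>)
        have "t < u powr (1 / \<theta>) * L 1 \<omega> \<longleftrightarrow> t / L 1 \<omega> < u powr (1 / \<theta>)"
          using elim by (simp add: pos_divide_less_eq)
        also have "\<dots> \<longleftrightarrow> ?Z \<omega> < (u powr (1 / \<theta>)) powr \<theta>"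
        proof
          have "0 \<le> t / L 1 \<omega>" using elim t by simp
          then show "?Z \<omega> < (u powr (1 / \<theta>)) powr \<theta>" if "t / L 1 \<omega> < u powr (1 / \<theta>)"
            using that by (intro powr_less_mono2 theta_pos)
          show "t / L 1 \<omega> < u powr (1 / \<theta>)" if less: "?Z \<omega> < (u powr (1 / \<theta>)) powr \<theta>"
          proof (rule ccontr)
            assume "\<not> t / L 1 \<omega> < u powr (1 / \<theta>)"
            then have "(u powr (1 / \<theta>)) powr \<theta> \<le> ?Z \<omega>"
              using theta_pos by (intro powr_mono2) auto
            then show False using less by simp
          qed
        qed
        also have "(u powr (1 / \<theta>)) powr \<theta> = u" using u theta_pos by (simp add: powr_powr)
        finally show ?case by simp
      qed
    qed measurable
    finally show ?thesis ..
  qed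
  have rd: "real_distribution (distr Q borel ?Y)" "real_distribution (distr Q borel ?Z)"
    by (auto intro: real_distribution_distr)
  have cdf: "cdf (distr Q borel X) x = prob {\<omega> \<in> space Q. X \<omega> \<le> x}"
    and opn: "measure (distr Q borel X) {..<x} = prob {\<omega> \<in> space Q. X \<omega> < x}"
    if [measurable]: "X \<in> borel_measurable Q" for X x
    unfolding cdf_def by (auto simp: measure_distr intro!: arg_cong[where f = prob])
  have "cdf (distr Q borel ?Y) = cdf (distr Q borel ?Z)"
  proof
    fix s
    show "cdf (distr Q borel ?Y) s = cdf (distr Q borel ?Z) s"
    proof (cases "s < 0")
      case True
      have "prob {\<omega> \<in> space Q. ?Y \<omega> \<le> s} = prob {}"
      proof (rule finite_measure_eq_AE)
        show "AE \<omega> in Q. \<omega> \<in> {\<omega> \<in> space Q. ?Y \<omega> \<le> s} \<longleftrightarrow> \<omega> \<in> {}"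
          using AE_exceeds[of t] AE_space
        proof eventually_elim
          case (elim \<omega>)
          then have "0 \<le> ?Y \<omega>" using inverse_process_nonneg by blast
          then show ?case using True by auto
        qed
      qed measurable
      moreover have "{\<omega> \<in> space Q. ?Z \<omega> \<le> s} = {}"
        using True by (auto simp: not_le intro: less_le_trans[OF _ powr_ge_zero])
      ultimately have "prob {\<omega> \<in> space Q. ?Y \<omega> \<le> s} = prob {\<omega> \<in> space Q. ?Z \<omega> \<le> s}"
        by (simp only:)
      then show ?thesis by (simp add: cdf)
    next
      case False
      then have s: "0 \<le> s" by simp
      show ?thesis
      proof (rule antisym)
        show "cdf (distr Q borel ?Y) s \<le> cdf (distr Q borel ?Z) s"
        proof (rule cdf_le_of_open[OF rd])
          fix u assume "s < u"
          then have u: "0 < u" using s by simp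
          then have [measurable]: "L u \<in> borel_measurable Q" by simp
          have "prob {\<omega> \<in> space Q. ?Y \<omega> < u} \<le> prob {\<omega> \<in> space Q. t < L u \<omega>}"
          proof (rule finite_measure_mono_AE)
            show "AE \<omega> in Q. \<omega> \<in> {\<omega> \<in> space Q. ?Y \<omega> < u} \<longrightarrow> \<omega> \<in> {\<omega> \<in> space Q. t < L u \<omega>}"
              using AE_exceeds[of t] AE_space
            proof eventually_elim
              case (elim \<omega>)
              then show ?case using inverse_process_ge[of \<omega> t _ u] by (auto simp: not_less[symmetric])
            qed
          qed measurable
          also have "\<dots> \<le> prob {\<omega> \<in> space Q. ?Z \<omega> \<le> u}"
            unfolding Zlt[OF u, symmetric] by (intro finite_measure_mono) auto
          finally show "measure (distr Q borel ?Y) {..<u} \<le> cdf (distr Q borel ?Z) u"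
            by (simp add: cdf opn)
        qed
        show "cdf (distr Q borel ?Z) s \<le> cdf (distr Q borel ?Y) s"
        proof (rule cdf_le_of_open[OF rd(2,1)])
          fix u assume "s < u"
          then have u: "0 < u" using s by simp
          have "prob {\<omega> \<in> space Q. ?Z \<omega> < u} \<le> prob {\<omega> \<in> space Q. ?Y \<omega> \<le> u}"
            unfolding Zlt[OF u] using inverse_process_le[OF u] by (intro finite_measure_mono) auto
          then show "measure (distr Q borel ?Z) {..<u} \<le> cdf (distr Q borel ?Y) u"
            by (simp add: cdf opn)
        qed
      qed
    qed
  qed
  then show ?thesis by (rule cdf_unique[OF rd])
qed

text \<open>Mixing exponentials as in the Gamma integral and exchanging by Tonelli leaves the
  Laplace transform exp (-u^\<theta>) of L(1) under the u-integral, whose value c is a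
  parameter.\<close>

lemma nn_integral_L_1_powr:
  assumes a: "0 < a" and I: "0 \<le> c"
    "(\<integral>\<^sup>+u. ennreal (u powr (a - 1) * exp (- (u powr \<theta>))) * indicator {0..} u \<partial>lborel) = ennreal c"
  shows "(\<integral>\<^sup>+\<omega>. ennreal (L 1 \<omega> powr (- a)) \<partial>Q) = ennreal (c / Gamma a)"
proof -
  have G: "0 < Gamma a" using a by (rule Gamma_real_pos)
  have "ennreal (Gamma a) * (\<integral>\<^sup>+\<omega>. ennreal (L 1 \<omega> powr (- a)) \<partial>Q)
    = (\<integral>\<^sup>+\<omega>. ennreal (Gamma a) * ennreal (L 1 \<omega> powr (- a)) \<partial>Q)"
    by (rule nn_integral_cmult[symmetric]) measurable
  also have "\<dots> = (\<integral>\<^sup>+\<omega>. (\<integral>\<^sup>+u. ennreal (u powr (a - 1) * exp (- u * L 1 \<omega>)) * indicator {0..} u \<partial>lborel) \<partial>Q)"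
  proof (rule nn_integral_cong_AE)
    show "AE \<omega> in Q. ennreal (Gamma a) * ennreal (L 1 \<omega> powr (- a))
      = (\<integral>\<^sup>+u. ennreal (u powr (a - 1) * exp (- u * L 1 \<omega>)) * indicator {0..} u \<partial>lborel)"
      using AE_L_1_pos
    proof eventually_elim
      case (elim \<omega>)
      then show ?case using nn_integral_Gamma_scaled[OF a elim] G by (simp add: ennreal_mult)
    qed
  qed
  also have "\<dots> = (\<integral>\<^sup>+u. (\<integral>\<^sup>+\<omega>. ennreal (u powr (a - 1) * exp (- u * L 1 \<omega>)) * indicator {0..} u \<partial>Q) \<partial>lborel)"
  proof (rule pair_sigma_finite.Fubini'[symmetric])
    show "pair_sigma_finite Q lborel"
      by (intro pair_sigma_finite.intro sigma_finite_measure_axioms lborel.sigma_finite_measure_axioms)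
  qed measurable
  also have "\<dots> = (\<integral>\<^sup>+u. ennreal (u powr (a - 1) * exp (- (u powr \<theta>))) * indicator {0..} u \<partial>lborel)"
  proof (rule nn_integral_cong)
    fix u :: real
    show "(\<integral>\<^sup>+\<omega>. ennreal (u powr (a - 1) * exp (- u * L 1 \<omega>)) * indicator {0..} u \<partial>Q)
      = ennreal (u powr (a - 1) * exp (- (u powr \<theta>))) * indicator {0..} u"
    proof (cases "0 \<le> u")
      case True
      have "(\<integral>\<^sup>+\<omega>. ennreal (u powr (a - 1) * exp (- u * L 1 \<omega>)) * indicator {0..} u \<partial>Q)
        = (\<integral>\<^sup>+\<omega>. ennreal (u powr (a - 1)) * ennreal (exp (- u * L 1 \<omega>)) \<partial>Q)"
        using True by (intro nn_integral_cong) (simp add: ennreal_mult)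
      also have "\<dots> = ennreal (u powr (a - 1)) * (\<integral>\<^sup>+\<omega>. ennreal (exp (- u * L 1 \<omega>)) \<partial>Q)"
        by (rule nn_integral_cmult) measurable
      also have "(\<integral>\<^sup>+\<omega>. ennreal (exp (- u * L 1 \<omega>)) \<partial>Q) = ennreal (exp (- (u powr \<theta>)))"
        using integrable_exp_L[of 1 u] laplace_L[of 1 u] True by (subst nn_integral_eq_integral) auto
      finally show ?thesis using True by (simp add: ennreal_mult)
    qed simp
  qed
  also have "\<dots> = ennreal c" by (rule I)
  finally have e: "ennreal (Gamma a) * (\<integral>\<^sup>+\<omega>. ennreal (L 1 \<omega> powr (- a)) \<partial>Q) = ennreal c" .
  have "(\<integral>\<^sup>+\<omega>. ennreal (L 1 \<omega> powr (- a)) \<partial>Q)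
    = ennreal (inverse (Gamma a) * Gamma a) * (\<integral>\<^sup>+\<omega>. ennreal (L 1 \<omega> powr (- a)) \<partial>Q)"
    using G by simp
  also have "\<dots> = ennreal (inverse (Gamma a)) * ennreal c"
    unfolding e[symmetric] using G by (subst ennreal_mult) (auto simp: mult.assoc)
  also have "\<dots> = ennreal (c / Gamma a)"
    using G I(1) by (subst ennreal_mult[symmetric]) (auto simp: divide_inverse mult.commute)
  finally show ?thesis .
qed

lemma has_bochner_integral_inverse_process_power:
  assumes t: "0 \<le> t" and k: "0 < k" and c: "0 \<le> c"
    "(\<integral>\<^sup>+u. ennreal (u powr (real k * \<theta> - 1) * exp (- (u powr \<theta>))) * indicator {0..} u \<partial>lborel) = ennreal c"
  shows "has_bochner_integral Q (\<lambda>\<omega>. inverse_process L t \<omega> ^ k) (t powr (real k * \<theta>) * (c / Gamma (real k * \<theta>)))"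
proof -
  note [measurable] = measurable_inverse_process[of t]
  let ?v = "t powr (real k * \<theta>) * (c / Gamma (real k * \<theta>))"
  have a: "0 < real k * \<theta>" using k theta_pos by simp
  have v: "0 \<le> ?v" using c(1) Gamma_real_pos[OF a] by simp
  have "has_bochner_integral Q (\<lambda>\<omega>. ((t / L 1 \<omega>) powr \<theta>) ^ k) ?v"
  proof (rule has_bochner_integral_nn_integral)
    have "(\<integral>\<^sup>+\<omega>. ennreal (((t / L 1 \<omega>) powr \<theta>) ^ k) \<partial>Q)
      = (\<integral>\<^sup>+\<omega>. ennreal (t powr (real k * \<theta>)) * ennreal (L 1 \<omega> powr (- (real k * \<theta>))) \<partial>Q)"
    proof (rule nn_integral_cong_AE)
      show "AE \<omega> in Q. ennreal (((t / L 1 \<omega>) powr \<theta>) ^ k)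
        = ennreal (t powr (real k * \<theta>)) * ennreal (L 1 \<omega> powr (- (real k * \<theta>)))"
        using AE_L_1_pos
      proof eventually_elim
        case (elim \<omega>)
        have "((t / L 1 \<omega>) powr \<theta>) ^ k = (t / L 1 \<omega>) powr (real k * \<theta>)"
          using k by (simp add: powr_powr powr_realpow'[symmetric] mult.commute)
        also have "\<dots> = t powr (real k * \<theta>) * L 1 \<omega> powr (- (real k * \<theta>))"
          using elim t by (simp add: powr_divide powr_minus_divide)
        finally show ?case by (simp add: ennreal_mult)
      qed
    qed
    also have "\<dots> = ennreal (t powr (real k * \<theta>)) * (\<integral>\<^sup>+\<omega>. ennreal (L 1 \<omega> powr (- (real k * \<theta>))) \<partial>Q)"
      by (rule nn_integral_cmult) measurable
    also have "\<dots> = ennreal ?v"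
      unfolding nn_integral_L_1_powr[OF a c] using c(1) Gamma_real_pos[OF a]
      by (subst ennreal_mult[symmetric]) auto
    finally show "(\<integral>\<^sup>+\<omega>. ennreal (((t / L 1 \<omega>) powr \<theta>) ^ k) \<partial>Q) = ennreal ?v" .
  qed (use v in auto)
  then have "has_bochner_integral (distr Q borel (\<lambda>\<omega>. (t / L 1 \<omega>) powr \<theta>)) (\<lambda>y. y ^ k) ?v"
    by (intro has_bochner_integral_distr) auto
  then have "has_bochner_integral (distr Q borel (inverse_process L t)) (\<lambda>y. y ^ k) ?v"
    unfolding distr_inverse_process[OF t] .
  then show ?thesis
    by (simp add: has_bochner_integral_iff integrable_distr_eq integral_distr)
qed

text \<open>Since (1/\<theta>) / Gamma (k \<theta>) = k / Gamma (1 + k \<theta>), the first two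
  moments are t^\<theta> / Gamma (1 + \<theta>) and 2 t^(2 \<theta>) / Gamma (1 + 2 \<theta>). Up to
  powers of lam^\<theta> these are E N and E N(N-1), which makes the covariance a multiple of this
  variance.\<close>

lemma variance_inverse_process:
  assumes t: "0 \<le> t"
  shows "integrable Q (\<lambda>\<omega>. (inverse_process L t \<omega>)\<^sup>2)"
    and "variance (inverse_process L t) = t powr (2 * \<theta>) * (2 / Gamma (1 + 2 * \<theta>) - 1 / (Gamma (1 + \<theta>))\<^sup>2)"
proof -
  have c: "0 \<le> 1 / \<theta>" using theta_pos by simp
  have G: "Gamma (1 + a) = a * Gamma a" if "0 < a" for a :: real
  proof -
    have "a \<notin> \<int>\<^sub>\<le>\<^sub>0" using that by (auto dest: nonpos_Ints_nonpos)
    then show ?thesis using Gamma_plus1[of a] by (simp add: add.commute)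
  qed
  have 1: "has_bochner_integral Q (inverse_process L t) (t powr \<theta> / Gamma (1 + \<theta>))"
    using has_bochner_integral_inverse_process_power[OF t, of 1 "1 / \<theta>"] c
      nn_integral_powr_exp_powr_1[OF theta_pos] G[OF theta_pos] by simp
  have 2: "has_bochner_integral Q (\<lambda>\<omega>. (inverse_process L t \<omega>)\<^sup>2) (t powr (2 * \<theta>) * (2 / Gamma (1 + 2 * \<theta>)))"
    using has_bochner_integral_inverse_process_power[OF t, of 2 "1 / \<theta>"] c
      nn_integral_powr_exp_powr_2[OF theta_pos] G[of "2 * \<theta>"] theta_pos by simp
  show "integrable Q (\<lambda>\<omega>. (inverse_process L t \<omega>)\<^sup>2)" using 2 by (simp add: has_bochner_integral_iff)
  have "variance (inverse_process L t) = t powr (2 * \<theta>) * (2 / Gamma (1 + 2 * \<theta>)) - (t powr \<theta> / Gamma (1 + \<theta>))\<^sup>2"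
    using 1 2 by (subst variance_eq) (auto simp: has_bochner_integral_iff)
  also have "(t powr \<theta> / Gamma (1 + \<theta>))\<^sup>2 = t powr (2 * \<theta>) * (1 / (Gamma (1 + \<theta>))\<^sup>2)"
    by (simp add: power2_eq_square powr_add[symmetric] flip: mult_2)
  finally show "variance (inverse_process L t) = t powr (2 * \<theta>) * (2 / Gamma (1 + 2 * \<theta>) - 1 / (Gamma (1 + \<theta>))\<^sup>2)"
    by (simp add: right_diff_distrib)
qed

end

section \<open>The classified process\<close>

lemma sum_class_count:
  assumes "finite B"
  shows "(\<Sum>j\<in>B. class_count N C j t \<omega>) = card {n. n < N t \<omega> \<and> C n \<omega> \<in> B}"
proof -
  have "(\<Sum>j\<in>B. class_count N C j t \<omega>) = (\<Sum>j\<in>B. \<Sum>n<N t \<omega>. if C n \<omega> = j then 1 else 0)"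
    unfolding class_count_def using card_marks_eq_sum[of "N t \<omega>" "\<lambda>n. C n \<omega>" "{_}"] by simp
  also have "\<dots> = (\<Sum>n<N t \<omega>. \<Sum>j\<in>B. if C n \<omega> = j then 1 else 0)"
    by (rule sum.swap)
  also have "\<dots> = (\<Sum>n<N t \<omega>. if C n \<omega> \<in> B then 1 else 0)"
    using assms by (intro sum.cong) auto
  finally show ?thesis unfolding card_marks_eq_sum .
qed

lemma stable_subordinator_processI:
  assumes "stable_subordinator Q \<theta> L" "0 < \<theta>"
  shows "stable_subordinator_process Q L \<theta>"
proof -
  have levy: "levy_process Q L" and mono: "\<And>\<omega>. \<omega> \<in> space Q \<Longrightarrow> mono_on {0..} (\<lambda>s. L s \<omega>)"
    and laplace: "\<And>s t. 0 \<le> s \<Longrightarrow> 0 \<le> t \<Longrightarrow> (\<integral>\<omega>. exp (- t * L s \<omega>) \<partial>Q) = exp (- s * t powr \<theta>)"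
    using assms(1) by (auto simp: stable_subordinator_def)
  interpret prob_space Q using levy by (simp add: levy_process_def)
  show ?thesis
  proof
    show "L s \<in> borel_measurable Q" if "0 \<le> s" for s using levy that by (simp add: levy_process_def)
    show "AE \<omega> in Q. L 0 \<omega> = 0" using levy by (simp add: levy_process_def)
    show "L s \<omega> \<le> L u \<omega>" if "\<omega> \<in> space Q" "0 \<le> s" "s \<le> u" for \<omega> s u
      using that by (intro mono_onD[OF mono]) auto
  qed (use assms(2) laplace in auto)
qed

text \<open>The spaces M and Q are unrelated: the identity with the variance compares two numbers,
  not processes on a common space.\<close>

theorem corollary2p4:
  fixes M :: "'a measure" and N :: "real \<Rightarrow> 'a \<Rightarrow> nat" and C :: "nat \<Rightarrow> 'a \<Rightarrow> nat"
    and \<alpha> lam :: real and K :: nat and p :: "nat \<Rightarrow> real"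
    and Q :: "'b measure" and L :: "real \<Rightarrow> 'b \<Rightarrow> real"
  assumes "0 < \<alpha>" and "\<alpha> \<le> 1" and "0 < lam" and "1 \<le> K"
    and "\<forall>i\<in>{1..K}. 0 < p i" and "(\<Sum>i=1..K. p i) = 1"
    and "prob_space M"
    and "has_FPP_law M N \<alpha> lam"
    and "independent_classes M N C K p"
  shows
    "(\<forall>(s :: nat \<Rightarrow> real) t. 0 \<le> t \<longrightarrow>
        has_bochner_integral M
          (\<lambda>\<omega>. exp (\<Sum>i=1..K. s i * real (class_count N C i t \<omega>)))
          (mittag_leffler \<alpha>
             (lam powr \<alpha> * t powr \<alpha> * (\<Sum>i=1..K. p i * (exp (s i) - 1))))) \<and>
     (\<forall>i\<in>{1..K}. has_FPP_law M (class_count N C i) \<alpha> (lam * p i powr (1 / \<alpha>))) \<and>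
     (\<forall>l\<in>{1..K}. has_FPP_law M (\<lambda>t \<omega>. \<Sum>j=1..l. class_count N C j t \<omega>) \<alpha>
        (lam * (\<Sum>j=1..l. p j) powr (1 / \<alpha>))) \<and>
     (\<forall>t i j. 0 \<le> t \<longrightarrow> i \<in> {1..K} \<longrightarrow> j \<in> {1..K} \<longrightarrow> i \<noteq> j \<longrightarrow>
        integrable M (\<lambda>\<omega>. (real (class_count N C i t \<omega>))\<^sup>2) \<and>
        integrable M (\<lambda>\<omega>. (real (class_count N C j t \<omega>))\<^sup>2) \<and>
        covariance M (\<lambda>\<omega>. real (class_count N C i t \<omega>)) (\<lambda>\<omega>. real (class_count N C j t \<omega>)) =
          p i * p j * lam powr (2 * \<alpha>) * t powr (2 * \<alpha>) *
            (2 / Gamma (1 + 2 * \<alpha>) - 1 / (Gamma (1 + \<alpha>))\<^sup>2) \<and>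
        (stable_subordinator Q \<alpha> L \<longrightarrow>
           integrable Q (\<lambda>\<omega>. (inverse_process L t \<omega>)\<^sup>2) \<and>
           p i * p j * lam powr (2 * \<alpha>) * t powr (2 * \<alpha>) *
             (2 / Gamma (1 + 2 * \<alpha>) - 1 / (Gamma (1 + \<alpha>))\<^sup>2) =
           p i * p j * lam powr (2 * \<alpha>) * prob_space.variance Q (inverse_process L t)))"
proof -
  interpret prob_space M by fact
  have measurable_N: "\<And>t. 0 \<le> t \<Longrightarrow> N t \<in> measurable M (count_space UNIV)"
    using assms(8) by (simp add: has_FPP_law_def)
  obtain \<rho> where \<rho>: "real_distribution \<rho>" "\<And>x. cdf \<rho> x = ml_cdf \<alpha> lam x"
    and law: "process_law M N = process_law (\<Pi>\<^sub>M k\<in>(UNIV :: nat set). \<rho>) renewal_count"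
    using assms(8) by (auto simp: has_FPP_law_def)
  interpret \<rho>: real_distribution \<rho> by fact
  interpret classified_renewal \<rho> \<alpha> lam M N C "{1..K}" p
  proof
    show "indep_sets (case_option (events_of M path_space (path N))
        (\<lambda>n. events_of M (count_space {1..K}) (C n))) UNIV"
      using assms(9) unfolding independent_classes_def by blast
    show "C n \<in> measurable M (count_space {1..K})" for n
      using assms(9) unfolding independent_classes_def by blast
    show "measure M {\<omega> \<in> space M. C n \<omega> = i} = p i" if "i \<in> {1..K}" for n i
      using assms(9) that unfolding independent_classes_def by blast
    show "0 < p i" if "i \<in> {1..K}" for i using assms(5) that by blast
  qed (use assms(1,3) \<rho>(2) measurable_N law in auto)
  show ?thesis
  proof (intro conjI allI ballI impI)
    fix s :: "nat \<Rightarrow> real" and t :: real assume "0 \<le> t"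
    then show "has_bochner_integral M (\<lambda>\<omega>. exp (\<Sum>i=1..K. s i * real (class_count N C i t \<omega>)))
        (mittag_leffler \<alpha> (lam powr \<alpha> * t powr \<alpha> * (\<Sum>i=1..K. p i * (exp (s i) - 1))))"
      using assms(6) by (rule has_bochner_integral_exp_class_counts)
  next
    fix i assume "i \<in> {1..K}"
    then have "has_FPP_law M (\<lambda>t \<omega>. card {n. n < N t \<omega> \<and> C n \<omega> \<in> {i}}) \<alpha> (lam * (\<Sum>i\<in>{i}. p i) powr (1 / \<alpha>))"
      by (intro has_FPP_law_classes) auto
    then show "has_FPP_law M (class_count N C i) \<alpha> (lam * p i powr (1 / \<alpha>))"
      by (simp add: class_count_def[abs_def])
  next
    fix l assume "l \<in> {1..K}"
    then have "has_FPP_law M (\<lambda>t \<omega>. card {n. n < N t \<omega> \<and> C n \<omega> \<in> {1..l}}) \<alpha> (lam * (\<Sum>j=1..l. p j) powr (1 / \<alpha>))"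
      by (intro has_FPP_law_classes) auto
    then show "has_FPP_law M (\<lambda>t \<omega>. \<Sum>j=1..l. class_count N C j t \<omega>) \<alpha> (lam * (\<Sum>j=1..l. p j) powr (1 / \<alpha>))"
      by (simp only: sum_class_count finite_atLeastAtMost)
  next
    fix t :: real and i j assume t: "0 \<le> t" and ij: "i \<in> {1..K}" "j \<in> {1..K}" "i \<noteq> j"
    show "integrable M (\<lambda>\<omega>. (real (class_count N C i t \<omega>))\<^sup>2)" "integrable M (\<lambda>\<omega>. (real (class_count N C j t \<omega>))\<^sup>2)"
      using t by (rule integrable_class_count_square)+
    show "covariance M (\<lambda>\<omega>. real (class_count N C i t \<omega>)) (\<lambda>\<omega>. real (class_count N C j t \<omega>)) =
        p i * p j * lam powr (2 * \<alpha>) * t powr (2 * \<alpha>) * (2 / Gamma (1 + 2 * \<alpha>) - 1 / (Gamma (1 + \<alpha>))\<^sup>2)"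
      using t ij by (rule covariance_class_counts)
    assume "stable_subordinator Q \<alpha> L"
    then interpret S: stable_subordinator_process Q L \<alpha>
      using assms(1) by (rule stable_subordinator_processI)
    show "integrable Q (\<lambda>\<omega>. (inverse_process L t \<omega>)\<^sup>2)"
      using t by (rule S.variance_inverse_process)
    show "p i * p j * lam powr (2 * \<alpha>) * t powr (2 * \<alpha>) * (2 / Gamma (1 + 2 * \<alpha>) - 1 / (Gamma (1 + \<alpha>))\<^sup>2) =
        p i * p j * lam powr (2 * \<alpha>) * prob_space.variance Q (inverse_process L t)"
      unfolding S.variance_inverse_process(2)[OF t] by (simp only: mult.assoc)
  qed
qed

end
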